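(* Let $S_{1,1}$ be a surface of genus one with one puncture, let $a,b$ be standard generators of the free group $\pi_1(S_{1,1})=F(a,b)$, and let $T_{1,1}$ be the Teichmüller space of $S_{1,1}$. There exists a unique $g\in T_{1,1}$ such that $$\mathrm{Tr}_g(a)=\mathrm{Tr}_g(b),\qquad \mathrm{Tr}_g(a^2)=\mathrm{Tr}_g(a^2b).$$
   Context: $T_{1,1}$ is the space of complete finite-area hyperbolic metrics on $S_{1,1}$ up to isotopy. For $\gamma\in\pi_1(S_{1,1})$, $\ell_g(\gamma)$ is the length of the closed geodesic freely homotopic to $\gamma$ ($0$ if $\gamma$ is parabolic or trivial) and $\mathrm{Tr}_g(\gamma)=2\cosh(\ell_g(\gamma)/2)$. Standard generators $a,b$ are free generators whose commutator represents a loop around the puncture. A point $g\in T_{1,1}$ is uniquely determined by its Fricke coordinates $(x,y,z)=(\mathrm{Tr}_g(a),\mathrm{Tr}_g(b),\mathrm{Tr}_g(ab))$, and the triples which occur are exactly those with $x^2+y^2+z^2-xyz=0$, $x>2$, $y>2$, $z>2$. *)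

theory Defs
  imports "HOL-Analysis.Analysis" "HOL-Algebra.Algebra"
begin

section \<open>The hyperbolic plane\<close>

definition hyp_plane :: "complex set" where
  "hyp_plane = {z. Im z > 0}"

definition hyp_dist :: "complex \<Rightarrow> complex \<Rightarrow> real" where
  "hyp_dist z w = arcosh (1 + (cmod (z - w))\<^sup>2 / (2 * Im z * Im w))"

text \<open>Hyperbolic area, i.e. the measure \<open>dx dy / y\<^sup>2\<close>.\<close>

definition hyp_area :: "complex set \<Rightarrow> ennreal" where
  "hyp_area D = (\<integral>\<^sup>+ z\<in>D. ennreal (1 / (Im z)\<^sup>2) \<partial>lborel)"

definition hyp_isometry :: "(complex \<Rightarrow> complex) \<Rightarrow> bool" where
  "hyp_isometry f \<longleftrightarrow> bij_betw f hyp_plane hyp_plane \<and>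
     (\<forall>z\<in>hyp_plane. \<forall>w\<in>hyp_plane. hyp_dist (f z) (f w) = hyp_dist z w)"

text \<open>The action of a real matrix of determinant \<open>1\<close>. Being extensional, these maps are elements
  of \<^term>\<open>carrier (BijGroup hyp_plane)\<close>; two matrices give the same map iff they agree up to sign.\<close>

definition real_moebius :: "real \<Rightarrow> real \<Rightarrow> real \<Rightarrow> real \<Rightarrow> complex \<Rightarrow> complex" where
  "real_moebius p q r s =
     (\<lambda>z\<in>hyp_plane. (of_real p * z + of_real q) / (of_real r * z + of_real s))"

text \<open>\<open>PSL(2,\<real>)\<close>, the group of orientation-preserving isometries of the hyperbolic plane.\<close>

definition PSL2R :: "(complex \<Rightarrow> complex) set" where
  "PSL2R = {real_moebius p q r s | p q r s. p * s - q * r = 1}"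

definition parabolic :: "(complex \<Rightarrow> complex) \<Rightarrow> bool" where
  "parabolic f \<longleftrightarrow> f \<noteq> (\<lambda>z\<in>hyp_plane. z) \<and>
     (\<exists>p q r s. p * s - q * r = 1 \<and> (p + s)\<^sup>2 = 4 \<and> f = real_moebius p q r s)"

text \<open>Complete geodesics, parametrised by arc length.\<close>

definition geodesic_line :: "(real \<Rightarrow> complex) \<Rightarrow> bool" where
  "geodesic_line c \<longleftrightarrow> range c \<subseteq> hyp_plane \<and> (\<forall>s t. hyp_dist (c s) (c t) = \<bar>s - t\<bar>)"


section \<open>Free groups of rank two\<close>

text \<open>A letter is a pair of flags: the first selects the generator (\<open>a\<close> or \<open>b\<close>), the second
  says whether the generator itself or its inverse is meant.\<close>

definition letter :: "('p, 'm) monoid_scheme \<Rightarrow> 'p \<Rightarrow> 'p \<Rightarrow> bool \<times> bool \<Rightarrow> 'p" where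
  "letter P a b l = (let x = (if fst l then a else b) in if snd l then x else inv\<^bsub>P\<^esub> x)"

definition word_value ::
    "('p, 'm) monoid_scheme \<Rightarrow> 'p \<Rightarrow> 'p \<Rightarrow> (bool \<times> bool) list \<Rightarrow> 'p" where
  "word_value P a b w = foldr (\<lambda>l u. letter P a b l \<otimes>\<^bsub>P\<^esub> u) w \<one>\<^bsub>P\<^esub>"

definition reduced_word :: "(bool \<times> bool) list \<Rightarrow> bool" where
  "reduced_word w \<longleftrightarrow> (\<forall>i. Suc i < length w \<longrightarrow>
     \<not> (fst (w ! i) = fst (w ! Suc i) \<and> snd (w ! i) \<noteq> snd (w ! Suc i)))"

definition free_generators :: "('p, 'm) monoid_scheme \<Rightarrow> 'p \<Rightarrow> 'p \<Rightarrow> bool" where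
  "free_generators P a b \<longleftrightarrow> group P \<and> a \<in> carrier P \<and> b \<in> carrier P \<and>
     generate P {a, b} = carrier P \<and>
     (\<forall>w. reduced_word w \<and> w \<noteq> [] \<longrightarrow> word_value P a b w \<noteq> \<one>\<^bsub>P\<^esub>)"

definition commutator_of :: "('p, 'm) monoid_scheme \<Rightarrow> 'p \<Rightarrow> 'p \<Rightarrow> 'p" where
  "commutator_of P a b = a \<otimes>\<^bsub>P\<^esub> b \<otimes>\<^bsub>P\<^esub> inv\<^bsub>P\<^esub> a \<otimes>\<^bsub>P\<^esub> inv\<^bsub>P\<^esub> b"


section \<open>The Teichmueller space of the once-punctured torus\<close>

text \<open>The surface enters through its fundamental group \<open>P\<close> (free of rank two) and an element \<open>c\<close>
  of \<open>P\<close> represented by a loop around the puncture. A complete hyperbolic metric \<open>g\<close> on the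
  surface presents it as a quotient of the hyperbolic plane by a group of orientation-preserving
  isometries acting freely and properly discontinuously, together with an identification
  (the holonomy, \<open>\<rho>\<close> below) of \<open>P\<close> with this deck group; conversely such a \<open>\<rho>\<close> determines a
  complete hyperbolic surface marked by \<open>P\<close>.

  The area of the surface is finite iff some Borel set of finite hyperbolic area meets every
  orbit. The ends of a complete hyperbolic surface of finite area are cusps, and its
  loops around cusps are the ones with parabolic holonomy. The condition on \<open>c\<close> thus says that \<open>c\<close>
  goes around a cusp; for \<open>c\<close> the commutator of two free generators of \<open>P\<close> it
  singles out the punctured torus among the surfaces with free fundamental group of rank two
  (on a thrice-punctured sphere no commutator of generators is peripheral).\<close>

definition hyperbolic_holonomy ::
    "('p, 'm) monoid_scheme \<Rightarrow> 'p \<Rightarrow> ('p \<Rightarrow> complex \<Rightarrow> complex) \<Rightarrow> bool" where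
  "hyperbolic_holonomy P c \<rho> \<longleftrightarrow>
     \<rho> \<in> hom P (BijGroup hyp_plane) \<and>
     \<rho> ` carrier P \<subseteq> PSL2R \<and>
     \<comment> \<open>free action\<close>
     (\<forall>\<gamma>\<in>carrier P. \<forall>z\<in>hyp_plane. \<rho> \<gamma> z = z \<longrightarrow> \<gamma> = \<one>\<^bsub>P\<^esub>) \<and>
     \<comment> \<open>properly discontinuous action\<close>
     (\<forall>K. compact K \<and> K \<subseteq> hyp_plane \<longrightarrow> finite {\<gamma> \<in> carrier P. \<rho> \<gamma> ` K \<inter> K \<noteq> {}}) \<and>
     \<comment> \<open>finite area\<close>
     (\<exists>D\<in>sets borel. D \<subseteq> hyp_plane \<and> hyp_plane \<subseteq> (\<Union>\<gamma>\<in>carrier P. \<rho> \<gamma> ` D) \<and> hyp_area D < \<infinity>) \<and>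
     \<comment> \<open>\<open>c\<close> goes around the puncture\<close>
     parabolic (\<rho> c)"

text \<open>Two metrics are isotopic iff some isometry between the marked quotients is compatible with
  the markings, i.e. iff their holonomies are conjugate by an isometry of the plane. The conjugating
  isometry may reverse the orientation of the plane, since a metric does not come with an
  orientation of the universal cover: this is conjugation by \<open>PGL(2,\<real>)\<close>.\<close>

definition same_metric ::
    "('p, 'm) monoid_scheme \<Rightarrow> 'p \<Rightarrow>
     (('p \<Rightarrow> complex \<Rightarrow> complex) \<times> ('p \<Rightarrow> complex \<Rightarrow> complex)) set" where
  "same_metric P c = {(\<rho>, \<rho>'). hyperbolic_holonomy P c \<rho> \<and> hyperbolic_holonomy P c \<rho>' \<and>
     (\<exists>\<phi>. hyp_isometry \<phi> \<and> (\<forall>\<gamma>\<in>carrier P. \<forall>z\<in>hyp_plane. \<phi> (\<rho> \<gamma> z) = \<rho>' \<gamma> (\<phi> z)))}"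

definition teichmueller_space ::
    "('p, 'm) monoid_scheme \<Rightarrow> 'p \<Rightarrow> ('p \<Rightarrow> complex \<Rightarrow> complex) set set" where
  "teichmueller_space P c = {\<rho>. hyperbolic_holonomy P c \<rho>} // same_metric P c"

text \<open>A closed geodesic of length \<open>L\<close> freely homotopic to \<open>\<gamma>\<close> is the same as a geodesic line
  in the universal cover along which the holonomy of \<open>\<gamma>\<close> translates by \<open>L\<close>.\<close>

definition closed_geodesic_of_length ::
    "('p \<Rightarrow> complex \<Rightarrow> complex) set \<Rightarrow> 'p \<Rightarrow> real \<Rightarrow> bool" where
  "closed_geodesic_of_length g \<gamma> L \<longleftrightarrow>
     L > 0 \<and> (\<exists>\<rho>\<in>g. \<exists>c. geodesic_line c \<and> (\<forall>t. \<rho> \<gamma> (c t) = c (t + L)))"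

text \<open>Trivial and parabolic elements have no closed geodesic and get length \<open>0\<close>.\<close>

definition geodesic_length :: "('p \<Rightarrow> complex \<Rightarrow> complex) set \<Rightarrow> 'p \<Rightarrow> real" where
  "geodesic_length g \<gamma> =
     (if \<exists>L. closed_geodesic_of_length g \<gamma> L then THE L. closed_geodesic_of_length g \<gamma> L else 0)"

definition Tr :: "('p \<Rightarrow> complex \<Rightarrow> complex) set \<Rightarrow> 'p \<Rightarrow> real" where
  "Tr g \<gamma> = 2 * cosh (geodesic_length g \<gamma> / 2)"

end

theory Submission
  imports Defs
begin

text \<open>A holonomy is lifted to two matrices of determinant \<open>1\<close> with traces \<open>x\<close>, \<open>y\<close> and product of
  trace \<open>z\<close>. The trace \<open>x\<^sup>2 + y\<^sup>2 + z\<^sup>2 - x y z - 2\<close> of their commutator is \<open>\<plusminus> 2\<close>, and \<open>2\<close> is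
  incompatible with a faithful representation of a free group; so \<open>x\<^sup>2 + y\<^sup>2 + z\<^sup>2 = x y z\<close>, and up to
  isometry the pair is determined by \<open>(x, y, z)\<close>. Under this relation the two trace conditions turn
  into a quintic in \<open>x = y\<close> with exactly one root greater than \<open>2\<close>.

  For the existence let \<open>k\<close> be a root of the corresponding quintic in \<open>k = z / x\<close>. The two explicit
  matrices with these traces, normalised such that their commutator is a translation, play
  ping-pong on four half planes, so a small disc has disjoint translates; hence the group they
  generate is free and acts properly discontinuously, and freely because a free group has no
  torsion. Up to translation, every orbit enters a vertical strip above some height, because the
  isometric circles of the four letters cover a period of the real line; such a strip has finite
  area.\<close>

section \<open>Isometries of the hyperbolic plane\<close>

text \<open>Two ambiguities stand between a triple of traces and a pair of matrices. Signs of the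
  lifts: both traces are taken nonnegative, and the relation excludes values up to 2 as soon as
  trace 0 of the first matrix, a half-turn with a fixed point, is ruled out. Orientation: once the
  first matrix is diagonal, the remaining conjugations by diagonal matrices multiply the upper right
  entry of the second by a positive number, so making this entry 1 may take a reflection, which the
  isotopy relation allows.

  The parameter \<open>k\<close> of the existence part comes from putting y = x and z = k x in the
  relation: it becomes 2 + k^2 = k x, so x = (k^2 + 2) / k and z = k^2 + 2. The trace of a^2 b is x
  z - y, hence the second condition reads x^2 - 2 = x z - x, and this is the quintic in
  \<open>k\<close>. It has a root between 1 and 2, which matters again later: 1 < k < 2 is what
  makes the isometric circles, of radius \<open>k\<close>, cover a period.\<close>

lemma hyp_plane_iff [simp]: "z \<in> hyp_plane \<longleftrightarrow> Im z > 0"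
  by (simp add: hyp_plane_def)

lemma hyp_dist_arg_ge_1:
  assumes "Im z > 0" "Im w > 0"
  shows "1 + (cmod (z - w))\<^sup>2 / (2 * Im z * Im w) \<ge> 1"
  using assms by simp

lemma cosh_hyp_dist:
  assumes "Im z > 0" "Im w > 0"
  shows "cosh (hyp_dist z w) = 1 + (cmod (z - w))\<^sup>2 / (2 * Im z * Im w)"
  unfolding hyp_dist_def using hyp_dist_arg_ge_1[OF assms] by (rule cosh_arcosh_real)

lemma hyp_dist_nonneg:
  assumes "Im z > 0" "Im w > 0"
  shows "hyp_dist z w \<ge> 0"
  unfolding hyp_dist_def using hyp_dist_arg_ge_1[OF assms] by (rule arcosh_nonneg_real)

lemma hyp_dist_commute: "hyp_dist z w = hyp_dist w z"
  by (simp add: hyp_dist_def norm_minus_commute mult.commute mult.left_commute)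

text \<open>In the hyperboloid model the three cosines are Lorentzian products of unit vectors, and the
  difference of the two sides is the square of the determinant of these vectors.\<close>

lemma cosh_gram_inequality:
  fixes x1 y1 x2 y2 x3 y3 :: real
  assumes "y1 > 0" "y2 > 0" "y3 > 0"
  defines "C12 \<equiv> 1 + ((x1 - x2)\<^sup>2 + (y1 - y2)\<^sup>2) / (2 * y1 * y2)"
    and "C23 \<equiv> 1 + ((x2 - x3)\<^sup>2 + (y2 - y3)\<^sup>2) / (2 * y2 * y3)"
    and "C13 \<equiv> 1 + ((x1 - x3)\<^sup>2 + (y1 - y3)\<^sup>2) / (2 * y1 * y3)"
  shows "(C13 - C12 * C23)\<^sup>2 \<le> (C12\<^sup>2 - 1) * (C23\<^sup>2 - 1)"
proof -
  define u where "u = x1 - x2"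
  define v where "v = x2 - x3"
  define p where "p = u\<^sup>2 + y1\<^sup>2 + y2\<^sup>2"
  define q where "q = v\<^sup>2 + y2\<^sup>2 + y3\<^sup>2"
  define r where "r = (u + v)\<^sup>2 + y1\<^sup>2 + y3\<^sup>2"
  \<comment> \<open>\<open>p\<close>, \<open>q\<close>, \<open>r\<close> are the cosines with
    denominators cleared. Up to a factor, \<open>d\<close> is the determinant of the three unit
    vectors; it vanishes exactly when the three points lie on one geodesic.\<close>
  define d where "d = u * (y2\<^sup>2 - v\<^sup>2 - y3\<^sup>2) - v * (u\<^sup>2 + y1\<^sup>2 - y2\<^sup>2)"
  define m where "m = 4 * y1 * y2\<^sup>2 * y3"
  have m: "m > 0" using assms(1-3) by (simp add: m_def)
  have c: "C12 = p / (2 * y1 * y2)" "C23 = q / (2 * y2 * y3)" "C13 = r / (2 * y1 * y3)"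
  proof -
    have "1 + (t + (a - b)\<^sup>2) / (2 * a * b) = (t + a\<^sup>2 + b\<^sup>2) / (2 * a * b)"
      if "a > 0" "b > 0" for t a b :: real
      using that by (simp add: add_divide_eq_iff power2_diff)
    then show "C12 = p / (2 * y1 * y2)" "C23 = q / (2 * y2 * y3)" "C13 = r / (2 * y1 * y3)"
      using assms(1-3) unfolding assms(4-6) p_def q_def r_def u_def v_def by simp_all
  qed
  have gram: "p * q * r + 4 * y1\<^sup>2 * y2\<^sup>2 * y3\<^sup>2 - p\<^sup>2 * y3\<^sup>2 - q\<^sup>2 * y1\<^sup>2 - r\<^sup>2 * y2\<^sup>2 = d\<^sup>2"
    unfolding p_def q_def r_def d_def power2_eq_square by (simp only: algebra_simps)
  have "C13 * m = 2 * r * y2\<^sup>2" "C12 * C23 * m = p * q"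
    using assms(1-3) unfolding c m_def by (simp_all add: power2_eq_square)
  then have "(C13 - C12 * C23) * m = 2 * r * y2\<^sup>2 - p * q"
    by (simp add: left_diff_distrib)
  then have "(C13 - C12 * C23)\<^sup>2 * m\<^sup>2 = (2 * r * y2\<^sup>2 - p * q)\<^sup>2"
    by (metis power_mult_distrib)
  also have "\<dots> = (p\<^sup>2 - 4 * y1\<^sup>2 * y2\<^sup>2) * (q\<^sup>2 - 4 * y2\<^sup>2 * y3\<^sup>2) - 4 * y2\<^sup>2 * d\<^sup>2"
    unfolding gram[symmetric] by (simp add: power2_eq_square algebra_simps)
  also have "\<dots> \<le> (p\<^sup>2 - 4 * y1\<^sup>2 * y2\<^sup>2) * (q\<^sup>2 - 4 * y2\<^sup>2 * y3\<^sup>2)"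
    by simp
  also have "\<dots> = ((C12\<^sup>2 - 1) * (4 * y1\<^sup>2 * y2\<^sup>2)) * ((C23\<^sup>2 - 1) * (4 * y2\<^sup>2 * y3\<^sup>2))"
  proof -
    have "(C12\<^sup>2 - 1) * (4 * y1\<^sup>2 * y2\<^sup>2) = p\<^sup>2 - 4 * y1\<^sup>2 * y2\<^sup>2"
      "(C23\<^sup>2 - 1) * (4 * y2\<^sup>2 * y3\<^sup>2) = q\<^sup>2 - 4 * y2\<^sup>2 * y3\<^sup>2"
      using assms(1-3) unfolding c by (simp_all add: power_divide power_mult_distrib left_diff_distrib)
    then show ?thesis by simp
  qed
  also have "\<dots> = (C12\<^sup>2 - 1) * (C23\<^sup>2 - 1) * m\<^sup>2"
    by (simp add: m_def power2_eq_square)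
  finally show ?thesis using m by simp
qed

text \<open>The Gram inequality bounds \<open>cosh ?c - cosh ?a * cosh ?b\<close> by
  \<open>sinh ?a * sinh ?b\<close>, which is the addition formula for
  \<open>cosh (?a + ?b)\<close>.\<close>

lemma hyp_dist_triangle:
  assumes "Im z > 0" "Im u > 0" "Im w > 0"
  shows "hyp_dist z w \<le> hyp_dist z u + hyp_dist u w"
proof -
  let ?a = "hyp_dist z u" and ?b = "hyp_dist u w" and ?c = "hyp_dist z w"
  have nn: "?a \<ge> 0" "?b \<ge> 0" "?c \<ge> 0"
    using assms by (auto intro: hyp_dist_nonneg)
  have "(cosh ?c - cosh ?a * cosh ?b)\<^sup>2 \<le> ((cosh ?a)\<^sup>2 - 1) * ((cosh ?b)\<^sup>2 - 1)"
    using cosh_gram_inequality[where ?x1.0 = "Re z" and ?x2.0 = "Re u" and ?x3.0 = "Re w"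
      and ?y1.0 = "Im z" and ?y2.0 = "Im u" and ?y3.0 = "Im w"] assms
    by (simp add: cosh_hyp_dist cmod_power2)
  also have "\<dots> = (sinh ?a * sinh ?b)\<^sup>2"
    by (simp add: cosh_square_eq power_mult_distrib)
  finally have "cosh ?c - cosh ?a * cosh ?b \<le> sinh ?a * sinh ?b"
    by (rule power2_le_imp_le) (use nn in auto)
  then have "cosh ?c \<le> cosh (?a + ?b)"
    unfolding cosh_add by linarith
  then show ?thesis
    using cosh_real_nonneg_le_iff[of ?c "?a + ?b"] nn by linarith
qed

section \<open>Real Moebius maps: composition, inverses, invariance of the distance\<close>

lemma moebius_denominator_nonzero:
  assumes "p * s - q * r = (1::real)" "Im z > 0"
  shows "of_real r * z + of_real s \<noteq> 0"
proof
  assume "of_real r * z + of_real s = 0"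
  then have "r * Im z = 0" "r * Re z + s = 0"
    by (auto simp: complex_eq_iff)
  with assms show False by auto
qed

lemma Im_moebius:
  assumes "p * s - q * r = (1::real)" "Im z > 0"
  shows "Im ((of_real p * z + of_real q) / (of_real r * z + of_real s)) =
    Im z / (cmod (of_real r * z + of_real s))\<^sup>2"
proof -
  have "Im z * (p * s - q * r) = Im z" using assms by simp
  then have "p * Im z * (r * Re z + s) - (p * Re z + q) * (r * Im z) = Im z"
    by (simp add: algebra_simps)
  then show ?thesis
    by (simp add: Im_divide cmod_power2)
qed

lemma Im_real_moebius:
  assumes "p * s - q * r = 1" "Im z > 0"
  shows "Im (real_moebius p q r s z) = Im z / (cmod (of_real r * z + of_real s))\<^sup>2"
  using Im_moebius[OF assms] assms(2) by (simp add: real_moebius_def)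

lemma Im_real_moebius_pos:
  assumes "p * s - q * r = 1" "Im z > 0"
  shows "Im (real_moebius p q r s z) > 0"
  using moebius_denominator_nonzero[OF assms] assms by (simp add: Im_real_moebius)

lemma real_moebius_apply:
  "Im z > 0 \<Longrightarrow> real_moebius p q r s z = (of_real p * z + of_real q) / (of_real r * z + of_real s)"
  by (simp add: real_moebius_def)

lemma real_moebius_real_moebius:
  assumes "p * s - q * r = 1" "p' * s' - q' * r' = 1" "Im z > 0"
  shows "real_moebius p q r s (real_moebius p' q' r' s' z) =
    real_moebius (p * p' + q * r') (p * q' + q * s') (r * p' + s * r') (r * q' + s * s') z"
proof -
  let ?d = "of_real r' * z + of_real s'"
  have d: "?d \<noteq> 0" by (rule moebius_denominator_nonzero[OF assms(2,3)])
  have "Im (real_moebius p' q' r' s' z) > 0"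
    by (rule Im_real_moebius_pos[OF assms(2,3)])
  then have "real_moebius p q r s (real_moebius p' q' r' s' z) =
    (of_real p * ((of_real p' * z + of_real q') / ?d) + of_real q) /
    (of_real r * ((of_real p' * z + of_real q') / ?d) + of_real s)"
    using assms(3) by (simp add: real_moebius_apply)
  also have "\<dots> = (of_real p * (of_real p' * z + of_real q') + of_real q * ?d) /
    (of_real r * (of_real p' * z + of_real q') + of_real s * ?d)"
  proof -
    have "of_real p * ((of_real p' * z + of_real q') / ?d) + of_real q =
       (of_real p * (of_real p' * z + of_real q') + of_real q * ?d) / ?d"
      "of_real r * ((of_real p' * z + of_real q') / ?d) + of_real s =
       (of_real r * (of_real p' * z + of_real q') + of_real s * ?d) / ?d"
      by (simp_all add: divide_add_eq_iff d)
    then show ?thesis using d by (simp only:) simp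
  qed
  also have "\<dots> = real_moebius (p * p' + q * r') (p * q' + q * s') (r * p' + s * r') (r * q' + s * s') z"
    using assms(3) by (simp add: real_moebius_apply algebra_simps)
  finally show ?thesis .
qed

lemma real_moebius_extensional: "real_moebius p q r s \<in> extensional hyp_plane"
  by (simp add: real_moebius_def)

lemma det_mult:
  fixes p q r s :: "'a::comm_ring_1"
  assumes "p * s - q * r = 1" "p' * s' - q' * r' = 1"
  shows "(p * p' + q * r') * (r * q' + s * s') - (p * q' + q * s') * (r * p' + s * r') = 1"
proof -
  have "(p * p' + q * r') * (r * q' + s * s') - (p * q' + q * s') * (r * p' + s * r') =
    (p * s - q * r) * (p' * s' - q' * r')"
    by (simp add: algebra_simps)
  then show ?thesis using assms by simp
qed

lemma compose_real_moebius:
  assumes "p * s - q * r = 1" "p' * s' - q' * r' = 1"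
  shows "compose hyp_plane (real_moebius p q r s) (real_moebius p' q' r' s') =
    real_moebius (p * p' + q * r') (p * q' + q * s') (r * p' + s * r') (r * q' + s * s')"
  by (rule extensionalityI[OF compose_extensional real_moebius_extensional])
    (simp add: compose_def real_moebius_real_moebius[OF assms])

lemma real_moebius_id: "real_moebius 1 0 0 1 = (\<lambda>z\<in>hyp_plane. z)"
  by (rule extensionalityI[of _ hyp_plane]) (auto simp: real_moebius_def)

lemma real_moebius_uminus: "real_moebius (- p) (- q) (- r) (- s) = real_moebius p q r s"
proof (rule extensionalityI[OF real_moebius_extensional real_moebius_extensional])
  fix z assume "z \<in> hyp_plane"
  then have "Im z > 0" by simp
  moreover have "of_real (- p) * z + of_real (- q) = - (of_real p * z + of_real q)"
    "of_real (- r) * z + of_real (- s) = - (of_real r * z + of_real s)" by simp_all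
  ultimately show "real_moebius (- p) (- q) (- r) (- s) z = real_moebius p q r s z"
    by (simp only: real_moebius_apply minus_divide_divide)
qed

lemma real_moebius_left_inverse:
  assumes "p * s - q * r = 1" "Im z > 0"
  shows "real_moebius s (- q) (- r) p (real_moebius p q r s z) = z"
proof -
  have det: "s * p - (- q) * (- r) = 1" using assms by (simp add: mult.commute)
  have e: "s * p - q * r = 1" "p * s - r * q = 1" using assms by (simp_all add: mult.commute)
  show ?thesis
    using real_moebius_real_moebius[OF det assms(1,2)] assms e
    by (simp add: real_moebius_apply mult.commute[of s q] mult.commute[of r p])
qed

lemma real_moebius_right_inverse:
  assumes "p * s - q * r = 1" "Im z > 0"
  shows "real_moebius p q r s (real_moebius s (- q) (- r) p z) = z"
  using real_moebius_left_inverse[of s p "- q" "- r" z] assms by (simp add: mult.commute)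

lemma bij_betw_real_moebius:
  assumes "p * s - q * r = 1"
  shows "bij_betw (real_moebius p q r s) hyp_plane hyp_plane"
proof (rule bij_betw_byWitness[where f' = "real_moebius s (- q) (- r) p"])
  have "s * p - (- q) * (- r) = 1" using assms by (simp add: mult.commute)
  then show "real_moebius s (- q) (- r) p ` hyp_plane \<subseteq> hyp_plane"
    using Im_real_moebius_pos[of s p "- q" "- r"] by auto
  show "real_moebius p q r s ` hyp_plane \<subseteq> hyp_plane"
    using Im_real_moebius_pos[OF assms] by auto
qed (use real_moebius_left_inverse[OF assms] real_moebius_right_inverse[OF assms] in auto)

lemma real_moebius_Bij: "p * s - q * r = 1 \<Longrightarrow> real_moebius p q r s \<in> Bij hyp_plane"
  by (simp add: Bij_def real_moebius_extensional bij_betw_real_moebius)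

lemma hyp_dist_real_moebius:
  assumes "p * s - q * r = 1" "Im z > 0" "Im w > 0"
  shows "hyp_dist (real_moebius p q r s z) (real_moebius p q r s w) = hyp_dist z w"
proof -
  let ?dz = "of_real r * z + of_real s" and ?dw = "of_real r * w + of_real s"
  have nz: "?dz \<noteq> 0" "?dw \<noteq> 0"
    using moebius_denominator_nonzero[OF assms(1)] assms by blast+
  have "real_moebius p q r s z - real_moebius p q r s w =
    of_real (p * s - q * r) * (z - w) / (?dz * ?dw)"
    using nz assms(2,3) by (simp add: real_moebius_apply divide_simps) (simp add: algebra_simps)
  then have "cmod (real_moebius p q r s z - real_moebius p q r s w) = cmod (z - w) / (cmod ?dz * cmod ?dw)"
    using assms(1) by (simp add: norm_divide norm_mult)
  then show ?thesis
    using nz assms unfolding hyp_dist_def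
    by (simp add: Im_real_moebius power_divide power_mult_distrib)
qed

lemma hyp_isometry_real_moebius: "p * s - q * r = 1 \<Longrightarrow> hyp_isometry (real_moebius p q r s)"
  by (simp add: hyp_isometry_def bij_betw_real_moebius hyp_dist_real_moebius)

text \<open>Cross-multiplication leaves a quadratic identity in \<open>z\<close> with real
  coefficients, and its values at \<open>\<i>\<close> and \<open>2 * \<i>\<close> give equality of
  all coefficients. The matrices are then proportional, and their determinants leave only the
  factors 1 and -1.\<close>

lemma real_moebius_eqD:
  assumes "p * s - q * r = 1" "p' * s' - q' * r' = 1"
    and eq: "real_moebius p q r s = real_moebius p' q' r' s'"
  shows "(p', q', r', s') = (p, q, r, s) \<or> (p', q', r', s') = (- p, - q, - r, - s)"
proof -
  have *: "(of_real p * z + of_real q) * (of_real r' * z + of_real s') =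
      (of_real p' * z + of_real q') * (of_real r * z + of_real s)" if "Im z > 0" for z
    using fun_cong[OF eq, of z] that moebius_denominator_nonzero[OF assms(1) that]
      moebius_denominator_nonzero[OF assms(2) that]
    by (simp add: real_moebius_apply frac_eq_eq)
  have 1: "p * s' + q * r' = p' * s + q' * r" "- p * r' + q * s' = - p' * r + q' * s"
    using *[of \<i>] by (auto simp: complex_eq_iff algebra_simps)
  have 2: "- 4 * (p * r') + q * s' = - 4 * (p' * r) + q' * s"
    using *[of "2 * \<i>"] by (auto simp: complex_eq_iff algebra_simps)
  have 3: "p * r' = p' * r" "q * s' = q' * s"
    using 1 2 by linarith+
  \<comment> \<open>For proportional matrices the inverse of the second times the first is scalar;
    the two expressions for \<open>\<alpha>\<close> are its diagonal entries.\<close>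
  define \<alpha> where "\<alpha> = s' * p - q' * r"
  have \<alpha>: "\<alpha> = p' * s - q * r'" using 1 unfolding \<alpha>_def by (simp add: algebra_simps)
  have eqs: "p = \<alpha> * p'" "q = \<alpha> * q'" "r = \<alpha> * r'" "s = \<alpha> * s'"
  proof -
    have "p = p * (p' * s' - q' * r')" using assms by simp
    also have "\<dots> = p' * (s' * p) - q' * (p * r')" by (simp add: algebra_simps)
    also have "\<dots> = \<alpha> * p'" by (simp add: 3 \<alpha>_def algebra_simps)
    finally show "p = \<alpha> * p'" .
    have "q = q * (p' * s' - q' * r')" using assms by simp
    also have "\<dots> = p' * (q * s') - q' * (q * r')" by (simp add: algebra_simps)
    also have "\<dots> = \<alpha> * q'" by (simp add: 3 \<alpha> algebra_simps)
    finally show "q = \<alpha> * q'" .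
    have "r = r * (p' * s' - q' * r')" using assms by simp
    also have "\<dots> = s' * (p' * r) - r' * (q' * r)" by (simp add: algebra_simps)
    also have "\<dots> = \<alpha> * r'" by (simp add: 3(1)[symmetric] \<alpha>_def algebra_simps)
    finally show "r = \<alpha> * r'" .
    have "s = s * (p' * s' - q' * r')" using assms by simp
    also have "\<dots> = s' * (p' * s) - r' * (q' * s)" by (simp add: algebra_simps)
    also have "\<dots> = \<alpha> * s'" by (simp add: 3(2)[symmetric] \<alpha> algebra_simps)
    finally show "s = \<alpha> * s'" .
  qed
  have "\<alpha>\<^sup>2 * (p' * s' - q' * r') = (\<alpha> * p') * (\<alpha> * s') - (\<alpha> * q') * (\<alpha> * r')"
    by (simp add: power2_eq_square algebra_simps)
  also have "\<dots> = p * s - q * r"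
    by (simp only: eqs[symmetric])
  finally have "\<alpha>\<^sup>2 * (p' * s' - q' * r') = p * s - q * r" .
  then have "\<alpha>\<^sup>2 = 1" using assms by simp
  then have "\<alpha> = 1 \<or> \<alpha> = - 1" by (simp add: power2_eq_1_iff)
  then show ?thesis using eqs by auto
qed

lemma hyp_isometry_comp:
  assumes "hyp_isometry f" "hyp_isometry g"
  shows "hyp_isometry (f \<circ> g)"
  using assms unfolding hyp_isometry_def
  by (auto intro: bij_betw_trans dest: bij_betwE)

lemma hyp_isometry_inv_into:
  assumes "hyp_isometry f"
  shows "hyp_isometry (inv_into hyp_plane f)"
  unfolding hyp_isometry_def
proof (intro conjI ballI)
  have b: "bij_betw f hyp_plane hyp_plane" using assms by (simp add: hyp_isometry_def)
  then show b': "bij_betw (inv_into hyp_plane f) hyp_plane hyp_plane" by (rule bij_betw_inv_into)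
  fix z w assume zw: "z \<in> hyp_plane" "w \<in> hyp_plane"
  have "hyp_dist (f (inv_into hyp_plane f z)) (f (inv_into hyp_plane f w)) =
      hyp_dist (inv_into hyp_plane f z) (inv_into hyp_plane f w)"
    using assms zw b' unfolding hyp_isometry_def by (meson bij_betwE)
  then show "hyp_dist (inv_into hyp_plane f z) (inv_into hyp_plane f w) = hyp_dist z w"
    using bij_betw_inv_into_right[OF b] zw by simp
qed

text \<open>For negative \<open>k\<close> this is an orientation-reversing isometry.\<close>

definition hyp_scale :: "real \<Rightarrow> complex \<Rightarrow> complex" where
  "hyp_scale k z = Complex (k * Re z) (\<bar>k\<bar> * Im z)"

lemma hyp_isometry_hyp_scale:
  assumes "k \<noteq> 0"
  shows "hyp_isometry (hyp_scale k)"
  unfolding hyp_isometry_def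
proof (intro conjI ballI)
  show "bij_betw (hyp_scale k) hyp_plane hyp_plane"
    by (rule bij_betw_byWitness[where f' = "hyp_scale (1 / k)"])
      (use assms in \<open>auto simp: hyp_scale_def complex_eq_iff abs_mult[symmetric]\<close>)
  fix z w assume "z \<in> hyp_plane" "w \<in> hyp_plane"
  have "(cmod (hyp_scale k z - hyp_scale k w))\<^sup>2 = k\<^sup>2 * (cmod (z - w))\<^sup>2"
    by (simp add: cmod_power2 hyp_scale_def power_mult_distrib left_diff_distrib[symmetric] 
      right_diff_distrib[symmetric] distrib_left)
  moreover have "2 * Im (hyp_scale k z) * Im (hyp_scale k w) = k\<^sup>2 * (2 * Im z * Im w)"
    by (simp add: hyp_scale_def power2_eq_square algebra_simps)
  ultimately show "hyp_dist (hyp_scale k z) (hyp_scale k w) = hyp_dist z w"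
    unfolding hyp_dist_def using assms by (simp only:) simp
qed

text \<open>Conjugation by a diagonal matrix, for either sign of \<open>k\<close>: complex
  conjugation commutes with maps that have real coefficients. This is how a nonzero off-diagonal
  entry is scaled to 1.\<close>

lemma hyp_scale_real_moebius:
  assumes "k \<noteq> 0" "p * s - q * r = 1" "Im z > 0"
  shows "hyp_scale k (real_moebius p q r s z) = real_moebius p (k * q) (r / k) s (hyp_scale k z)"
proof -
  have im: "Im (hyp_scale k z) > 0" using assms by (simp add: hyp_scale_def)
  have scale: "hyp_scale k w = (if k > 0 then of_real k * w else of_real k * cnj w)" for w
    using assms(1) by (auto simp: hyp_scale_def complex_eq_iff)
  have *: "of_real k * ((of_real p * w + of_real q) / (of_real r * w + of_real s)) =
      (of_real p * (of_real k * w) + of_real (k * q)) / (of_real (r / k) * (of_real k * w) + of_real s)"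
    for w :: complex
    using assms(1) by (simp add: algebra_simps)
  show ?thesis
    using * im assms(3) by (simp add: real_moebius_apply) (simp add: scale)
qed

section \<open>Words in a free group of rank two\<close>

definition inv_letter :: "bool \<times> bool \<Rightarrow> bool \<times> bool" where
  "inv_letter l = (fst l, \<not> snd l)"

lemma inv_letter_inv_letter [simp]: "inv_letter (inv_letter l) = l"
  by (simp add: inv_letter_def)

lemma reduced_word_iff_successively: "reduced_word w \<longleftrightarrow> successively (\<lambda>l m. m \<noteq> inv_letter l) w"
  unfolding reduced_word_def successively_conv_nth inv_letter_def
  by (auto simp: prod_eq_iff)

lemma reduced_word_Nil [simp]: "reduced_word []"
  by (simp add: reduced_word_iff_successively)

lemma reduced_word_Cons:
  "reduced_word (l # w) \<longleftrightarrow> w = [] \<or> hd w \<noteq> inv_letter l \<and> reduced_word w"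
  by (auto simp: reduced_word_iff_successively successively_Cons)

lemma reduced_word_append:
  "reduced_word (v @ w) \<longleftrightarrow> reduced_word v \<and> reduced_word w \<and>
    (v = [] \<or> w = [] \<or> hd w \<noteq> inv_letter (last v))"
  by (auto simp: reduced_word_iff_successively successively_append_iff)

text \<open>Left multiplication by a letter on reduced words. Folding it over a concrete word lets
  the simplifier compute the reduced form.\<close>

definition cancel_Cons :: "bool \<times> bool \<Rightarrow> (bool \<times> bool) list \<Rightarrow> (bool \<times> bool) list" where
  "cancel_Cons l w = (if w \<noteq> [] \<and> hd w = inv_letter l then tl w else l # w)"

definition free_reduction :: "(bool \<times> bool) list \<Rightarrow> (bool \<times> bool) list" where
  "free_reduction w = foldr cancel_Cons w []"

lemma free_reduction_Cons: "free_reduction (l # w) = cancel_Cons l (free_reduction w)"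
  by (simp add: free_reduction_def)

lemma reduced_word_free_reduction: "reduced_word (free_reduction w)"
proof (induction w)
  case Nil
  show ?case by (simp add: free_reduction_def)
next
  case (Cons l w)
  then show ?case
    by (cases "free_reduction w") (auto simp: free_reduction_Cons cancel_Cons_def reduced_word_Cons)
qed

lemma word_value_Nil [simp]: "word_value P a b [] = \<one>\<^bsub>P\<^esub>"
  by (simp add: word_value_def)

lemma word_value_Cons [simp]: "word_value P a b (l # w) = letter P a b l \<otimes>\<^bsub>P\<^esub> word_value P a b w"
  by (simp add: word_value_def)

text \<open>Kept apart from freeness because words are also evaluated in the group of bijections of
  the plane, at two concrete maps.\<close>

locale group_two_elements = group P for P (structure) +
  fixes a b
  assumes a_closed: "a \<in> carrier P" and b_closed: "b \<in> carrier P"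
begin

lemma letter_closed: "letter P a b l \<in> carrier P"
  using a_closed b_closed by (simp add: letter_def Let_def)

lemma letter_inv_letter: "letter P a b (inv_letter l) = inv (letter P a b l)"
  using a_closed b_closed by (simp add: letter_def Let_def inv_letter_def)

lemma word_value_closed: "word_value P a b w \<in> carrier P"
  by (induction w) (auto simp: letter_closed)

lemma word_value_append:
  "word_value P a b (v @ w) = word_value P a b v \<otimes> word_value P a b w"
  by (induction v) (auto simp: letter_closed word_value_closed m_assoc)

lemma word_value_inverse:
  "word_value P a b (map inv_letter (rev w)) = inv (word_value P a b w)"
  by (induction w)
    (auto simp: word_value_append letter_closed word_value_closed letter_inv_letter inv_mult_group)

lemma word_value_cancel_Cons:
  "word_value P a b (cancel_Cons l w) = letter P a b l \<otimes> word_value P a b w"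
proof (cases "w \<noteq> [] \<and> hd w = inv_letter l")
  case True
  then obtain u where "w = inv_letter l # u" by (cases w) auto
  then show ?thesis
    by (simp add: cancel_Cons_def letter_closed word_value_closed letter_inv_letter m_assoc[symmetric])
qed (auto simp: cancel_Cons_def)

lemma word_value_free_reduction: "word_value P a b (free_reduction w) = word_value P a b w"
proof (induction w)
  case (Cons l w)
  then show ?case by (simp add: free_reduction_Cons word_value_cancel_Cons)
qed (simp add: free_reduction_def)

lemma generate_words: "generate P {a, b} \<subseteq> range (word_value P a b)"
proof
  fix \<gamma> assume "\<gamma> \<in> generate P {a, b}"
  then show "\<gamma> \<in> range (word_value P a b)"
  proof (induction rule: generate.induct)
    case one
    show ?case by (metis word_value_Nil rangeI)
  next
    case (incl h)
    then have "h = word_value P a b [(h = a, True)]"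
      using a_closed b_closed by (auto simp: letter_def Let_def)
    then show ?case by (metis rangeI)
  next
    case (inv h)
    then have "inv h = word_value P a b [(h = a, False)]"
      using a_closed b_closed by (auto simp: letter_def Let_def)
    then show ?case by (metis rangeI)
  next
    case (eng h1 h2)
    then obtain v w where "h1 = word_value P a b v" "h2 = word_value P a b w" by auto
    then have "h1 \<otimes> h2 = word_value P a b (v @ w)" by (simp add: word_value_append)
    then show ?case by blast
  qed
qed

end

section \<open>Universal property and absence of torsion\<close>

locale free_group_two_generators = group_two_elements +
  assumes generators: "free_generators P a b"
begin

lemma word_value_eq_one:
  assumes "word_value P a b w = \<one>"
  shows "free_reduction w = []"
  using generators assms reduced_word_free_reduction[of w] word_value_free_reduction[of w]
  by (auto simp: free_generators_def)

lemma carrier_reduced_wordE: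
  assumes "\<gamma> \<in> carrier P"
  obtains w where "reduced_word w" "\<gamma> = word_value P a b w"
proof -
  have "\<gamma> \<in> generate P {a, b}" using generators assms by (simp add: free_generators_def)
  then obtain w where "\<gamma> = word_value P a b w" using generate_words by auto
  then show ?thesis
    using that[of "free_reduction w"] by (simp add: reduced_word_free_reduction word_value_free_reduction)
qed

text \<open>If two words agree in \<open>P\<close>, the first followed by the formal inverse of the
  second reduces to the empty word. Reduction preserves values in every group, so the words agree in
  \<open>Q\<close> too, and any representing word may be used to define
  \<open>\<rho>\<close>.\<close>

lemma hom_extension:
  assumes "group_two_elements Q A B"
  obtains \<rho> where "\<rho> \<in> hom P Q" "\<And>w. \<rho> (word_value P a b w) = word_value Q A B w"
proof -
  interpret Q: group_two_elements Q A B by (rule assms)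
  have wd: "word_value Q A B v = word_value Q A B w"
    if "word_value P a b v = word_value P a b w" for v w
  proof -
    let ?u = "v @ map inv_letter (rev w)"
    have "word_value P a b ?u = \<one>"
      using that by (simp add: word_value_append word_value_inverse word_value_closed)
    then have "word_value Q A B ?u = \<one>\<^bsub>Q\<^esub>"
      by (metis Q.word_value_free_reduction word_value_Nil word_value_eq_one)
    then show ?thesis
      by (metis Q.inv_equality Q.inv_inv Q.word_value_append Q.word_value_closed Q.word_value_inverse)
  qed
  define \<rho> where "\<rho> \<gamma> = word_value Q A B (SOME w. word_value P a b w = \<gamma>)" for \<gamma>
  have \<rho>: "\<rho> (word_value P a b w) = word_value Q A B w" for w
    unfolding \<rho>_def by (rule wd) (rule someI[of _ w], rule refl)
  have "\<rho> \<in> hom P Q"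
  proof (rule homI)
    fix x assume "x \<in> carrier P"
    then obtain v where "x = word_value P a b v" by (rule carrier_reduced_wordE)
    then show "\<rho> x \<in> carrier Q" by (simp add: \<rho> Q.word_value_closed)
  next
    fix x y assume "x \<in> carrier P" "y \<in> carrier P"
    then obtain v w where "x = word_value P a b v" "y = word_value P a b w"
      by (metis carrier_reduced_wordE)
    then show "\<rho> (x \<otimes> y) = \<rho> x \<otimes>\<^bsub>Q\<^esub> \<rho> y"
      by (metis \<rho> word_value_append Q.word_value_append)
  qed
  with \<rho> show ?thesis by (intro that)
qed

text \<open>A cyclically reduced word does not cancel against a copy of itself, so its repetitions
  stay reduced. The first letter is recorded for the induction.\<close>

lemma reduced_word_power_value:
  assumes "reduced_word w" "w \<noteq> []" "hd w \<noteq> inv_letter (last w)"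
  shows "\<exists>v. reduced_word v \<and> v \<noteq> [] \<and> hd v = hd w \<and> word_value P a b v = word_value P a b w [^] Suc n"
proof (induction n)
  case 0
  show ?case using assms word_value_closed by (intro exI[of _ w]) auto
next
  case (Suc n)
  then obtain v where v: "reduced_word v" "v \<noteq> []" "hd v = hd w"
    "word_value P a b v = word_value P a b w [^] Suc n" by blast
  have "word_value P a b (w @ v) = word_value P a b w [^] Suc (Suc n)"
    by (simp only: word_value_append v(4) nat_pow_Suc2[OF word_value_closed, of w "Suc n"])
  then show ?case
    using v assms by (intro exI[of _ "w @ v"]) (auto simp: reduced_word_append)
qed

text \<open>If the outer letters cancel, the word is a conjugate of a shorter one, and so are the
  powers; otherwise a power has a nonempty reduced word. Writing the exponent as
  \<open>Suc n\<close> excludes the power 0.\<close>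

lemma word_value_torsion_free:
  assumes "reduced_word w" "w \<noteq> []"
  shows "word_value P a b w [^] Suc n \<noteq> \<one>"
  using assms
proof (induction "length w" arbitrary: w rule: less_induct)
  case less
  show ?case
  proof (cases "hd w = inv_letter (last w)")
    case False
    then obtain v where "reduced_word v" "v \<noteq> []" "word_value P a b v = word_value P a b w [^] Suc n"
      using reduced_word_power_value less.prems by blast
    then show ?thesis using generators by (auto simp: free_generators_def)
  next
    case True
    obtain l v where w: "w = l # v" using less.prems by (cases w) auto
    have "v \<noteq> []" using True w by (auto simp: inv_letter_def prod_eq_iff)
    then obtain u m where v: "v = u @ [m]" by (metis rev_exhaust)
    have m: "m = inv_letter l" using True by (simp add: w v)
    have "u \<noteq> []" using less.prems by (auto simp: w v m reduced_word_Cons)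
    moreover have "reduced_word u"
      using less.prems \<open>u \<noteq> []\<close> by (simp add: w v reduced_word_Cons reduced_word_append)
    ultimately have IH: "word_value P a b u [^] Suc n \<noteq> \<one>"
      using less.hyps[of u] by (simp add: w v)
    define x where "x = letter P a b l"
    define y where "y = word_value P a b u"
    have xy: "x \<in> carrier P" "y \<in> carrier P"
      by (simp_all add: x_def y_def letter_closed word_value_closed)
    have val: "word_value P a b w = x \<otimes> y \<otimes> inv x"
      by (simp add: w v m word_value_append letter_inv_letter x_def[symmetric] y_def[symmetric] xy m_assoc)
    have "(x \<otimes> y \<otimes> inv x) [^] k = x \<otimes> y [^] k \<otimes> inv x" for k :: nat
    proof (induction k)
      case (Suc k)
      have "(x \<otimes> y \<otimes> inv x) [^] Suc k = (x \<otimes> y [^] k \<otimes> inv x) \<otimes> (x \<otimes> y \<otimes> inv x)"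
        by (simp only: nat_pow_Suc Suc)
      also have "\<dots> = x \<otimes> y [^] k \<otimes> (inv x \<otimes> x) \<otimes> y \<otimes> inv x"
        by (simp only: m_assoc xy m_closed inv_closed nat_pow_closed)
      also have "\<dots> = x \<otimes> y [^] Suc k \<otimes> inv x"
        using xy by (simp add: m_assoc)
      finally show ?case .
    qed (use xy in auto)
    then have "word_value P a b w [^] Suc n = x \<otimes> y [^] Suc n \<otimes> inv x"
      using val by metis
    moreover have "x \<otimes> y [^] Suc n \<otimes> inv x \<noteq> \<one>"
    proof
      assume "x \<otimes> y [^] Suc n \<otimes> inv x = \<one>"
      then have "x \<otimes> y [^] Suc n = x"
        using xy by (metis inv_equality inv_inv inv_closed m_closed nat_pow_closed)
      then have "y [^] Suc n = \<one>"
        using xy by (metis l_cancel_one nat_pow_closed)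
      then show False using IH y_def by blast
    qed
    ultimately show ?thesis by simp
  qed
qed

lemma torsion_free:
  assumes "\<gamma> \<in> carrier P" "\<gamma> [^] Suc n = \<one>"
  shows "\<gamma> = \<one>"
  using assms by (metis carrier_reduced_wordE word_value_Nil word_value_torsion_free)

text \<open>Pigeonhole produces torsion. It serves for point stabilisers, which proper discontinuity
  makes finite.\<close>

lemma finite_powers_imp_one:
  assumes "\<gamma> \<in> carrier P" "finite (range (\<lambda>n::nat. \<gamma> [^] n))"
  shows "\<gamma> = \<one>"
proof -
  have "\<not> inj (\<lambda>n::nat. \<gamma> [^] n)"
    using assms(2) finite_imageD by blast
  then obtain i j :: nat where "i < j" "\<gamma> [^] i = \<gamma> [^] j"
    by (metis (mono_tags, lifting) injI linorder_neqE_nat)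
  then obtain k where "\<gamma> [^] i = \<gamma> [^] i \<otimes> \<gamma> [^] Suc k"
    using assms(1) by (metis less_imp_Suc_add nat_pow_mult add_Suc_right)
  then have "\<gamma> [^] Suc k = \<one>"
    using assms(1) by (metis l_cancel_one nat_pow_closed)
  then show ?thesis by (rule torsion_free[OF assms(1)])
qed

end

section \<open>Axes and translation lengths\<close>

text \<open>The hypothesis says that \<open>l\<close> is a root of the characteristic polynomial. A
  vector orthogonal to a nonzero row of the matrix minus \<open>l\<close> is an eigenvector; a
  scalar matrix is the remaining case.\<close>

lemma eigenvector_exists:
  fixes p q r s l :: real
  assumes "(p - l) * (s - l) = q * r"
  obtains u v where "u \<noteq> 0 \<or> v \<noteq> 0" "p * u + q * v = l * u" "r * u + s * v = l * v"
proof -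
  consider "q \<noteq> 0 \<or> p \<noteq> l" | "r \<noteq> 0 \<or> s \<noteq> l" | "q = 0" "r = 0" "p = l" "s = l" by blast
  then show ?thesis
  proof cases
    case 1
    have "r * q + s * (l - p) = l * (l - p)" "p * q + q * (l - p) = l * q"
      using assms by (simp_all add: algebra_simps)
    then show ?thesis using 1 by (intro that[of q "l - p"]) auto
  next
    case 2
    have "p * (l - s) + q * r = l * (l - s)" "r * (l - s) + s * r = l * r"
      using assms by (simp_all add: algebra_simps)
    then show ?thesis using 2 by (intro that[of "l - s" r]) auto
  qed (use that[of 1 0] in auto)
qed

text \<open>The columns of the base change are eigenvectors for \<open>l\<close> and
  \<open>1 / l\<close>, independent because these differ. The second is rescaled to give determinant
  1, so that the base change acts as an isometry.\<close>

lemma eigenbasis_SL2: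
  fixes p q r s l :: real
  assumes det: "p * s - q * r = 1" and l: "l > 1" and tr: "p + s = l + 1 / l"
  obtains \<alpha> \<beta> \<gamma> \<delta> where "\<alpha> * \<delta> - \<beta> * \<gamma> = 1"
    "p * \<alpha> + q * \<gamma> = l * \<alpha>" "r * \<alpha> + s * \<gamma> = l * \<gamma>"
    "p * \<beta> + q * \<delta> = \<beta> / l" "r * \<beta> + s * \<delta> = \<delta> / l"
proof -
  have "(p - x) * (s - x) = q * r" if "x * x + 1 = (l + 1 / l) * x" for x
    using that det unfolding tr[symmetric] by (simp add: algebra_simps)
  moreover have "l * l + 1 = (l + 1 / l) * l" "1 / l * (1 / l) + 1 = (l + 1 / l) * (1 / l)"
    using l by (simp_all add: field_simps)
  ultimately have "(p - l) * (s - l) = q * r" "(p - 1 / l) * (s - 1 / l) = q * r" by blast+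
  then obtain u v u' v' where
    uv: "u \<noteq> 0 \<or> v \<noteq> 0" "p * u + q * v = l * u" "r * u + s * v = l * v" and
    uv': "u' \<noteq> 0 \<or> v' \<noteq> 0" "p * u' + q * v' = 1 / l * u'" "r * u' + s * v' = 1 / l * v'"
    by (metis eigenvector_exists)
  define d where "d = u * v' - u' * v"
  have "d \<noteq> 0"
  proof
    assume "d = 0"
    then have d: "u * v' = u' * v" by (simp add: d_def)
    have "u' * l * u = u' * (p * u + q * v)" using uv by simp
    also have "\<dots> = u * (p * u' + q * v')" using d by (simp add: algebra_simps)
    also have "\<dots> = u' * (1 / l) * u" using uv' by simp
    finally have "(u' * u) * (l - 1 / l) = 0" by (simp add: algebra_simps)
    then have 1: "u' * u = 0 \<or> l = 1 / l" by (simp only: mult_eq_0_iff right_minus_eq)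
    have "v' * l * v = v' * (r * u + s * v)" using uv by simp
    also have "\<dots> = v * (r * u' + s * v')" using d by (simp add: algebra_simps)
    also have "\<dots> = v' * (1 / l) * v" using uv' by simp
    finally have "(v' * v) * (l - 1 / l) = 0" by (simp add: algebra_simps)
    then have 2: "v' * v = 0 \<or> l = 1 / l" by (simp only: mult_eq_0_iff right_minus_eq)
    have "1 / l < 1" using l by simp
    then have "l \<noteq> 1 / l" using l by linarith
    then show False using 1 2 d uv(1) uv'(1) by auto
  qed
  then have "u * (v' / d) - u' / d * v = 1"
    by (simp add: d_def diff_divide_distrib[symmetric])
  moreover have "p * (u' / d) + q * (v' / d) = u' / d / l" "r * (u' / d) + s * (v' / d) = v' / d / l"
    using uv'(2,3) by (simp_all add: add_divide_distrib[symmetric] mult.commute)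
  ultimately show ?thesis using uv(2,3) by (intro that)
qed

text \<open>The larger root of \<open>t\<^sup>2 - x * t + 1\<close>, hence the eigenvalue above 1 of
  a matrix of determinant 1 and trace \<open>x > 2\<close>.\<close>

definition large_eigenvalue :: "real \<Rightarrow> real" where
  "large_eigenvalue x = (x + sqrt (x\<^sup>2 - 4)) / 2"

lemma large_eigenvalue:
  assumes "x > 2"
  shows "large_eigenvalue x > 1" "large_eigenvalue x + 1 / large_eigenvalue x = x"
proof -
  let ?l = "large_eigenvalue x"
  have "2\<^sup>2 < x\<^sup>2" using assms by (intro power_strict_mono) auto
  then have sq: "(sqrt (x\<^sup>2 - 4))\<^sup>2 = x\<^sup>2 - 4" "sqrt (x\<^sup>2 - 4) > 0" by auto
  then show l: "?l > 1" using assms sq(2) unfolding large_eigenvalue_def by (simp only: field_simps)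
  have "?l * (x - ?l) = 1"
    using sq(1) by (simp add: large_eigenvalue_def field_simps power2_eq_square)
  then have "x - ?l = 1 / ?l" using l by (simp add: eq_divide_eq mult.commute)
  then show "?l + 1 / ?l = x" by simp
qed

section \<open>Translation along axes\<close>

lemma real_moebius_diag:
  assumes "l > 0" "Im z > 0"
  shows "real_moebius l 0 0 (1 / l) z = of_real (l\<^sup>2) * z"
  using assms by (simp add: real_moebius_apply power2_eq_square)

lemma geodesic_line_imaginary_axis: "geodesic_line (\<lambda>t. Complex 0 (exp t))"
proof -
  have "hyp_dist (Complex 0 (exp s)) (Complex 0 (exp t)) = \<bar>s - t\<bar>" for s t
  proof -
    have "1 + (exp s - exp t)\<^sup>2 / (2 * exp s * exp t) = (exp s * exp s + exp t * exp t) / (2 * exp s * exp t)"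
      by (simp add: field_simps power2_eq_square)
    also have "\<dots> = (exp (s - t) + exp (- (s - t))) / 2"
      by (simp add: exp_diff field_simps)
    also have "\<dots> = cosh (s - t)" by (simp add: cosh_def)
    also have "\<dots> = cosh \<bar>s - t\<bar>" by simp
    finally have "1 + (exp s - exp t)\<^sup>2 / (2 * exp s * exp t) = cosh \<bar>s - t\<bar>" .
    then show ?thesis
      by (simp add: hyp_dist_def cmod_power2 arcosh_cosh_real del: cosh_real_abs)
  qed
  then show ?thesis by (auto simp: geodesic_line_def)
qed

lemma geodesic_line_closed: "geodesic_line c \<Longrightarrow> Im (c t) > 0"
  unfolding geodesic_line_def by (metis hyp_plane_iff range_subsetD)

lemma hyp_isometry_closed: "hyp_isometry f \<Longrightarrow> Im z > 0 \<Longrightarrow> Im (f z) > 0"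
  unfolding hyp_isometry_def by (metis bij_betwE hyp_plane_iff)

lemma geodesic_line_isometry:
  assumes "hyp_isometry f" "geodesic_line c"
  shows "geodesic_line (\<lambda>t. f (c t))"
  unfolding geodesic_line_def
proof (intro conjI allI)
  have H: "c t \<in> hyp_plane" for t using geodesic_line_closed[OF assms(2)] by simp
  show "range (\<lambda>t. f (c t)) \<subseteq> hyp_plane"
    using hyp_isometry_closed[OF assms(1)] H by auto
  fix s t
  have "hyp_dist (f (c s)) (f (c t)) = hyp_dist (c s) (c t)"
    using assms(1) H unfolding hyp_isometry_def by blast
  then show "hyp_dist (f (c s)) (f (c t)) = \<bar>s - t\<bar>"
    using assms(2) unfolding geodesic_line_def by simp
qed

text \<open>In the eigenbasis the map is multiplication by \<open>l\<^sup>2\<close>, which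
  translates the imaginary axis by \<open>2 * ln l\<close>; the base change carries this axis to the
  one sought. Length and trace agree because \<open>2 * cosh (ln l) = l + 1 / l\<close>.\<close>

lemma hyperbolic_axis:
  assumes det: "p * s - q * r = 1" and tr: "p + s > 2"
  obtains c L where "L > 0" "geodesic_line c" "\<And>t. real_moebius p q r s (c t) = c (t + L)"
    "2 * cosh (L / 2) = p + s"
proof -
  define l where "l = large_eigenvalue (p + s)"
  have l: "l > 1" "p + s = l + 1 / l" using large_eigenvalue[OF tr] by (simp_all add: l_def)
  obtain \<alpha> \<beta> \<gamma> \<delta> where T: "\<alpha> * \<delta> - \<beta> * \<gamma> = 1" and
    eig: "p * \<alpha> + q * \<gamma> = l * \<alpha>" "r * \<alpha> + s * \<gamma> = l * \<gamma>"
    "p * \<beta> + q * \<delta> = \<beta> / l" "r * \<beta> + s * \<delta> = \<delta> / l"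
    using eigenbasis_SL2[OF det l] by metis
  let ?T = "real_moebius \<alpha> \<beta> \<gamma> \<delta>"
  let ?c = "\<lambda>t. ?T (Complex 0 (exp t))"
  have "real_moebius p q r s (?c t) = ?c (t + 2 * ln l)" for t
  proof -
    let ?z = "Complex 0 (exp t)"
    have "real_moebius p q r s (?c t) = real_moebius (l * \<alpha>) (\<beta> / l) (l * \<gamma>) (\<delta> / l) ?z"
      using real_moebius_real_moebius[OF det T, of ?z] by (simp add: eig)
    also have "\<dots> = ?T (real_moebius l 0 0 (1 / l) ?z)"
      using real_moebius_real_moebius[OF T, of l "1 / l" 0 0 ?z] l by (simp add: mult.commute)
    also have "real_moebius l 0 0 (1 / l) ?z = of_real (l\<^sup>2) * ?z"
      using l by (simp add: real_moebius_diag)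
    also have "\<dots> = Complex 0 (exp (t + 2 * ln l))"
    proof -
      have "exp (t + 2 * ln l) = exp t * (exp (ln l))\<^sup>2" by (simp only: exp_add exp_double)
      also have "\<dots> = l\<^sup>2 * exp t" using l by simp
      finally show ?thesis by (simp only: complex_eq_iff) simp
    qed
    finally show ?thesis .
  qed
  moreover have "2 * cosh (2 * ln l / 2) = p + s"
    using l by (simp add: cosh_ln_real inverse_eq_divide)
  moreover have "geodesic_line ?c"
    by (rule geodesic_line_isometry[OF hyp_isometry_real_moebius[OF T] geodesic_line_imaginary_axis])
  moreover have "2 * ln l > 0" using l by simp
  ultimately show ?thesis by (intro that[of "2 * ln l" ?c])
qed

lemma hyperbolic_axis_abs:
  assumes det: "p * s - q * r = 1" and tr: "\<bar>p + s\<bar> > 2"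
  obtains c L where "L > 0" "geodesic_line c" "\<And>t. real_moebius p q r s (c t) = c (t + L)"
    "2 * cosh (L / 2) = \<bar>p + s\<bar>"
proof (cases "p + s > 0")
  case True
  then show ?thesis using hyperbolic_axis[OF det] tr that by auto
next
  case False
  have m: "- p * - s - - q * - r = 1" "- p + - s > 2" using det tr False by auto
  obtain c L where "L > 0" "geodesic_line c" "2 * cosh (L / 2) = - p + - s"
    and "\<And>t. real_moebius (- p) (- q) (- r) (- s) (c t) = c (t + L)"
    using hyperbolic_axis[OF m] by blast
  then show ?thesis
    using False by (intro that[of L c]) (simp_all add: real_moebius_uminus)
qed

text \<open>Iterating \<open>f\<close> moves both starting points along their lines and keeps their
  distance \<open>?d\<close>. The triangle inequality gives
  \<open>n * L \<le> 2 * ?d + n * L'\<close> for all \<open>n\<close>, which fails for large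
  \<open>n\<close> if \<open>L > L'\<close>.\<close>

lemma translation_length_le:
  assumes f: "hyp_isometry f"
    and c: "geodesic_line c" "\<forall>t. f (c t) = c (t + L)"
    and c': "geodesic_line c'" "\<forall>t. f (c' t) = c' (t + L')"
    and L: "L > 0" "L' > 0"
  shows "L \<le> L'"
proof (rule ccontr)
  assume "\<not> L \<le> L'"
  let ?d = "hyp_dist (c 0) (c' 0)"
  have H: "Im (c t) > 0" "Im (c' t) > 0" for t
    using c(1) c'(1) by (simp_all add: geodesic_line_closed)
  have cn: "hyp_dist (c (real n * L)) (c' (real n * L')) = ?d" for n
  proof (induction n)
    case (Suc n)
    have "hyp_dist (f (c (real n * L))) (f (c' (real n * L'))) = hyp_dist (c (real n * L)) (c' (real n * L'))"
      using f H by (simp add: hyp_isometry_def)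
    then show ?case using Suc by (simp add: c(2) c'(2) algebra_simps)
  qed simp
  obtain n :: nat where n: "2 * ?d < real n * (L - L')"
    using \<open>\<not> L \<le> L'\<close> ex_less_of_nat_mult[of "L - L'"] by auto
  have "real n * L = hyp_dist (c 0) (c (real n * L))"
    using c(1) L by (simp add: geodesic_line_def)
  also have "\<dots> \<le> ?d + hyp_dist (c' 0) (c (real n * L))"
    by (rule hyp_dist_triangle[OF H(1,2,1)])
  also have "hyp_dist (c' 0) (c (real n * L)) \<le>
      hyp_dist (c' 0) (c' (real n * L')) + hyp_dist (c' (real n * L')) (c (real n * L))"
    by (rule hyp_dist_triangle[OF H(2,2,1)])
  also have "hyp_dist (c' 0) (c' (real n * L')) = real n * L'"
    using c'(1) L by (simp add: geodesic_line_def)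
  also have "hyp_dist (c' (real n * L')) (c (real n * L)) = ?d"
    using cn by (simp add: hyp_dist_commute)
  finally show False using n by (simp add: algebra_simps)
qed

lemma translation_length_unique:
  assumes "hyp_isometry f"
    and "geodesic_line c" "\<forall>t. f (c t) = c (t + L)" "L > 0"
    and "geodesic_line c'" "\<forall>t. f (c' t) = c' (t + L')" "L' > 0"
  shows "L = L'"
proof (rule antisym)
  show "L \<le> L'" by (rule translation_length_le[OF assms(1-3,5,6,4,7)])
  show "L' \<le> L" by (rule translation_length_le[OF assms(1,5,6,2,3,7,4)])
qed

section \<open>Classes of holonomies and the traces of their elements\<close>

lemma hyp_isometry_PSL2R: "f \<in> PSL2R \<Longrightarrow> hyp_isometry f"
  by (auto simp: PSL2R_def hyp_isometry_real_moebius)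

lemma hyperbolic_holonomy_isometry:
  assumes "hyperbolic_holonomy P c \<rho>" "\<gamma> \<in> carrier P"
  shows "hyp_isometry (\<rho> \<gamma>)"
  using assms by (auto simp: hyperbolic_holonomy_def intro!: hyp_isometry_PSL2R)

lemma equiv_same_metric: "equiv {\<rho>. hyperbolic_holonomy P c \<rho>} (same_metric P c)"
proof (rule equivI)
  show "same_metric P c \<subseteq> {\<rho>. hyperbolic_holonomy P c \<rho>} \<times> {\<rho>. hyperbolic_holonomy P c \<rho>}"
    by (auto simp: same_metric_def)
  have "hyp_isometry id" by (simp add: hyp_isometry_def)
  then show "refl_on {\<rho>. hyperbolic_holonomy P c \<rho>} (same_metric P c)"
    by (auto simp: same_metric_def refl_on_def intro!: exI[of _ id])
  show "sym (same_metric P c)"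
  proof (rule symI)
    fix \<rho> \<rho>' assume "(\<rho>, \<rho>') \<in> same_metric P c"
    then obtain \<phi> where h: "hyperbolic_holonomy P c \<rho>" "hyperbolic_holonomy P c \<rho>'"
      and \<phi>: "hyp_isometry \<phi>" "\<And>\<gamma> z. \<gamma> \<in> carrier P \<Longrightarrow> z \<in> hyp_plane \<Longrightarrow> \<phi> (\<rho> \<gamma> z) = \<rho>' \<gamma> (\<phi> z)"
      by (auto simp: same_metric_def)
    have b: "bij_betw \<phi> hyp_plane hyp_plane" using \<phi> by (simp add: hyp_isometry_def)
    let ?\<psi> = "inv_into hyp_plane \<phi>"
    have \<psi>: "hyp_isometry ?\<psi>" by (rule hyp_isometry_inv_into[OF \<phi>(1)])
    have "?\<psi> (\<rho>' \<gamma> z) = \<rho> \<gamma> (?\<psi> z)" if "\<gamma> \<in> carrier P" "z \<in> hyp_plane" for \<gamma> z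
    proof -
      have "?\<psi> z \<in> hyp_plane" using hyp_isometry_closed[OF \<psi>] that by simp
      moreover from this have "\<rho> \<gamma> (?\<psi> z) \<in> hyp_plane"
        using hyp_isometry_closed[OF hyperbolic_holonomy_isometry[OF h(1)]] that by simp
      ultimately show ?thesis
        using \<phi>(2)[of \<gamma> "?\<psi> z"] that bij_betw_inv_into_left[OF b] bij_betw_inv_into_right[OF b]
        by metis
    qed
    then show "(\<rho>', \<rho>) \<in> same_metric P c" using h \<psi> by (auto simp: same_metric_def)
  qed
  show "trans (same_metric P c)"
  proof (rule transI)
    fix \<rho>1 \<rho>2 \<rho>3 assume "(\<rho>1, \<rho>2) \<in> same_metric P c" "(\<rho>2, \<rho>3) \<in> same_metric P c"
    then obtain \<phi> \<psi> where h: "hyperbolic_holonomy P c \<rho>1" "hyperbolic_holonomy P c \<rho>3"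
      and \<phi>: "hyp_isometry \<phi>" "\<forall>\<gamma>\<in>carrier P. \<forall>z\<in>hyp_plane. \<phi> (\<rho>1 \<gamma> z) = \<rho>2 \<gamma> (\<phi> z)"
      and \<psi>: "hyp_isometry \<psi>" "\<forall>\<gamma>\<in>carrier P. \<forall>z\<in>hyp_plane. \<psi> (\<rho>2 \<gamma> z) = \<rho>3 \<gamma> (\<psi> z)"
      unfolding same_metric_def by blast
    have "(\<psi> \<circ> \<phi>) (\<rho>1 \<gamma> z) = \<rho>3 \<gamma> ((\<psi> \<circ> \<phi>) z)" if "\<gamma> \<in> carrier P" "z \<in> hyp_plane" for \<gamma> z
      using \<phi>(2) \<psi>(2) that hyp_isometry_closed[OF \<phi>(1)] by simp
    then show "(\<rho>1, \<rho>3) \<in> same_metric P c"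
      using h hyp_isometry_comp[OF \<psi>(1) \<phi>(1)] unfolding same_metric_def by blast
  qed
qed

text \<open>Any representative of \<open>g\<close> is conjugate to \<open>\<rho>\<close> by an
  isometry, which carries the axis of \<open>\<rho> \<gamma>\<close> to a line translated by the
  same \<open>L\<close>. Uniqueness of translation lengths therefore justifies the
  \<open>THE\<close> in \<open>geodesic_length\<close>.\<close>

lemma Tr_eq_abs_trace:
  assumes g: "g \<in> teichmueller_space P c" "\<rho> \<in> g" and \<gamma>: "\<gamma> \<in> carrier P"
    and m: "\<rho> \<gamma> = real_moebius p q r s" "p * s - q * r = 1" "\<bar>p + s\<bar> > 2"
  shows "Tr g \<gamma> = \<bar>p + s\<bar>"
proof -
  obtain c0 L where c0: "L > 0" "geodesic_line c0" "\<And>t. \<rho> \<gamma> (c0 t) = c0 (t + L)"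
    and L: "2 * cosh (L / 2) = \<bar>p + s\<bar>"
    using hyperbolic_axis_abs[OF m(2,3)] m(1) by metis
  have ex: "closed_geodesic_of_length g \<gamma> L"
    using c0 g(2) by (auto simp: closed_geodesic_of_length_def)
  have uniq: "L' = L" if L': "closed_geodesic_of_length g \<gamma> L'" for L'
  proof -
    obtain \<rho>' c' where c': "L' > 0" "\<rho>' \<in> g" "geodesic_line c'" "\<forall>t. \<rho>' \<gamma> (c' t) = c' (t + L')"
      using L' unfolding closed_geodesic_of_length_def by blast
    have "(\<rho>, \<rho>') \<in> same_metric P c"
      by (rule in_quotient_imp_in_rel[OF equiv_same_metric g(1)[unfolded teichmueller_space_def]])
        (simp add: g(2) c'(2))
    then obtain \<phi> where h: "hyperbolic_holonomy P c \<rho>'"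
      and \<phi>: "hyp_isometry \<phi>" "\<And>z. z \<in> hyp_plane \<Longrightarrow> \<phi> (\<rho> \<gamma> z) = \<rho>' \<gamma> (\<phi> z)"
      using \<gamma> by (auto simp: same_metric_def)
    have "c0 t \<in> hyp_plane" for t using geodesic_line_closed[OF c0(2)] by simp
    then have "\<rho>' \<gamma> (\<phi> (c0 t)) = \<phi> (c0 (t + L))" for t using \<phi>(2) c0(3) by metis
    then show "L' = L"
      using translation_length_unique[OF hyperbolic_holonomy_isometry[OF h \<gamma>] c'(3,4,1)
          geodesic_line_isometry[OF \<phi>(1) c0(2)]] c0(1) by blast
  qed
  have "(THE L. closed_geodesic_of_length g \<gamma> L) = L"
    by (rule the_equality[of "closed_geodesic_of_length g \<gamma>", OF ex uniq])
  moreover have "\<exists>L. closed_geodesic_of_length g \<gamma> L" using ex by (rule exI)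
  ultimately have "geodesic_length g \<gamma> = L" unfolding geodesic_length_def by (simp only: if_True)
  then show ?thesis using L by (simp add: Tr_def)
qed

section \<open>Trace identities and normal forms\<close>

lemma free_generators_locale:
  assumes "free_generators P a b"
  shows "free_group_two_generators P a b"
  using assms by (auto simp: free_generators_def free_group_two_generators_def
      group_two_elements_def group_two_elements_axioms_def free_group_two_generators_axioms_def)

lemma PSL2RE:
  assumes "f \<in> PSL2R"
  obtains p q r s where "f = real_moebius p q r s" "p * s - q * r = 1" "p + s \<ge> 0"
proof -
  obtain p q r s where f: "f = real_moebius p q r s" "p * s - q * r = 1"
    using assms by (auto simp: PSL2R_def)
  show ?thesis
  proof (cases "p + s \<ge> 0")
    case False
    then show ?thesis
      using f by (intro that[of "- p" "- q" "- r" "- s"]) (auto simp: real_moebius_uminus)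
  qed (use f that in auto)
qed

lemma real_moebius_parabolic_trace:
  assumes "parabolic (real_moebius p q r s)" "p * s - q * r = 1"
  shows "(p + s)\<^sup>2 = 4"
proof -
  obtain p' q' r' s' where m: "p' * s' - q' * r' = 1" "(p' + s')\<^sup>2 = 4"
    and eq: "real_moebius p q r s = real_moebius p' q' r' s'"
    using assms(1) unfolding parabolic_def by blast
  show ?thesis
    using real_moebius_eqD[OF assms(2) m(1) eq] m(2)
    by (auto simp: power2_eq_square algebra_simps)
qed

text \<open>With \<open>s = - p\<close> the fixed points solve
  \<open>r * z\<^sup>2 - 2 * p * z - q = 0\<close>, so they are (p \<plusminus> i) / r, and one of
  them lies in the upper half plane.\<close>

lemma real_moebius_elliptic_fixed_point:
  assumes "p * s - q * r = 1" "p + s = 0"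
  obtains z where "z \<in> hyp_plane" "real_moebius p q r s z = z"
proof -
  have s: "s = - p" using assms by simp
  have qr: "- (q * r) = 1 + p * p" using assms by (simp add: s)
  then have r: "r \<noteq> 0" by (metis add_nonneg_pos less_irrefl mult_zero_right neg_0_equal_iff_equal
     add.commute zero_le_square zero_less_one)
  define z where "z = Complex (p / r) (1 / \<bar>r\<bar>)"
  have z: "Im z > 0" using r by (simp add: z_def)
  have nz: "of_real r * z + of_real s \<noteq> 0" by (rule moebius_denominator_nonzero[OF assms(1) z])
  have "of_real p * z + of_real q = z * (of_real r * z + of_real s)"
  proof -
    have "q = - ((1 + p * p) / r)" using qr r by (simp add: field_simps)
    then have "p * (p / r) + q = - (1 / r)" by (simp add: add_divide_distrib)
    moreover have "\<bar>r\<bar> * \<bar>r\<bar> = r * r" by simp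
    ultimately show ?thesis using r by (simp add: z_def s complex_eq_iff)
  qed
  then have "real_moebius p q r s z = z"
    using nz z by (simp add: real_moebius_apply)
  with z that show ?thesis by simp
qed

lemma BijGroup_mult_real_moebius:
  assumes "p * s - q * r = 1" "p' * s' - q' * r' = 1"
  shows "real_moebius p q r s \<otimes>\<^bsub>BijGroup hyp_plane\<^esub> real_moebius p' q' r' s' =
    real_moebius (p * p' + q * r') (p * q' + q * s') (r * p' + s * r') (r * q' + s * s')"
  using compose_real_moebius[OF assms] assms by (simp add: BijGroup_def real_moebius_Bij)

lemma hom_mult_real_moebius:
  assumes "\<rho> \<in> hom P (BijGroup hyp_plane)" "x \<in> carrier P" "y \<in> carrier P"
    and "\<rho> x = real_moebius p q r s" "\<rho> y = real_moebius p' q' r' s'"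
    and "p * s - q * r = 1" "p' * s' - q' * r' = 1"
  shows "\<rho> (x \<otimes>\<^bsub>P\<^esub> y) =
    real_moebius (p * p' + q * r') (p * q' + q * s') (r * p' + s * r') (r * q' + s * s')"
  using assms hom_mult[OF assms(1-3)] by (simp add: BijGroup_mult_real_moebius)

lemma BijGroup_inv_real_moebius:
  assumes "p * s - q * r = 1"
  shows "inv\<^bsub>BijGroup hyp_plane\<^esub> (real_moebius p q r s) = real_moebius s (- q) (- r) p"
proof -
  have det: "s * p - (- q) * (- r) = 1" using assms by (simp add: mult.commute)
  have e: "s * p - q * r = 1" "p * s - r * q = 1" using assms by (simp_all add: mult.commute)
  have "real_moebius s (- q) (- r) p \<otimes>\<^bsub>BijGroup hyp_plane\<^esub> real_moebius p q r s = real_moebius 1 0 0 1"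
    using e by (simp add: BijGroup_mult_real_moebius[OF det assms] mult.commute)
  also have "\<dots> = \<one>\<^bsub>BijGroup hyp_plane\<^esub>"
    by (simp add: real_moebius_id BijGroup_def)
  finally show ?thesis
    using assms det real_moebius_Bij
    by (intro group.inv_equality[OF group_BijGroup]) (auto simp: BijGroup_def)
qed

text \<open>Fricke's trace identity for matrices A and B: the m's are the entries of A B, the n's
  those of A^-1 B^-1. Restoring the two determinants as factors turns it into a polynomial
  identity.\<close>

lemma trace_commutator:
  fixes p q r s p' q' r' s' :: real
  assumes "p * s - q * r = 1" "p' * s' - q' * r' = 1"
  defines "x \<equiv> p + s" and "y \<equiv> p' + s'" and "z \<equiv> p * p' + q * r' + (r * q' + s * s')"
    and "m1 \<equiv> p * p' + q * r'" and "m2 \<equiv> p * q' + q * s'"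
    and "m3 \<equiv> r * p' + s * r'" and "m4 \<equiv> r * q' + s * s'"
    and "n1 \<equiv> s * s' + q * r'" and "n2 \<equiv> - (s * q') - q * p'"
    and "n3 \<equiv> - (r * s') - p * r'" and "n4 \<equiv> r * q' + p * p'"
  shows "m1 * n1 + m2 * n3 + (m3 * n2 + m4 * n4) = x\<^sup>2 + y\<^sup>2 + z\<^sup>2 - x * y * z - 2"
proof -
  have "m1 * n1 + m2 * n3 + (m3 * n2 + m4 * n4) =
    x\<^sup>2 * (p' * s' - q' * r') + y\<^sup>2 * (p * s - q * r) + z\<^sup>2 - x * y * z
      - 2 * ((p * s - q * r) * (p' * s' - q' * r'))"
    unfolding x_def y_def z_def m1_def m2_def m3_def m4_def n1_def n2_def n3_def n4_def
    by (simp add: power2_eq_square algebra_simps)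
  then show ?thesis using assms(1,2) by simp
qed

text \<open>Completing the square in \<open>z\<close> turns the relation into \<open>y\<^sup>2 *
  (x\<^sup>2 - 4) = (2 * z - x * y)\<^sup>2 + 4 * x\<^sup>2\<close>, whose right-hand side is
  positive.\<close>

lemma markov_gt_2:
  fixes x y z :: real
  assumes "x\<^sup>2 + y\<^sup>2 + z\<^sup>2 = x * y * z" "x > 0"
  shows "x > 2"
proof -
  have "(2 * z - x * y)\<^sup>2 = 4 * (x\<^sup>2 + y\<^sup>2 + z\<^sup>2) - 4 * x\<^sup>2 - 4 * y\<^sup>2 + x\<^sup>2 * y\<^sup>2 - 4 * (x * y * z)"
    by (simp add: power2_eq_square algebra_simps)
  then have "y\<^sup>2 * (x\<^sup>2 - 4) = (2 * z - x * y)\<^sup>2 + 4 * x\<^sup>2"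
    using assms(1) by (simp add: algebra_simps)
  also have "\<dots> > 0" using assms(2) by (intro add_nonneg_pos) auto
  finally have "x\<^sup>2 - 4 > 0" by (simp add: zero_less_mult_iff)
  then have "2\<^sup>2 < x\<^sup>2" by simp
  then show ?thesis using assms(2) by (intro power_less_imp_less_base[of 2 2 x]) auto
qed

text \<open>If \<open>n\<close> is nilpotent and \<open>tr (n a) = 0\<close>, then \<open>n a n = tr (n a) n = 0\<close>.\<close>

lemma nilpotent_sandwich:
  fixes n1 n2 n3 p q r s :: real
  assumes "n1 * n1 + n2 * n3 = 0" "n1 * p + n2 * r + n3 * q - n1 * s = 0"
  shows "(n1 * p + n2 * r) * n1 + (n1 * q + n2 * s) * n3 = 0"
    "(n1 * p + n2 * r) * n2 - (n1 * q + n2 * s) * n1 = 0"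
    "(n3 * p - n1 * r) * n1 + (n3 * q - n1 * s) * n3 = 0"
    "(n3 * p - n1 * r) * n2 - (n3 * q - n1 * s) * n1 = 0"
proof -
  let ?d = "n1 * n1 + n2 * n3" and ?t = "n1 * p + n2 * r + n3 * q - n1 * s"
  have "(n1 * p + n2 * r) * n1 + (n1 * q + n2 * s) * n3 = n1 * ?t + s * ?d"
    "(n1 * p + n2 * r) * n2 - (n1 * q + n2 * s) * n1 = n2 * ?t - q * ?d"
    "(n3 * p - n1 * r) * n1 + (n3 * q - n1 * s) * n3 = n3 * ?t - r * ?d"
    "(n3 * p - n1 * r) * n2 - (n3 * q - n1 * s) * n1 = - n1 * ?t + p * ?d"
    by (simp_all add: algebra_simps)
  then show "(n1 * p + n2 * r) * n1 + (n1 * q + n2 * s) * n3 = 0"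
    "(n1 * p + n2 * r) * n2 - (n1 * q + n2 * s) * n1 = 0"
    "(n3 * p - n1 * r) * n1 + (n3 * q - n1 * s) * n3 = 0"
    "(n3 * p - n1 * r) * n2 - (n3 * q - n1 * s) * n1 = 0"
    unfolding assms by simp_all
qed

text \<open>Let K and A be the matrices of the k's and of \<open>p\<close>, \<open>q\<close>,
  \<open>r\<close>, \<open>s\<close>; the c's are the entries of A K A^-1. Write K = 1 + n with n
  nilpotent. The assumption \<open>tr'\<close> says tr (A^-1 K) = tr A, so n A and n A^-1 have trace
  0 and n A n = n A^-1 n = 0. The difference of the two products of K and A K A^-1 is n A n A^-1 - A
  n A^-1 n, which vanishes.\<close>

lemma unipotent_commutes_with_conjugate:
  fixes k1 k2 k3 k4 p q r s :: real
  assumes det: "k1 * k4 - k2 * k3 = 1" and tr: "k1 + k4 = 2"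
    and tr': "s * k1 - q * k3 - r * k2 + p * k4 = p + s"
  defines "c1 \<equiv> (p * k1 + q * k3) * s - (p * k2 + q * k4) * r"
    and "c2 \<equiv> (p * k2 + q * k4) * p - (p * k1 + q * k3) * q"
    and "c3 \<equiv> (r * k1 + s * k3) * s - (r * k2 + s * k4) * r"
    and "c4 \<equiv> (r * k2 + s * k4) * p - (r * k1 + s * k3) * q"
  shows "k1 * c1 + k2 * c3 = c1 * k1 + c2 * k3" "k1 * c2 + k2 * c4 = c1 * k2 + c2 * k4"
    "k3 * c1 + k4 * c3 = c3 * k1 + c4 * k3" "k3 * c2 + k4 * c4 = c3 * k2 + c4 * k4"
proof -
  define n where "n = k1 - 1"
  have k: "k1 = 1 + n" "k4 = 1 - n" using tr by (simp_all add: n_def)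
  have d: "n * n + k2 * k3 = 0" using det unfolding k by (simp add: algebra_simps)
  have t: "n * p + k2 * r + k3 * q - n * s = 0" "n * s + k2 * - r + k3 * - q - n * p = 0"
    using tr' unfolding k by (simp_all add: algebra_simps)
  note X = nilpotent_sandwich[OF d t(1)] and Y = nilpotent_sandwich[OF d t(2)]
  \<comment> \<open>Here and in the next three identities, an entry of (n A n) A^-1 - A (n A^-1 n),
    arranged so that \<open>X\<close> and \<open>Y\<close> rewrite its pieces to 0.\<close>
  have "k1 * c1 + k2 * c3 - (c1 * k1 + c2 * k3) =
     ((n * p + k2 * r) * n + (n * q + k2 * s) * k3) * s - ((n * p + k2 * r) * k2 - (n * q + k2 * s) * n) * r
   - (p * ((n * s + k2 * - r) * n + (n * - q + k2 * p) * k3) + q * ((k3 * s - n * - r) * n + (k3 * - q - n * p) * k3))"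
    unfolding c1_def c2_def c3_def c4_def k by (simp add: algebra_simps)
  then show "k1 * c1 + k2 * c3 = c1 * k1 + c2 * k3" unfolding X Y by simp
  have "k1 * c2 + k2 * c4 - (c1 * k2 + c2 * k4) =
     ((n * p + k2 * r) * k2 - (n * q + k2 * s) * n) * p - ((n * p + k2 * r) * n + (n * q + k2 * s) * k3) * q
   - (p * ((n * s + k2 * - r) * k2 - (n * - q + k2 * p) * n) + q * ((k3 * s - n * - r) * k2 - (k3 * - q - n * p) * n))"
    unfolding c1_def c2_def c3_def c4_def k by (simp add: algebra_simps)
  then show "k1 * c2 + k2 * c4 = c1 * k2 + c2 * k4" unfolding X Y by simp
  have "k3 * c1 + k4 * c3 - (c3 * k1 + c4 * k3) =
     ((k3 * p - n * r) * n + (k3 * q - n * s) * k3) * s - ((k3 * p - n * r) * k2 - (k3 * q - n * s) * n) * r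
   - (r * ((n * s + k2 * - r) * n + (n * - q + k2 * p) * k3) + s * ((k3 * s - n * - r) * n + (k3 * - q - n * p) * k3))"
    unfolding c1_def c2_def c3_def c4_def k by (simp add: algebra_simps)
  then show "k3 * c1 + k4 * c3 = c3 * k1 + c4 * k3" unfolding X Y by simp
  have "k3 * c2 + k4 * c4 - (c3 * k2 + c4 * k4) =
     ((k3 * p - n * r) * k2 - (k3 * q - n * s) * n) * p - ((k3 * p - n * r) * n + (k3 * q - n * s) * k3) * q
   - (r * ((n * s + k2 * - r) * k2 - (n * - q + k2 * p) * n) + s * ((k3 * s - n * - r) * k2 - (k3 * - q - n * p) * n))"
    unfolding c1_def c2_def c3_def c4_def k by (simp add: algebra_simps)
  then show "k3 * c2 + k4 * c4 = c3 * k2 + c4 * k4" unfolding X Y by simp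
qed

section \<open>Traces of a holonomy of the punctured torus\<close>

locale punctured_torus_holonomy = free_group_two_generators +
  fixes \<rho>
  assumes holonomy: "hyperbolic_holonomy P (commutator_of P a b) \<rho>"
begin

lemma hom_BijGroup: "\<rho> \<in> hom P (BijGroup hyp_plane)"
  using holonomy by (simp add: hyperbolic_holonomy_def)

lemma image_PSL2R: "\<gamma> \<in> carrier P \<Longrightarrow> \<rho> \<gamma> \<in> PSL2R"
  using holonomy by (auto simp: hyperbolic_holonomy_def)

lemma fixed_point_imp_one:
  "\<gamma> \<in> carrier P \<Longrightarrow> z \<in> hyp_plane \<Longrightarrow> \<rho> \<gamma> z = z \<Longrightarrow> \<gamma> = \<one>"
  using holonomy by (auto simp: hyperbolic_holonomy_def)

lemma group_hom_BijGroup: "group_hom P (BijGroup hyp_plane) \<rho>"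
  using hom_BijGroup group_BijGroup is_group
  by (simp add: group_hom_def group_hom_axioms_def)

lemmas mult_real_moebius = hom_mult_real_moebius[OF hom_BijGroup]

lemma inv_real_moebius:
  assumes "x \<in> carrier P" "\<rho> x = real_moebius p q r s" "p * s - q * r = 1"
  shows "\<rho> (inv x) = real_moebius s (- q) (- r) p"
  using assms group_hom.hom_inv[OF group_hom_BijGroup assms(1)] by (simp add: BijGroup_inv_real_moebius)

lemma faithful:
  assumes "x \<in> carrier P" "y \<in> carrier P" "\<rho> x = \<rho> y"
  shows "x = y"
proof -
  have "\<i> \<in> hyp_plane" by simp
  have "\<rho> (inv x \<otimes> y) = inv\<^bsub>BijGroup hyp_plane\<^esub> \<rho> y \<otimes>\<^bsub>BijGroup hyp_plane\<^esub> \<rho> y"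
    using assms hom_mult[OF hom_BijGroup] group_hom.hom_inv[OF group_hom_BijGroup] by simp
  also have "\<dots> = \<one>\<^bsub>BijGroup hyp_plane\<^esub>"
    by (rule group.l_inv[OF group_BijGroup hom_in_carrier[OF hom_BijGroup assms(2)]])
  finally have "\<rho> (inv x \<otimes> y) = (\<lambda>z\<in>hyp_plane. z)" by (simp add: BijGroup_def)
  then have "inv x \<otimes> y = \<one>"
    using assms fixed_point_imp_one[of "inv x \<otimes> y" \<i>] by simp
  then show ?thesis using assms by (metis inv_equality inv_inv inv_closed)
qed

text \<open>Otherwise the commutator of \<open>k\<close> with its conjugate, written out as a word
  in the generators, would have trivial value; evaluation shows that its reduced form is not
  empty.\<close>

lemma commutator_not_commuting_with_conjugate:
  defines "k \<equiv> commutator_of P a b"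
  shows "k \<otimes> (a \<otimes> k \<otimes> inv a) \<noteq> a \<otimes> k \<otimes> inv a \<otimes> k"
proof
  assume comm: "k \<otimes> (a \<otimes> k \<otimes> inv a) = a \<otimes> k \<otimes> inv a \<otimes> k"
  let ?A = "(True, True)" and ?A' = "(True, False)" and ?B = "(False, True)" and ?B' = "(False, False)"
  let ?k = "[?A, ?B, ?A', ?B']" and ?k' = "[?B, ?A, ?B', ?A']"
  let ?c = "[?A] @ ?k @ [?A']" and ?c' = "[?A] @ ?k' @ [?A']"
  have k: "word_value P a b ?k = k"
    using a_closed b_closed by (simp add: k_def commutator_of_def letter_def m_assoc)
  have kc: "k \<in> carrier P" using k word_value_closed by metis
  have c: "word_value P a b ?c = a \<otimes> k \<otimes> inv a"
    using a_closed kc unfolding word_value_append k by (simp add: letter_def m_assoc)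
  have k': "word_value P a b ?k' = inv k"
    using word_value_inverse[of ?k] k by (simp add: inv_letter_def)
  have c': "word_value P a b ?c' = inv (a \<otimes> k \<otimes> inv a)"
    using word_value_inverse[of ?c] c by (simp add: inv_letter_def)
  have "word_value P a b ((?k @ ?c) @ ?k' @ ?c') = (k \<otimes> (a \<otimes> k \<otimes> inv a)) \<otimes> (inv k \<otimes> inv (a \<otimes> k \<otimes> inv a))"
    by (simp only: word_value_append[of "?k @ ?c" "?k' @ ?c'"] word_value_append[of ?k ?c]
        word_value_append[of ?k' ?c'] k c k' c')
  also have "\<dots> = a \<otimes> k \<otimes> inv a \<otimes> k \<otimes> (inv k \<otimes> inv (a \<otimes> k \<otimes> inv a))"
    by (simp only: comm)
  also have "\<dots> = \<one>"
    using a_closed kc by (metis inv_closed inv_mult_group m_closed r_inv)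
  finally have "free_reduction ((?k @ ?c) @ ?k' @ ?c') = []"
    by (rule word_value_eq_one)
  then show False
    by (simp add: free_reduction_def cancel_Cons_def inv_letter_def)
qed

text \<open>Of the two possible values \<open>\<plusminus> 2\<close> of the trace of the commutator, \<open>2\<close> would make the
  commutator commute with its conjugate by \<open>a\<close>.\<close>

lemma fricke_coordinates:
  obtains p q r s p' q' r' s' where
    "\<rho> a = real_moebius p q r s" "p * s - q * r = 1"
    "\<rho> b = real_moebius p' q' r' s'" "p' * s' - q' * r' = 1"
    "p + s > 2" "p' + s' > 2"
    "(p + s)\<^sup>2 + (p' + s')\<^sup>2 + (p * p' + q * r' + (r * q' + s * s'))\<^sup>2 =
      (p + s) * (p' + s') * (p * p' + q * r' + (r * q' + s * s'))"
proof -
  obtain p q r s where A: "\<rho> a = real_moebius p q r s" "p * s - q * r = 1" "p + s \<ge> 0"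
    using image_PSL2R[OF a_closed] by (rule PSL2RE)
  obtain p' q' r' s' where B: "\<rho> b = real_moebius p' q' r' s'" "p' * s' - q' * r' = 1" "p' + s' \<ge> 0"
    using image_PSL2R[OF b_closed] by (rule PSL2RE)
  define x where "x = p + s"
  define y where "y = p' + s'"
  define z where "z = p * p' + q * r' + (r * q' + s * s')"
  define k where "k = commutator_of P a b"
  have A': "s * p - - q * - r = 1" and B': "s' * p' - - q' * - r' = 1"
    using A(2) B(2) by (simp_all add: mult.commute)
  define m1 m2 m3 m4 where m: "m1 = p * p' + q * r'" "m2 = p * q' + q * s'"
    "m3 = r * p' + s * r'" "m4 = r * q' + s * s'"
  define n1 n2 n3 n4 where n: "n1 = s * s' + q * r'" "n2 = - (s * q') - q * p'"
    "n3 = - (r * s') - p * r'" "n4 = r * q' + p * p'"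
  define k1 k2 k3 k4 where k: "k1 = m1 * n1 + m2 * n3" "k2 = m1 * n2 + m2 * n4"
    "k3 = m3 * n1 + m4 * n3" "k4 = m3 * n2 + m4 * n4"
  have ab: "\<rho> (a \<otimes> b) = real_moebius m1 m2 m3 m4"
    unfolding m by (rule mult_real_moebius[OF a_closed b_closed A(1) B(1) A(2) B(2)])
  have dm: "m1 * m4 - m2 * m3 = 1" unfolding m by (rule det_mult[OF A(2) B(2)])
  have dn: "n1 * n4 - n2 * n3 = 1"
    using det_mult[OF A' B'] unfolding n by (simp add: algebra_simps)
  have n': "s * s' + - q * - r' = n1" "s * - q' + - q * p' = n2" "- r * s' + p * - r' = n3" "- r * - q' + p * p' = n4"
    unfolding n by simp_all
  have a'b': "\<rho> (inv a \<otimes> inv b) = real_moebius n1 n2 n3 n4"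
    using mult_real_moebius[OF _ _ inv_real_moebius[OF a_closed A(1,2)] inv_real_moebius[OF b_closed B(1,2)] A' B']
      a_closed b_closed unfolding n' by simp
  have dk: "k1 * k4 - k2 * k3 = 1" unfolding k by (rule det_mult[OF dm dn])
  have keq: "k = a \<otimes> b \<otimes> (inv a \<otimes> inv b)"
    using a_closed b_closed by (simp add: k_def commutator_of_def m_assoc)
  have \<rho>k: "\<rho> k = real_moebius k1 k2 k3 k4"
    unfolding k keq using a_closed b_closed by (intro mult_real_moebius[OF _ _ ab a'b' dm dn]) auto
  have kc: "k \<in> carrier P" using a_closed b_closed by (simp add: keq)
  have trk: "k1 + k4 = x\<^sup>2 + y\<^sup>2 + z\<^sup>2 - x * y * z - 2"
    using trace_commutator[OF A(2) B(2)] unfolding k m n x_def y_def z_def by simp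
  have "parabolic (real_moebius k1 k2 k3 k4)"
    using holonomy \<rho>k by (simp add: hyperbolic_holonomy_def k_def)
  then have "(k1 + k4)\<^sup>2 = 4" by (rule real_moebius_parabolic_trace[OF _ dk])
  then have "(k1 + k4)\<^sup>2 = 2\<^sup>2" by simp
  then consider "k1 + k4 = 2" | "k1 + k4 = - 2" by (auto simp only: power2_eq_iff)
  then have neg: "k1 + k4 = - 2"
  proof cases
    case 1
    define c1 c2 c3 c4 where c: "c1 = (p * k1 + q * k3) * s - (p * k2 + q * k4) * r"
      "c2 = (p * k2 + q * k4) * p - (p * k1 + q * k3) * q"
      "c3 = (r * k1 + s * k3) * s - (r * k2 + s * k4) * r"
      "c4 = (r * k2 + s * k4) * p - (r * k1 + s * k3) * q"
    have "\<rho> (a \<otimes> k) = real_moebius (p * k1 + q * k3) (p * k2 + q * k4) (r * k1 + s * k3) (r * k2 + s * k4)"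
      by (rule mult_real_moebius[OF a_closed kc A(1) \<rho>k A(2) dk])
    then have \<rho>c: "\<rho> (a \<otimes> k \<otimes> inv a) = real_moebius c1 c2 c3 c4"
      using mult_real_moebius[OF _ _ _ inv_real_moebius[OF a_closed A(1,2)] det_mult[OF A(2) dk] A']
        a_closed kc unfolding c by (simp add: algebra_simps)
    have dc: "c1 * c4 - c2 * c3 = 1"
      using det_mult[OF det_mult[OF A(2) dk] A'] unfolding c by (simp add: algebra_simps)
    \<comment> \<open>With K = A B A^-1 B^-1 the left-hand side is the trace of A^-1 K = B A^-1
      B^-1, which is the trace of A.\<close>
    have "s * k1 - q * k3 - r * k2 + p * k4 = (p + s) * (p * s - q * r) * (p' * s' - q' * r')"
      unfolding k m n by (simp add: algebra_simps)
    then have tr': "s * k1 - q * k3 - r * k2 + p * k4 = p + s" using A(2) B(2) by simp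
    have "\<rho> (k \<otimes> (a \<otimes> k \<otimes> inv a)) = \<rho> (a \<otimes> k \<otimes> inv a \<otimes> k)"
      using mult_real_moebius[OF kc _ \<rho>k \<rho>c dk dc] mult_real_moebius[OF _ kc \<rho>c \<rho>k dc dk]
        a_closed kc unipotent_commutes_with_conjugate[OF dk 1 tr', folded c] by simp
    then have "k \<otimes> (a \<otimes> k \<otimes> inv a) = a \<otimes> k \<otimes> inv a \<otimes> k"
      using a_closed kc by (intro faithful) auto
    then show ?thesis
      using commutator_not_commuting_with_conjugate by (simp add: k_def)
  qed
  then have markov: "x\<^sup>2 + y\<^sup>2 + z\<^sup>2 = x * y * z" using trk by simp
  have "a \<noteq> \<one>"
  proof
    assume "a = \<one>"
    then have "word_value P a b [(True, True)] = \<one>" by (simp add: letter_def)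
    from word_value_eq_one[OF this] show False by (simp add: free_reduction_def cancel_Cons_def)
  qed
  have "x \<noteq> 0"
  proof
    assume "x = 0"
    then obtain w where "w \<in> hyp_plane" "\<rho> a w = w"
      using real_moebius_elliptic_fixed_point[OF A(2)] A(1) by (auto simp: x_def)
    then show False using fixed_point_imp_one[OF a_closed] \<open>a \<noteq> \<one>\<close> by blast
  qed
  then have x: "x > 0" using A(3) by (simp add: x_def)
  have "y \<noteq> 0"
  proof
    assume "y = 0"
    then have "x\<^sup>2 + z\<^sup>2 = 0" using markov by simp
    then show False using x by simp
  qed
  then have y: "y > 0" using B(3) by (simp add: y_def)
  have "y\<^sup>2 + x\<^sup>2 + z\<^sup>2 = y * x * z" using markov by (simp add: algebra_simps)
  then have "x > 2" "y > 2" using markov_gt_2[OF markov x] markov_gt_2[OF _ y] by blast+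
  then show ?thesis
    using that[OF A(1,2) B(1,2)] markov unfolding x_def y_def z_def by blast
qed

end

text \<open>In an eigenbasis of the first matrix, \<open>y\<close> and \<open>z\<close> are two
  independent linear functions of the diagonal entries of the second, which gives \<open>t\<close>
  and \<open>y - t\<close>. The determinant fixes the product of the off-diagonal entries, and
  scaling the upper right one to 1 fixes both.\<close>

lemma normal_form:
  fixes p q r s p' q' r' s' :: real
  assumes A: "p * s - q * r = 1" and B: "p' * s' - q' * r' = 1"
  defines "x \<equiv> p + s" and "y \<equiv> p' + s'" and "z \<equiv> p * p' + q * r' + (r * q' + s * s')"
  assumes x: "x > 2" and markov: "x\<^sup>2 + y\<^sup>2 + z\<^sup>2 = x * y * z"
  defines "l \<equiv> large_eigenvalue x"
  defines "t \<equiv> (z - y / l) / (l - 1 / l)"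
  obtains \<phi> where "hyp_isometry \<phi>"
    "\<And>w. w \<in> hyp_plane \<Longrightarrow> \<phi> (real_moebius p q r s w) = real_moebius l 0 0 (1 / l) (\<phi> w)"
    "\<And>w. w \<in> hyp_plane \<Longrightarrow> \<phi> (real_moebius p' q' r' s' w) = real_moebius t 1 (t * (y - t) - 1) (y - t) (\<phi> w)"
proof -
  have l: "l > 1" "p + s = l + 1 / l" using large_eigenvalue[OF x] by (simp_all add: l_def x_def)
  obtain \<alpha> \<beta> \<gamma> \<delta> where T: "\<alpha> * \<delta> - \<beta> * \<gamma> = 1" and
    eig: "p * \<alpha> + q * \<gamma> = l * \<alpha>" "r * \<alpha> + s * \<gamma> = l * \<gamma>"
    "p * \<beta> + q * \<delta> = \<beta> / l" "r * \<beta> + s * \<delta> = \<delta> / l"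
    using eigenbasis_SL2[OF A l] by metis
  have U: "\<delta> * \<alpha> - - \<beta> * - \<gamma> = 1" using T by (simp add: mult.commute)
  let ?U = "real_moebius \<delta> (- \<beta>) (- \<gamma>) \<alpha>"
  \<comment> \<open>The entries of the second matrix in the eigenbasis of the first.\<close>
  define b1 b2 b3 b4 where b: "b1 = \<delta> * (p' * \<alpha> + q' * \<gamma>) + - \<beta> * (r' * \<alpha> + s' * \<gamma>)"
    "b2 = \<delta> * (p' * \<beta> + q' * \<delta>) + - \<beta> * (r' * \<beta> + s' * \<delta>)"
    "b3 = - \<gamma> * (p' * \<alpha> + q' * \<gamma>) + \<alpha> * (r' * \<alpha> + s' * \<gamma>)"
    "b4 = - \<gamma> * (p' * \<beta> + q' * \<delta>) + \<alpha> * (r' * \<beta> + s' * \<delta>)"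
  have db: "b1 * b4 - b2 * b3 = 1"
    unfolding b by (rule det_mult[OF U det_mult[OF B T]])
  have UA: "?U (real_moebius p q r s w) = real_moebius l 0 0 (1 / l) (?U w)" if w: "Im w > 0" for w
  proof -
    have v: "Im (?U w) > 0" by (rule Im_real_moebius_pos[OF U w])
    have w': "w = real_moebius \<alpha> \<beta> \<gamma> \<delta> (?U w)"
      using real_moebius_left_inverse[OF U w] by simp
    have "real_moebius p q r s w = real_moebius (l * \<alpha>) (\<beta> / l) (l * \<gamma>) (\<delta> / l) (?U w)"
      by (subst w', subst real_moebius_real_moebius[OF A T v]) (simp only: eig)
    moreover have "?U (real_moebius (l * \<alpha>) (\<beta> / l) (l * \<gamma>) (\<delta> / l) (?U w)) =
      real_moebius (\<delta> * (l * \<alpha>) + - \<beta> * (l * \<gamma>)) (\<delta> * (\<beta> / l) + - \<beta> * (\<delta> / l))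
        (- \<gamma> * (l * \<alpha>) + \<alpha> * (l * \<gamma>)) (- \<gamma> * (\<beta> / l) + \<alpha> * (\<delta> / l)) (?U w)"
      using det_mult[OF A T, unfolded eig] by (rule real_moebius_real_moebius[OF U _ v])
    moreover have "\<delta> * (l * \<alpha>) + - \<beta> * (l * \<gamma>) = l * (\<alpha> * \<delta> - \<beta> * \<gamma>)"
      "- \<gamma> * (\<beta> / l) + \<alpha> * (\<delta> / l) = (\<alpha> * \<delta> - \<beta> * \<gamma>) / l"
      "\<delta> * (\<beta> / l) + - \<beta> * (\<delta> / l) = 0" "- \<gamma> * (l * \<alpha>) + \<alpha> * (l * \<gamma>) = 0"
      by (simp_all add: algebra_simps diff_divide_distrib)
    ultimately show ?thesis by (simp only: T mult_1_right)
  qed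
  have UB: "?U (real_moebius p' q' r' s' w) = real_moebius b1 b2 b3 b4 (?U w)" if w: "Im w > 0" for w
  proof -
    have v: "Im (?U w) > 0" by (rule Im_real_moebius_pos[OF U w])
    have "w = real_moebius \<alpha> \<beta> \<gamma> \<delta> (?U w)"
      using real_moebius_left_inverse[OF U w] by simp
    then show ?thesis
      unfolding b real_moebius_real_moebius[OF U det_mult[OF B T] v, symmetric]
        real_moebius_real_moebius[OF B T v, symmetric] by simp
  qed
  have y: "y = b1 + b4"
  proof -
    have "b1 + b4 = y * (\<alpha> * \<delta> - \<beta> * \<gamma>)" unfolding b y_def by (simp add: algebra_simps)
    then show ?thesis using T by simp
  qed
  have z: "z = l * b1 + b4 / l"
  proof -
    have "l * b1 + b4 / l = \<delta> * (p' * (l * \<alpha>) + q' * (l * \<gamma>)) - \<beta> * (r' * (l * \<alpha>) + s' * (l * \<gamma>))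
       - \<gamma> * (p' * (\<beta> / l) + q' * (\<delta> / l)) + \<alpha> * (r' * (\<beta> / l) + s' * (\<delta> / l))"
      unfolding b by (simp add: algebra_simps add_divide_distrib diff_divide_distrib)
    also have "\<dots> = z * (\<alpha> * \<delta> - \<beta> * \<gamma>)"
      unfolding eig[symmetric] z_def by (simp add: algebra_simps)
    finally show ?thesis using T by simp
  qed
  have "b2 \<noteq> 0"
  proof
    assume "b2 = 0"
    then have bb: "b1 * b4 = 1" using db by simp
    define m where "m = 1 / l"
    have lm: "l * m = 1" using l by (simp add: m_def)
    have xyz: "x = l + m" "y = b1 + b4" "z = l * b1 + m * b4"
      using l y z by (simp_all add: x_def m_def)
    \<comment> \<open>If \<open>b2\<close> vanished, both matrices would be lower triangular and
      their commutator would have trace 2. Accordingly the right-hand side has the value 4, while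
      the relation makes the left-hand side 0.\<close>
    have "x\<^sup>2 + y\<^sup>2 + z\<^sup>2 - x * y * z =
       l\<^sup>2 * (1 - b1 * b4) + m\<^sup>2 * (1 - b1 * b4) + b1\<^sup>2 * (1 - l * m) + b4\<^sup>2 * (1 - l * m)
         + 2 * (l * m) + 2 * (b1 * b4) + 2 * (l * m) * (b1 * b4) - 2 * (l * m) * (b1 * b4)"
      unfolding xyz by (simp add: power2_eq_square algebra_simps)
    then show False using markov bb lm by simp
  qed
  have "1 / l < 1" using l by simp
  then have "l - 1 / l \<noteq> 0" using l(1) by linarith
  moreover have "z - y / l = b1 * (l - 1 / l)"
    unfolding z y by (simp add: algebra_simps add_divide_distrib)
  ultimately have t: "t = b1" by (simp add: t_def)
  have yt: "y - t = b4" "t * (y - t) - 1 = b3 * b2"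
    using y t db by (simp_all add: algebra_simps)
  let ?\<phi> = "hyp_scale (1 / b2) \<circ> ?U"
  have k: "1 / b2 \<noteq> 0" using \<open>b2 \<noteq> 0\<close> by simp
  show ?thesis
  proof (rule that)
    show "hyp_isometry ?\<phi>"
      by (rule hyp_isometry_comp[OF hyp_isometry_hyp_scale[OF k] hyp_isometry_real_moebius[OF U]])
    fix w assume "w \<in> hyp_plane"
    then have w: "Im w > 0" by simp
    have v: "Im (?U w) > 0" by (rule Im_real_moebius_pos[OF U w])
    have "l * (1 / l) - 0 * 0 = 1" using l by simp
    from hyp_scale_real_moebius[OF k this v]
    show "?\<phi> (real_moebius p q r s w) = real_moebius l 0 0 (1 / l) (?\<phi> w)"
      by (simp add: UA[OF w])
    show "?\<phi> (real_moebius p' q' r' s' w) = real_moebius t 1 (t * (y - t) - 1) (y - t) (?\<phi> w)"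
      unfolding yt(2) unfolding yt(1) unfolding t
      using hyp_scale_real_moebius[OF k db v] \<open>b2 \<noteq> 0\<close> by (simp add: UB[OF w])
  qed
qed

context group_two_elements
begin

lemma intertwining_extends:
  assumes gen: "generate P {a, b} = carrier P"
    and h: "hyperbolic_holonomy P c \<rho>" "hyperbolic_holonomy P c \<rho>'" "hyp_isometry \<phi>"
    and a: "\<And>z. z \<in> hyp_plane \<Longrightarrow> \<phi> (\<rho> a z) = \<rho>' a (\<phi> z)"
    and b: "\<And>z. z \<in> hyp_plane \<Longrightarrow> \<phi> (\<rho> b z) = \<rho>' b (\<phi> z)"
  shows "(\<rho>, \<rho>') \<in> same_metric P c"
proof -
  have maps: "\<sigma> \<gamma> z \<in> hyp_plane" if "hyperbolic_holonomy P c \<sigma>" "\<gamma> \<in> carrier P" "z \<in> hyp_plane" for \<sigma> \<gamma> z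
    using hyp_isometry_closed[OF hyperbolic_holonomy_isometry[OF that(1,2)]] that(3) by simp
  have id_one: "\<sigma> \<one> z = z" if \<sigma>: "hyperbolic_holonomy P c \<sigma>" and z: "z \<in> hyp_plane" for \<sigma> z
  proof -
    have "\<sigma> \<one> = \<one>\<^bsub>BijGroup hyp_plane\<^esub>"
      using \<sigma> is_group group_BijGroup by (auto simp: hyperbolic_holonomy_def intro: hom_one)
    then show ?thesis using z by (simp add: BijGroup_def)
  qed
  have mult: "\<sigma> (\<gamma> \<otimes> \<delta>) z = \<sigma> \<gamma> (\<sigma> \<delta> z)"
    if \<sigma>: "hyperbolic_holonomy P c \<sigma>" and \<gamma>: "\<gamma> \<in> carrier P" "\<delta> \<in> carrier P" and z: "z \<in> hyp_plane" for \<sigma> \<gamma> \<delta> z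
  proof -
    have hom: "\<sigma> \<in> hom P (BijGroup hyp_plane)" using \<sigma> by (simp add: hyperbolic_holonomy_def)
    then have "\<sigma> \<gamma> \<in> Bij hyp_plane" "\<sigma> \<delta> \<in> Bij hyp_plane"
      using \<gamma> hom_in_carrier[OF hom] by (auto simp: BijGroup_def)
    then show ?thesis
      using hom_mult[OF hom \<gamma>] z by (simp add: BijGroup_def compose_eq)
  qed
  have \<phi>H: "\<phi> z \<in> hyp_plane" if "z \<in> hyp_plane" for z
    using hyp_isometry_closed[OF h(3)] that by simp
  have inv_case: "\<phi> (\<rho> (inv \<gamma>) z) = \<rho>' (inv \<gamma>) (\<phi> z)"
    if \<gamma>: "\<gamma> \<in> carrier P" and eq: "\<And>z. z \<in> hyp_plane \<Longrightarrow> \<phi> (\<rho> \<gamma> z) = \<rho>' \<gamma> (\<phi> z)"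
      and z: "z \<in> hyp_plane" for \<gamma> z
  proof -
    define w where "w = \<rho> (inv \<gamma>) z"
    have w: "w \<in> hyp_plane" using maps[OF h(1) _ z] \<gamma> by (simp add: w_def)
    have "z = \<rho> \<gamma> w" using mult[OF h(1) \<gamma> _ z, of "inv \<gamma>"] \<gamma> id_one[OF h(1) z] by (simp add: w_def)
    then have "\<rho>' (inv \<gamma>) (\<phi> z) = \<rho>' (inv \<gamma>) (\<rho>' \<gamma> (\<phi> w))" using eq[OF w] by simp
    also have "\<dots> = \<phi> w"
      using mult[OF h(2) _ \<gamma> \<phi>H[OF w], of "inv \<gamma>"] \<gamma> id_one[OF h(2) \<phi>H[OF w]] by simp
    finally show ?thesis by (simp add: w_def)
  qed
  have "\<gamma> \<in> carrier P \<and> (\<forall>z\<in>hyp_plane. \<phi> (\<rho> \<gamma> z) = \<rho>' \<gamma> (\<phi> z))" if "\<gamma> \<in> generate P {a, b}" for \<gamma>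
    using that
  proof (induction rule: generate.induct)
    case one
    then show ?case using id_one[OF h(1)] id_one[OF h(2)] \<phi>H by auto
  next
    case (incl \<gamma>)
    then show ?case using a b a_closed b_closed by auto
  next
    case (inv \<gamma>)
    then show ?case using inv_case a b a_closed b_closed by auto
  next
    case (eng \<gamma> \<delta>)
    then show ?case
      using mult[OF h(1)] mult[OF h(2)] maps[OF h(1)] \<phi>H by (auto simp del: hyp_plane_iff)
  qed
  then show ?thesis using h gen by (auto simp: same_metric_def)
qed

end

text \<open>Substituting \<open>x = t + 2\<close> in the quintic below gives the coefficients \<open>1, 8, 20, 11, -16, -16\<close>,
  with a single change of sign.\<close>

lemma trace_equations_unique:
  fixes x z x' z' :: real
  assumes "x > 2" "2 * x\<^sup>2 + z\<^sup>2 = x\<^sup>2 * z" "x\<^sup>2 - 2 = x * z - x"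
    and "x' > 2" "2 * x'\<^sup>2 + z'\<^sup>2 = x'\<^sup>2 * z'" "x'\<^sup>2 - 2 = x' * z' - x'"
  shows "x = x'" "z = z'"
proof -
  \<comment> \<open>The quintic in \<open>t\<close> is split at its sign change and divided by
    \<open>t\<close>: a root is a point where the increasing \<open>h\<close> meets the decreasing
    \<open>16 + 16 / t\<close>, which happens at most once.\<close>
  define h :: "real \<Rightarrow> real" where "h t = t ^ 4 + 8 * t ^ 3 + 20 * t\<^sup>2 + 11 * t" for t
  have h: "h (x - 2) = 16 + 16 / (x - 2)"
    if x: "x > 2" and e: "2 * x\<^sup>2 + z\<^sup>2 = x\<^sup>2 * z" "x\<^sup>2 - 2 = x * z - x" for x z :: real
  proof -
    define t where "t = x - 2"
    have xz: "x * z = x\<^sup>2 + x - 2" using e(2) by simp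
    have "2 * x ^ 4 + (x * z)\<^sup>2 = x ^ 3 * (x * z)"
    proof -
      have "2 * x ^ 4 + (x * z)\<^sup>2 = x\<^sup>2 * (2 * x\<^sup>2 + z\<^sup>2)"
        by (simp add: algebra_simps power2_eq_square power4_eq_xxxx)
      then show ?thesis
        unfolding e(1) by (simp add: algebra_simps power2_eq_square power3_eq_cube)
    qed
    then have "2 * x ^ 4 + (x\<^sup>2 + x - 2)\<^sup>2 = x ^ 3 * (x\<^sup>2 + x - 2)" by (simp only: xz)
    moreover have "x = t + 2" by (simp add: t_def)
    ultimately have "h t * t = 16 * t + 16"
      by (simp add: h_def power2_eq_square power3_eq_cube power4_eq_xxxx algebra_simps)
    moreover have "t > 0" using x by (simp add: t_def)
    ultimately have "h t = 16 + 16 / t" by (simp add: field_simps)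
    then show ?thesis by (simp add: t_def)
  qed
  have mono: "h s < h t" if "0 < s" "s < t" for s t
    unfolding h_def using that
    by (intro add_strict_mono mult_strict_left_mono power_strict_mono) auto
  have anti: "16 + 16 / t < 16 + 16 / s" if "0 < s" "s < t" for s t :: real
    using that by (simp add: frac_less2)
  show "x = x'"
  proof (rule linorder_cases[of x x'])
    assume "x < x'"
    then show ?thesis
      using mono[of "x - 2" "x' - 2"] anti[of "x - 2" "x' - 2"] h[OF assms(1-3)] h[OF assms(4-6)] assms(1,4)
      by simp
  next
    assume "x' < x"
    then show ?thesis
      using mono[of "x' - 2" "x - 2"] anti[of "x' - 2" "x - 2"] h[OF assms(1-3)] h[OF assms(4-6)] assms(1,4)
      by simp
  qed
  then have "x * z = x * z'" using assms by simp
  then show "z = z'" using assms(1) by simp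
qed

section \<open>Uniqueness of the solution\<close>

context free_group_two_generators
begin

text \<open>The conjugated generators are expressed by \<open>x\<close> and \<open>z\<close> alone,
  so that two solutions can be compared through their traces.\<close>

lemma solution_normal_form:
  assumes g: "g \<in> teichmueller_space P (commutator_of P a b)"
    and tr: "Tr g a = Tr g b" "Tr g (a [^] (2::nat)) = Tr g (a [^] (2::nat) \<otimes> b)"
  obtains \<rho> x z \<phi> where "\<rho> \<in> g" "hyperbolic_holonomy P (commutator_of P a b) \<rho>"
    "x > 2" "2 * x\<^sup>2 + z\<^sup>2 = x\<^sup>2 * z" "x\<^sup>2 - 2 = x * z - x" "hyp_isometry \<phi>"
    "let l = large_eigenvalue x; t = (z - x / l) / (l - 1 / l) in
      \<forall>w\<in>hyp_plane. \<phi> (\<rho> a w) = real_moebius l 0 0 (1 / l) (\<phi> w) \<and>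
        \<phi> (\<rho> b w) = real_moebius t 1 (t * (x - t) - 1) (x - t) (\<phi> w)"
proof -
  obtain \<rho> where \<rho>: "hyperbolic_holonomy P (commutator_of P a b) \<rho>"
    and g_eq: "g = same_metric P (commutator_of P a b) `` {\<rho>}"
    using g unfolding teichmueller_space_def by (auto elim: quotientE)
  have \<rho>g: "\<rho> \<in> g"
    unfolding g_eq by (rule equiv_class_self[OF equiv_same_metric]) (simp add: \<rho>)
  interpret punctured_torus_holonomy P a b \<rho> by unfold_locales (rule \<rho>)
  obtain p q r s p' q' r' s' where A: "\<rho> a = real_moebius p q r s" "p * s - q * r = 1"
    and B: "\<rho> b = real_moebius p' q' r' s'" "p' * s' - q' * r' = 1"
    and gt: "p + s > 2" "p' + s' > 2"
    and markov: "(p + s)\<^sup>2 + (p' + s')\<^sup>2 + (p * p' + q * r' + (r * q' + s * s'))\<^sup>2 =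
      (p + s) * (p' + s') * (p * p' + q * r' + (r * q' + s * s'))"
    by (rule fricke_coordinates)
  define x where "x = p + s"
  define y where "y = p' + s'"
  define z where "z = p * p' + q * r' + (r * q' + s * s')"
  have x: "x > 2" and y: "y > 2" using gt by (simp_all add: x_def y_def)
  have m: "x\<^sup>2 + y\<^sup>2 + z\<^sup>2 = x * y * z" using markov by (simp add: x_def y_def z_def)
  have "\<rho> (a \<otimes> a) = real_moebius (p * p + q * r) (p * q + q * s) (r * p + s * r) (r * q + s * s)"
    by (rule mult_real_moebius[OF a_closed a_closed A(1) A(1) A(2) A(2)])
  moreover have a2: "a [^] (2::nat) = a \<otimes> a" using a_closed by (simp add: numeral_2_eq_2)
  ultimately have \<rho>a2: "\<rho> (a [^] (2::nat)) = real_moebius (p * p + q * r) (p * q + q * s) (r * p + s * r) (r * q + s * s)"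
    by simp
  note \<rho>a2b = mult_real_moebius[OF nat_pow_closed[OF a_closed] b_closed \<rho>a2 B(1) det_mult[OF A(2) A(2)] B(2)]
  have tr_a2: "p * p + q * r + (r * q + s * s) = x\<^sup>2 - 2"
  proof -
    have "p * p + q * r + (r * q + s * s) = x\<^sup>2 - 2 * (p * s - q * r)"
      by (simp add: x_def power2_eq_square algebra_simps)
    then show ?thesis using A(2) by simp
  qed
  have tr_a2b: "(p * p + q * r) * p' + (p * q + q * s) * r' + ((r * p + s * r) * q' + (r * q + s * s) * s') = x * z - y"
  proof -
    have "(p * p + q * r) * p' + (p * q + q * s) * r' + ((r * p + s * r) * q' + (r * q + s * s) * s') =
      x * z - y * (p * s - q * r)"
      unfolding x_def y_def z_def by (simp add: algebra_simps)
    then show ?thesis using A(2) by simp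
  qed
  \<comment> \<open>As a quadratic in \<open>y\<close> the relation has the second root
    \<open>x * z - y\<close>, the trace of a^2 b. The new triple satisfies the same relation, so
    this trace also exceeds 2 and equals its absolute value.\<close>
  have "y * (x * z - y) = x\<^sup>2 + z\<^sup>2" using m by (simp add: power2_eq_square algebra_simps)
  moreover have "x\<^sup>2 + z\<^sup>2 > 0" using x by (intro add_pos_nonneg) auto
  ultimately have "x * z - y > 0" using y by (metis zero_less_mult_pos less_trans zero_less_numeral)
  moreover have "(x * z - y)\<^sup>2 + x\<^sup>2 + z\<^sup>2 = (x * z - y) * x * z"
    using m by (simp add: power2_eq_square algebra_simps)
  ultimately have gt_a2b: "x * z - y > 2" by (rule markov_gt_2[rotated])
  have "2 * 2 < x * x" using x by (intro mult_strict_mono) auto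
  then have gt_a2: "x\<^sup>2 - 2 > 2" by (simp add: power2_eq_square)
  have "Tr g a = x" using Tr_eq_abs_trace[OF g \<rho>g a_closed A] x by (simp add: x_def)
  moreover have "Tr g b = y" using Tr_eq_abs_trace[OF g \<rho>g b_closed B] y by (simp add: y_def)
  ultimately have xy: "y = x" using tr by simp
  have "Tr g (a [^] (2::nat)) = x\<^sup>2 - 2"
    using Tr_eq_abs_trace[OF g \<rho>g nat_pow_closed[OF a_closed] \<rho>a2 det_mult[OF A(2) A(2)]] gt_a2
    unfolding tr_a2 by simp
  moreover have "Tr g (a [^] (2::nat) \<otimes> b) = x * z - y"
    using Tr_eq_abs_trace[OF g \<rho>g m_closed[OF nat_pow_closed[OF a_closed] b_closed] \<rho>a2b
        det_mult[OF det_mult[OF A(2) A(2)] B(2)]] gt_a2b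
    unfolding tr_a2b by simp
  ultimately have eq2: "x\<^sup>2 - 2 = x * z - x" using tr xy by simp
  have eq1: "2 * x\<^sup>2 + z\<^sup>2 = x\<^sup>2 * z" using m xy by (simp add: power2_eq_square)
  obtain \<phi> where \<phi>: "hyp_isometry \<phi>"
    "\<And>w. w \<in> hyp_plane \<Longrightarrow> \<phi> (real_moebius p q r s w) =
      real_moebius (large_eigenvalue x) 0 0 (1 / large_eigenvalue x) (\<phi> w)"
    "\<And>w. w \<in> hyp_plane \<Longrightarrow> \<phi> (real_moebius p' q' r' s' w) =
      (let l = large_eigenvalue x; t = (z - y / l) / (l - 1 / l) in real_moebius t 1 (t * (y - t) - 1) (y - t) (\<phi> w))"
    using normal_form[OF A(2) B(2) gt(1) markov] unfolding x_def y_def z_def Let_def by metis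
  show ?thesis
    by (rule that[OF \<rho>g \<rho> x eq1 eq2 \<phi>(1)]) (use \<phi>(2,3) in \<open>simp add: A(1) B(1) Let_def xy\<close>)
qed

lemma solution_unique:
  assumes "g \<in> teichmueller_space P (commutator_of P a b)"
    "Tr g a = Tr g b" "Tr g (a [^] (2::nat)) = Tr g (a [^] (2::nat) \<otimes> b)"
    and "g' \<in> teichmueller_space P (commutator_of P a b)"
    "Tr g' a = Tr g' b" "Tr g' (a [^] (2::nat)) = Tr g' (a [^] (2::nat) \<otimes> b)"
  shows "g = g'"
proof -
  let ?N = "\<lambda>x z \<phi> \<rho>. let l = large_eigenvalue x; t = (z - x / l) / (l - 1 / l) in
      \<forall>w\<in>hyp_plane. \<phi> (\<rho> a w) = real_moebius l 0 0 (1 / l) (\<phi> w) \<and>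
        \<phi> (\<rho> b w) = real_moebius t 1 (t * (x - t) - 1) (x - t) (\<phi> w)"
  obtain \<rho> x z \<phi> where \<rho>: "\<rho> \<in> g" "hyperbolic_holonomy P (commutator_of P a b) \<rho>"
    and xz: "x > 2" "2 * x\<^sup>2 + z\<^sup>2 = x\<^sup>2 * z" "x\<^sup>2 - 2 = x * z - x" and \<phi>: "hyp_isometry \<phi>"
    and N: "?N x z \<phi> \<rho>"
    by (rule solution_normal_form[OF assms(1-3)])
  obtain \<rho>' x' z' \<phi>' where \<rho>': "\<rho>' \<in> g'" "hyperbolic_holonomy P (commutator_of P a b) \<rho>'"
    and xz': "x' > 2" "2 * x'\<^sup>2 + z'\<^sup>2 = x'\<^sup>2 * z'" "x'\<^sup>2 - 2 = x' * z' - x'" and \<phi>': "hyp_isometry \<phi>'"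
    and N': "?N x' z' \<phi>' \<rho>'"
    by (rule solution_normal_form[OF assms(4-6)])
  have x': "x' = x" "z' = z" using trace_equations_unique[OF xz xz'] by simp_all
  \<comment> \<open>Both normal forms are given by the same \<open>x\<close> and \<open>z\<close>,
    hence are one pair of maps; composing one conjugation with the inverse of the other intertwines
    the holonomies.\<close>
  obtain f h where f: "\<And>w. w \<in> hyp_plane \<Longrightarrow> \<phi> (\<rho> a w) = f (\<phi> w)" "\<And>w. w \<in> hyp_plane \<Longrightarrow> \<phi>' (\<rho>' a w) = f (\<phi>' w)"
    and h: "\<And>w. w \<in> hyp_plane \<Longrightarrow> \<phi> (\<rho> b w) = h (\<phi> w)" "\<And>w. w \<in> hyp_plane \<Longrightarrow> \<phi>' (\<rho>' b w) = h (\<phi>' w)"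
    using N N' unfolding x' Let_def by blast
  define \<psi> where "\<psi> = inv_into hyp_plane \<phi>' \<circ> \<phi>"
  have bij: "bij_betw \<phi>' hyp_plane hyp_plane" using \<phi>' by (simp add: hyp_isometry_def)
  have \<psi>: "hyp_isometry \<psi>"
    unfolding \<psi>_def by (rule hyp_isometry_comp[OF hyp_isometry_inv_into[OF \<phi>'] \<phi>])
  have intertwine: "\<psi> (\<rho> \<gamma> w) = \<rho>' \<gamma> (\<psi> w)"
    if \<gamma>: "\<gamma> \<in> carrier P" and w: "w \<in> hyp_plane"
      and e: "\<phi> (\<rho> \<gamma> w) = f (\<phi> w)" "\<And>w. w \<in> hyp_plane \<Longrightarrow> \<phi>' (\<rho>' \<gamma> w) = f (\<phi>' w)" for \<gamma> w f
  proof -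
    have "\<psi> w \<in> hyp_plane" using hyp_isometry_closed[OF \<psi>] w by simp
    have "\<phi> w \<in> hyp_plane" using hyp_isometry_closed[OF \<phi>] w by simp
    then have "\<phi>' (\<psi> w) = \<phi> w" by (simp add: \<psi>_def bij_betw_inv_into_right[OF bij])
    then have "\<phi> (\<rho> \<gamma> w) = \<phi>' (\<rho>' \<gamma> (\<psi> w))" using e \<open>\<psi> w \<in> hyp_plane\<close> by simp
    moreover have "\<rho>' \<gamma> (\<psi> w) \<in> hyp_plane"
      using hyp_isometry_closed[OF hyperbolic_holonomy_isometry[OF \<rho>'(2) \<gamma>]] \<open>\<psi> w \<in> hyp_plane\<close> by simp
    ultimately show ?thesis by (simp add: \<psi>_def bij_betw_inv_into_left[OF bij])
  qed
  have "(\<rho>, \<rho>') \<in> same_metric P (commutator_of P a b)"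
  proof (rule intertwining_extends[OF _ \<rho>(2) \<rho>'(2) \<psi>])
    show "generate P {a, b} = carrier P" using generators by (simp add: free_generators_def)
  qed (use intertwine[OF a_closed] intertwine[OF b_closed] f h in blast)+
  then show ?thesis
    by (rule quotient_eqI[OF equiv_same_metric assms(1)[unfolded teichmueller_space_def]
          assms(4)[unfolded teichmueller_space_def] \<rho>(1) \<rho>'(1)])
qed

end

section \<open>Discreteness and area\<close>

lemma continuous_on_hyp_dist:
  assumes "Im z > 0"
  shows "continuous_on hyp_plane (hyp_dist z)"
proof -
  have "continuous_on hyp_plane (\<lambda>w. 1 + (cmod (z - w))\<^sup>2 / (2 * Im z * Im w))"
    using assms by (intro continuous_intros) auto
  then show ?thesis
    unfolding hyp_dist_def using assms
    by (intro continuous_on_compose2[OF continuous_on_arcosh[of "{1..}"]]) auto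
qed

text \<open>For \<open>r \<ge> 0\<close> the ball is the Euclidean disc \<open>T\<close>. Its
  inequality, imposed on the whole plane, already keeps points off the closed lower half plane, so
  closedness in the plane comes directly from it.\<close>

lemma compact_hyp_cball:
  assumes "Im z > 0"
  shows "compact {w \<in> hyp_plane. hyp_dist w z \<le> r}"
proof (cases "r \<ge> 0")
  case False
  then have "{w \<in> hyp_plane. hyp_dist w z \<le> r} = {}"
    using hyp_dist_nonneg[OF _ assms] by force
  then show ?thesis by (simp only: compact_empty)
next
  case True
  define c where "c = 2 * (cosh r - 1) * Im z"
  have c: "c \<ge> 0" using assms cosh_real_ge_1[of r] by (simp add: c_def)
  define T where "T = {w. (cmod (w - z))\<^sup>2 \<le> c * Im w}"
  have "{w \<in> hyp_plane. hyp_dist w z \<le> r} = T"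
  proof (rule Set.set_eqI)
    fix w
    show "w \<in> {w \<in> hyp_plane. hyp_dist w z \<le> r} \<longleftrightarrow> w \<in> T"
    proof (cases "Im w > 0")
      case w: True
      have "hyp_dist w z \<le> r \<longleftrightarrow> cosh (hyp_dist w z) \<le> cosh r"
        using cosh_real_nonneg_le_iff[of "hyp_dist w z" r] hyp_dist_nonneg[OF w assms] True by simp
      also have "\<dots> \<longleftrightarrow> (cmod (w - z))\<^sup>2 / (2 * Im w * Im z) \<le> cosh r - 1"
        by (simp add: cosh_hyp_dist[OF w assms] algebra_simps)
      also have "\<dots> \<longleftrightarrow> (cmod (w - z))\<^sup>2 \<le> c * Im w"
      proof -
        have "(cosh r - 1) * (2 * Im w * Im z) = c * Im w" "0 < 2 * Im w * Im z"
          using w assms by (simp_all add: c_def)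
        then show ?thesis by (simp only: pos_divide_le_eq)
      qed
      finally show ?thesis using w by (simp add: T_def)
    next
      case w: False
      have "w \<notin> T"
      proof
        assume "w \<in> T"
        moreover have "c * Im w \<le> 0" using c w by (simp add: mult_nonneg_nonpos)
        ultimately have "(cmod (w - z))\<^sup>2 \<le> 0"
          unfolding T_def mem_Collect_eq by (rule order_trans)
        then have "w = z" by simp
        then show False using w assms by simp
      qed
      then show ?thesis using w by simp
    qed
  qed
  moreover have "compact T"
  proof -
    have "closed T" unfolding T_def by (intro closed_Collect_le continuous_intros)
    moreover have "dist z w \<le> c + Im z" if "w \<in> T" for w
    proof (rule ccontr)
      let ?d = "cmod (w - z)"
      assume "\<not> dist z w \<le> c + Im z"
      then have d: "?d > c + Im z" by (simp add: dist_norm norm_minus_commute)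
      then have "(c + Im z) * ?d < ?d * ?d"
        using c assms by (intro mult_strict_right_mono) auto
      also have "\<dots> \<le> c * Im w" using that by (simp add: T_def power2_eq_square)
      also have "\<dots> \<le> c * (Im z + ?d)"
        using c abs_Im_le_cmod[of "w - z"] by (intro mult_left_mono) auto
      finally have "Im z * ?d < Im z * c" by (simp add: algebra_simps)
      then have "?d < c" using assms by simp
      then show False using d assms by simp
    qed
    then have "bounded T" unfolding bounded_def by blast
    ultimately show ?thesis by (simp add: compact_eq_bounded_closed)
  qed
  ultimately show ?thesis by simp
qed

text \<open>An accumulation point would have two members of \<open>E\<close> within
  \<open>r / 2\<close>. The second is taken nearer to it than the first, which makes them
  distinct.\<close>

lemma hyp_separated_finite:
  assumes "compact K" "K \<subseteq> hyp_plane" "E \<subseteq> K" "r > 0"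
    and sep: "\<And>u v. u \<in> E \<Longrightarrow> v \<in> E \<Longrightarrow> u \<noteq> v \<Longrightarrow> hyp_dist u v \<ge> r"
  shows "finite E"
proof (rule ccontr)
  assume "infinite E"
  then obtain p where p: "p \<in> K" "p islimpt E"
    using assms(1,3) by (metis compact_eq_Bolzano_Weierstrass)
  then have ip: "Im p > 0" using assms(2) by auto
  have "hyp_dist p p = 0" by (simp add: hyp_dist_def)
  moreover have "continuous (at p within hyp_plane) (hyp_dist p)"
    using continuous_on_hyp_dist[OF ip] ip by (simp add: continuous_on_eq_continuous_within)
  ultimately obtain e where e: "e > 0" "\<And>w. w \<in> hyp_plane \<Longrightarrow> dist w p < e \<Longrightarrow> dist (hyp_dist p w) 0 < r / 2"
    using \<open>r > 0\<close> unfolding continuous_within_eps_delta by (metis half_gt_zero)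
  obtain u where u: "u \<in> E" "u \<noteq> p" "dist u p < e"
    using p(2) e(1) by (meson islimpt_approachable)
  obtain v where v: "v \<in> E" "v \<noteq> p" "dist v p < dist u p"
    using p(2) u(2) by (meson islimpt_approachable zero_less_dist_iff)
  have H: "u \<in> hyp_plane" "v \<in> hyp_plane" using u v assms by auto
  have "hyp_dist u v \<le> hyp_dist p u + hyp_dist p v"
    using hyp_dist_triangle[of u p v] H ip by (simp add: hyp_dist_commute)
  also have "\<dots> < r"
    using e(2)[OF H(1)] e(2)[OF H(2)] u v by auto
  finally show False using sep[OF u(1) v(1)] v(3) by auto
qed

text \<open>If \<open>f i\<close> moves a point of \<open>K\<close> into \<open>K\<close>, then
  \<open>f i z\<close> lies within \<open>2 * R\<close> of \<open>z\<close>, and this compact ball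
  holds finitely many separated points. Separation is by index, so finitely many points mean
  finitely many indices.\<close>

lemma properly_discontinuous_of_separated_orbit:
  assumes z: "Im z > 0" and r: "r > 0"
    and iso: "\<And>i. i \<in> I \<Longrightarrow> hyp_isometry (f i)"
    and sep: "\<And>i j. i \<in> I \<Longrightarrow> j \<in> I \<Longrightarrow> i \<noteq> j \<Longrightarrow> hyp_dist (f i z) (f j z) \<ge> r"
    and K: "compact K" "K \<subseteq> hyp_plane"
  shows "finite {i \<in> I. f i ` K \<inter> K \<noteq> {}}"
proof -
  have "compact (hyp_dist z ` K)"
    using continuous_on_subset[OF continuous_on_hyp_dist[OF z] K(2)] K(1) by (rule compact_continuous_image)
  then obtain R where R: "\<And>k. k \<in> K \<Longrightarrow> hyp_dist z k \<le> R"
    using compact_imp_bounded bounded_real by (metis abs_le_D1 imageI)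
  let ?S = "{i \<in> I. f i ` K \<inter> K \<noteq> {}}"
  let ?B = "{w \<in> hyp_plane. hyp_dist w z \<le> 2 * R}"
  have "f i z \<in> ?B" if i: "i \<in> ?S" for i
  proof -
    obtain k where k: "k \<in> K" "f i k \<in> K" using i by auto
    have H: "Im k > 0" "Im (f i k) > 0" "Im (f i z) > 0"
      using k K(2) hyp_isometry_closed[OF iso z] i by auto
    have "hyp_dist (f i z) z \<le> hyp_dist (f i z) (f i k) + hyp_dist (f i k) z"
      by (rule hyp_dist_triangle[OF H(3,2) z])
    also have "hyp_dist (f i z) (f i k) = hyp_dist z k"
      using iso i H(1) z by (auto simp: hyp_isometry_def)
    finally show ?thesis using R[OF k(1)] R[OF k(2)] H(3) by (simp add: hyp_dist_commute)
  qed
  then have "finite ((\<lambda>i. f i z) ` ?S)"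
    using sep by (intro hyp_separated_finite[OF compact_hyp_cball[OF z] _ _ r]) auto
  moreover have "inj_on (\<lambda>i. f i z) ?S"
  proof (rule inj_onI, rule ccontr)
    fix i j assume ij: "i \<in> ?S" "j \<in> ?S" "f i z = f j z" "i \<noteq> j"
    then have "r \<le> hyp_dist (f i z) (f j z)" using sep by blast
    then show False using r ij(3) by (simp add: hyp_dist_def)
  qed
  ultimately show ?thesis by (rule finite_imageD)
qed

text \<open>Cutting the strip into boxes of height \<open>e\<close> and bounding the density by its
  value at the bottom of each compares the area with the sum of the inverse squares.\<close>

lemma hyp_area_cusp_strip:
  assumes "e > 0" "m \<ge> 0"
  shows "hyp_area {z. \<bar>Re z\<bar> \<le> m \<and> e \<le> Im z} < \<infinity>"
proof -
  let ?D = "{z. \<bar>Re z\<bar> \<le> m \<and> e \<le> Im z}"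
  define box where "box n = cbox (Complex (- m) (real (Suc n) * e)) (Complex m (real (Suc (Suc n)) * e))" for n
  define f where "f n = 1 / (real (Suc n) * e)\<^sup>2" for n
  have cover: "ennreal (1 / (Im z)\<^sup>2) * indicator ?D z \<le> suminf (\<lambda>n. ennreal (f n) * indicator (box n) z)" for z
  proof (cases "z \<in> ?D")
    case True
    \<comment> \<open>Box \<open>n\<close> begins at height \<open>Suc n * e\<close>, hence the
      subtraction of 1.\<close>
    define n where "n = nat \<lfloor>Im z / e\<rfloor> - 1"
    have "1 \<le> Im z / e" using True assms(1) by simp
    then have "1 \<le> \<lfloor>Im z / e\<rfloor>" by simp
    then have "real (Suc n) = of_int \<lfloor>Im z / e\<rfloor>" by (simp add: n_def)
    then have "real (Suc n) \<le> Im z / e" "Im z / e \<le> real (Suc (Suc n))" by linarith+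
    then have n: "real (Suc n) * e \<le> Im z" "Im z \<le> real (Suc (Suc n)) * e"
      using assms(1) by (simp_all only: pos_le_divide_eq pos_divide_le_eq)
    then have "z \<in> box n" using True by (auto simp: box_def in_cbox_complex_iff)
    have "0 < real (Suc n) * e" using assms(1) by simp
    then have "1 / (Im z)\<^sup>2 \<le> f n"
      unfolding f_def using n(1) by (intro divide_left_mono power_mono mult_pos_pos) auto
    then have "ennreal (1 / (Im z)\<^sup>2) * indicator ?D z \<le> ennreal (f n) * indicator (box n) z"
      using True \<open>z \<in> box n\<close> by (simp add: ennreal_leI)
    also have "\<dots> = (\<Sum>i\<in>{n}. ennreal (f i) * indicator (box i) z)"
      by (simp del: sum_mult_indicator)
    also have "\<dots> \<le> suminf (\<lambda>n. ennreal (f n) * indicator (box n) z)"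
      by (intro sum_le_suminf) auto
    finally show ?thesis .
  qed simp
  have "hyp_area ?D \<le> (\<integral>\<^sup>+z. suminf (\<lambda>n. ennreal (f n) * indicator (box n) z) \<partial>lborel)"
    unfolding hyp_area_def by (intro nn_integral_mono cover)
  also have "\<dots> = suminf (\<lambda>n. \<integral>\<^sup>+z. ennreal (f n) * indicator (box n) z \<partial>lborel)"
    by (intro nn_integral_suminf) (simp add: box_def)
  also have "\<dots> = suminf (\<lambda>n. ennreal (2 * m / e * (1 / (real (Suc n))\<^sup>2)))"
  proof (rule suminf_cong)
    fix n
    have "emeasure lborel (box n) = ennreal (2 * m * e)"
      using assms unfolding box_def
      by (subst emeasure_lborel_cbox) (auto simp: Basis_complex_def algebra_simps)
    moreover have "f n * (2 * m * e) = 2 * m / e * (1 / (real (Suc n))\<^sup>2)"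
      using assms(1) unfolding f_def power_mult_distrib by (simp add: power2_eq_square)
    moreover have "f n \<ge> 0" by (simp add: f_def)
    ultimately show "(\<integral>\<^sup>+z. ennreal (f n) * indicator (box n) z \<partial>lborel) = ennreal (2 * m / e * (1 / (real (Suc n))\<^sup>2))"
      using assms by (simp add: nn_integral_cmult_indicator box_def ennreal_mult[symmetric] del: of_nat_Suc)
  qed
  also have "\<dots> < \<infinity>"
  proof -
    have "summable (\<lambda>n. 1 / (real (Suc n))\<^sup>2)"
      using summable_Suc_iff[of "\<lambda>n. 1 / (real n)\<^sup>2"] inverse_power_summable[of 2, where 'a = real]
      by (simp add: inverse_eq_divide)
    then have "summable (\<lambda>n. 2 * m / e * (1 / (real (Suc n))\<^sup>2))" by (rule summable_mult)
    then have "suminf (\<lambda>n. ennreal (2 * m / e * (1 / (real (Suc n))\<^sup>2))) \<noteq> \<infinity>"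
      unfolding infinity_ennreal_def using assms by (intro ennreal_suminf_neq_top) auto
    then show ?thesis unfolding infinity_ennreal_def less_top[symmetric] .
  qed
  finally show ?thesis .
qed

section \<open>An explicit family of Fricke groups\<close>

text \<open>A Fricke group with traces \<open>(k\<^sup>2 + 2) / k\<close>, \<open>(k\<^sup>2 + 2) / k\<close>, \<open>k\<^sup>2 + 2\<close>, normalised such that the
  commutator of the generators is the translation by \<open>2 (k\<^sup>2 + 2)\<close>.\<close>

definition fricke_A :: "real \<Rightarrow> complex \<Rightarrow> complex" where
  "fricke_A k = real_moebius ((1 + k\<^sup>2) / k) (1 / k) (1 / k) (1 / k)"

definition fricke_B :: "real \<Rightarrow> complex \<Rightarrow> complex" where
  "fricke_B k = real_moebius ((1 + k\<^sup>2) / k) (- (1 / k)) (- (1 / k)) (1 / k)"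

text \<open>The half planes of the ping-pong game: \<open>side_exterior l\<close> is the interior of the complement of
  \<open>side_region l\<close>, and the letter \<open>l\<close> maps \<open>side_exterior (inv_letter l)\<close> into \<open>side_region l\<close>. The four
  half planes bound an ideal quadrilateral with vertices \<open>-1\<close>, \<open>0\<close>, \<open>1\<close> and \<open>\<infinity>\<close>.\<close>

definition side_region :: "bool \<times> bool \<Rightarrow> complex set" where
  "side_region l = {w \<in> hyp_plane. let t = if fst l then Re w else - Re w in
     if snd l then t > 1 else (cmod w)\<^sup>2 + t < 0}"

definition side_exterior :: "bool \<times> bool \<Rightarrow> complex set" where
  "side_exterior l = {w \<in> hyp_plane. let t = if fst l then Re w else - Re w in
     if snd l then t < 1 else (cmod w)\<^sup>2 + t > 0}"

lemma side_region_disjoint: "side_region l \<inter> side_exterior l = {}"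
  by (auto simp: side_region_def side_exterior_def Let_def split: if_splits)

text \<open>Different half planes are disjoint: the two half discs lie over \<bar>Re w\<bar> < 1,
  and wherever \<bar>Re w\<bar> \<ge> 1, positivity of \<open>Im w\<close> gives \<bar>Re w\<bar> <
  \<bar>w\<bar>^2.\<close>

lemma side_region_subset_exterior:
  assumes "l \<noteq> m"
  shows "side_region l \<subseteq> side_exterior m"
proof
  fix w assume w: "w \<in> side_region l"
  have pos: "Im w > 0" using w by (simp add: side_region_def)
  have "\<bar>Re w\<bar> < (cmod w)\<^sup>2" if "\<not> \<bar>Re w\<bar> < 1"
  proof -
    have "1 * \<bar>Re w\<bar> \<le> \<bar>Re w\<bar> * \<bar>Re w\<bar>" using that by (intro mult_right_mono) auto
    also have "\<dots> < (cmod w)\<^sup>2" using pos by (simp add: cmod_power2 power2_eq_square[of "Re w"])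
    finally show ?thesis by simp
  qed
  moreover define N where "N = (cmod w)\<^sup>2"
  ultimately consider "\<bar>Re w\<bar> < 1" | "\<bar>Re w\<bar> < N" by blast
  then show "w \<in> side_exterior m"
  proof cases
    case 1
    then show ?thesis
      using w assms pos zero_le_power2[of "cmod w"]
      unfolding side_region_def side_exterior_def Let_def mem_Collect_eq
      unfolding N_def[symmetric]
      by (cases l; cases m) (auto split: if_splits)
  next
    case 2
    then show ?thesis
      using w assms pos unfolding side_region_def side_exterior_def Let_def mem_Collect_eq
      unfolding N_def[symmetric]
      by (cases l; cases m) (auto split: if_splits)
  qed
qed

lemma carrier_BijGroup: "carrier (BijGroup S) = Bij S"
  by (simp add: BijGroup_def)

lemma mult_BijGroup_apply:
  "f \<in> Bij S \<Longrightarrow> g \<in> Bij S \<Longrightarrow> x \<in> S \<Longrightarrow> (f \<otimes>\<^bsub>BijGroup S\<^esub> g) x = f (g x)"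
  by (simp add: BijGroup_def compose_eq)

lemma one_BijGroup: "\<one>\<^bsub>BijGroup S\<^esub> = (\<lambda>x\<in>S. x)"
  by (simp add: BijGroup_def)

text \<open>The bounds put both 1 and \<open>k\<^sup>2 / 2\<close> below \<open>k\<close>, as the
  covering by isometric circles requires.\<close>

locale fricke_group =
  fixes k :: real
  assumes k_gt: "1 < k" and k_lt: "k < 2"
begin

lemma k_pos: "k > 0"
  using k_gt by simp

lemma det_A: "(1 + k\<^sup>2) / k * (1 / k) - 1 / k * (1 / k) = 1"
  and det_B: "(1 + k\<^sup>2) / k * (1 / k) - (- (1 / k)) * (- (1 / k)) = 1"
  using k_pos by (simp_all add: field_simps power2_eq_square)

lemma det_A_inv: "1 / k * ((1 + k\<^sup>2) / k) - (- (1 / k)) * (- (1 / k)) = 1"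
  and det_B_inv: "1 / k * ((1 + k\<^sup>2) / k) - (1 / k) * (1 / k) = 1"
  using k_pos by (simp_all add: field_simps power2_eq_square)

sublocale generated: group_two_elements "BijGroup hyp_plane" "fricke_A k" "fricke_B k"
proof -
  have "fricke_A k \<in> carrier (BijGroup hyp_plane)" "fricke_B k \<in> carrier (BijGroup hyp_plane)"
    unfolding fricke_A_def fricke_B_def
    using real_moebius_Bij[OF det_A] real_moebius_Bij[OF det_B] by (simp_all add: BijGroup_def)
  then show "group_two_elements (BijGroup hyp_plane) (fricke_A k) (fricke_B k)"
    by (simp add: group_two_elements_def group_two_elements_axioms_def group_BijGroup)
qed

abbreviation "letter_map \<equiv> letter (BijGroup hyp_plane) (fricke_A k) (fricke_B k)"
abbreviation "word_map \<equiv> word_value (BijGroup hyp_plane) (fricke_A k) (fricke_B k)"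

lemma letter_map_moebius:
  "letter_map (True, True) = real_moebius ((1 + k\<^sup>2) / k) (1 / k) (1 / k) (1 / k)"
  "letter_map (True, False) = real_moebius (1 / k) (- (1 / k)) (- (1 / k)) ((1 + k\<^sup>2) / k)"
  "letter_map (False, True) = real_moebius ((1 + k\<^sup>2) / k) (- (1 / k)) (- (1 / k)) (1 / k)"
  "letter_map (False, False) = real_moebius (1 / k) (1 / k) (1 / k) ((1 + k\<^sup>2) / k)"
  using BijGroup_inv_real_moebius[OF det_A] BijGroup_inv_real_moebius[OF det_B]
  by (simp_all add: letter_def fricke_A_def fricke_B_def)

lemma letter_map_PSL2R: "letter_map l \<in> PSL2R"
proof -
  have "real_moebius p q r s \<in> PSL2R" if "p * s - q * r = 1" for p q r s
    using that by (auto simp: PSL2R_def)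
  note PSL = this[OF det_A] this[OF det_A_inv] this[OF det_B] this[OF det_B_inv]
  consider "l = (True, True)" | "l = (True, False)" | "l = (False, True)" | "l = (False, False)"
    by (cases l) auto
  then show ?thesis by cases (simp_all only: letter_map_moebius PSL)
qed

lemma word_map_Cons_apply:
  assumes "Im z > 0"
  shows "word_map (l # w) z = letter_map l (word_map w z)"
proof -
  have "letter_map l \<in> Bij hyp_plane" "word_map w \<in> Bij hyp_plane"
    using generated.letter_closed[of l] generated.word_value_closed[of w] by (simp_all only: carrier_BijGroup)
  then show ?thesis using assms unfolding word_value_Cons by (intro mult_BijGroup_apply) simp_all
qed

lemma word_map_Nil_apply: "Im z > 0 \<Longrightarrow> word_map [] z = z"
  by (simp add: one_BijGroup)

lemma word_map_PSL2R: "word_map w \<in> PSL2R"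
proof (induction w)
  case Nil
  have "word_map [] = real_moebius 1 0 0 1" by (simp add: one_BijGroup real_moebius_id)
  then show ?case by (force simp: PSL2R_def)
next
  case (Cons l w)
  obtain p q r s p' q' r' s' where m: "letter_map l = real_moebius p q r s" "p * s - q * r = 1"
    "word_map w = real_moebius p' q' r' s'" "p' * s' - q' * r' = 1"
    using letter_map_PSL2R[of l] Cons unfolding PSL2R_def by blast
  then have "word_map (l # w) =
      real_moebius (p * p' + q * r') (p * q' + q * s') (r * p' + s * r') (r * q' + s * s')"
    by (simp add: BijGroup_mult_real_moebius)
  with det_mult[OF m(2,4)] show ?case unfolding PSL2R_def by blast
qed

text \<open>For the two generators the limit at infinity is split off: comparing the real part of
  the image with 1 or -1 becomes a question about the sign of the remaining term.\<close>

lemma letter_map_apply: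
  assumes "Im w > 0"
  shows "letter_map (True, True) w = 1 + of_real (k\<^sup>2) * (w / (w + 1))"
    "letter_map (True, False) w = (w - 1) / (of_real (1 + k\<^sup>2) - w)"
    "letter_map (False, True) w = - 1 + of_real (k\<^sup>2) * (w / (1 - w))"
    "letter_map (False, False) w = (w + 1) / (of_real (1 + k\<^sup>2) + w)"
proof -
  have nz: "of_real c + w \<noteq> 0" "of_real c - w \<noteq> 0" "w + of_real c \<noteq> 0" for c
    using assms by (auto simp: complex_eq_iff)
  have nz': "w + 1 \<noteq> 0" "1 - w \<noteq> 0" using nz(3)[of 1] nz(2)[of 1] by simp_all
  have k: "of_real k \<noteq> (0::complex)" using k_pos by simp
  have cancel: "(u / of_real k) / (v / of_real k) = u / v" for u v :: complex
    using k by simp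
  have linear: "of_real (c / k) * w + of_real (d / k) = (of_real c * w + of_real d) / of_real k" for c d
    by (simp add: add_divide_distrib)
  have moebius: "real_moebius (c / k) (d / k) (c' / k) (d' / k) w =
      (of_real c * w + of_real d) / (of_real c' * w + of_real d')" for c d c' d'
    using assms by (simp only: real_moebius_apply linear cancel)
  have "letter_map (True, True) w = (of_real (1 + k\<^sup>2) * w + 1) / (w + 1)"
    using moebius[of "1 + k\<^sup>2" 1 1 1] by (simp add: letter_map_moebius)
  also have "\<dots> = ((w + 1) + of_real (k\<^sup>2) * w) / (w + 1)" by (simp add: algebra_simps)
  also have "\<dots> = 1 + of_real (k\<^sup>2) * (w / (w + 1))" 
    using nz' by (simp add: add_divide_distrib[of "w + 1" _ "w + 1"])
  finally show "letter_map (True, True) w = 1 + of_real (k\<^sup>2) * (w / (w + 1))" .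
  show "letter_map (True, False) w = (w - 1) / (of_real (1 + k\<^sup>2) - w)"
    using moebius[of 1 "- 1" "- 1" "1 + k\<^sup>2"] by (simp add: letter_map_moebius)
  have "letter_map (False, True) w = (of_real (1 + k\<^sup>2) * w - 1) / (1 - w)"
    using moebius[of "1 + k\<^sup>2" "- 1" "- 1" 1] by (simp add: letter_map_moebius)
  also have "\<dots> = (of_real (k\<^sup>2) * w - (1 - w)) / (1 - w)" by (simp add: algebra_simps)
  also have "\<dots> = - 1 + of_real (k\<^sup>2) * (w / (1 - w))"
    using nz' by (simp add: diff_divide_distrib[of _ "1 - w" "1 - w"])
  finally show "letter_map (False, True) w = - 1 + of_real (k\<^sup>2) * (w / (1 - w))" .
  show "letter_map (False, False) w = (w + 1) / (of_real (1 + k\<^sup>2) + w)"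
    using moebius[of 1 1 1 "1 + k\<^sup>2"] by (simp add: letter_map_moebius add.commute)
qed

text \<open>For the generators, Re (w / (w + 1)) and Re (w / (1 - w)) have the signs of
  \<bar>w\<bar>^2 + Re w and Re w - \<bar>w\<bar>^2. For the inverses, multiplying the half disc
  inequality of the image by the squared modulus of the denominator leaves k^2 (\<plusminus> Re w -
  1) < 0.\<close>

lemma letter_map_ping_pong:
  assumes w: "w \<in> side_exterior (inv_letter l)"
  shows "letter_map l w \<in> side_region l"
proof -
  have pos: "Im w > 0" using w by (simp add: side_exterior_def)
  have H: "letter_map l w \<in> hyp_plane"
    using hyp_isometry_closed[OF hyp_isometry_PSL2R[OF letter_map_PSL2R] pos] by simp
  have Re_divide': "Re (u / v) = Re (u * cnj v) / (cmod v)\<^sup>2" for u v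
    by (simp add: Re_divide cmod_power2)
  have sq: "(cmod v)\<^sup>2 = Re v * Re v + Im v * Im v" for v
    by (simp only: cmod_power2) (simp only: power2_eq_square)
  have Re_scale: "Re (of_real c * v) = c * Re v" for c v by simp
  have nz: "cmod v > 0" if "Im v \<noteq> 0" for v
    using that by (auto simp: complex_eq_iff)
  have div_neg: "(cmod (u / v))\<^sup>2 + e * Re (u / v) < 0"
    if "(cmod u)\<^sup>2 + e * Re (u * cnj v) < 0" "Im v \<noteq> 0" for u v e
  proof -
    have "(cmod (u / v))\<^sup>2 + e * Re (u / v) = ((cmod u)\<^sup>2 + e * Re (u * cnj v)) / (cmod v)\<^sup>2"
      by (simp only: Re_divide' norm_divide power_divide) (simp only: add_divide_distrib times_divide_eq_right)
    also have "\<dots> < 0" using that(1) nz[OF that(2)] by (intro divide_neg_pos) auto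
    finally show ?thesis .
  qed
  consider "l = (True, True)" | "l = (True, False)" | "l = (False, True)" | "l = (False, False)"
    by (cases l) auto
  then show ?thesis
  proof cases
    case 1
    have "(cmod w)\<^sup>2 + Re w > 0" using w by (simp add: 1 side_exterior_def inv_letter_def)
    then have "Re (w * cnj (w + 1)) > 0" using sq[of w] by (simp add: algebra_simps)
    then have "Re (w / (w + 1)) > 0" using nz[of "w + 1"] pos unfolding Re_divide' by simp
    then have "k\<^sup>2 * Re (w / (w + 1)) > 0" using k_pos by simp
    then have "Re (letter_map l w) > 1" unfolding 1 letter_map_apply[OF pos]
      by (simp only: plus_complex.sel uminus_complex.sel one_complex.sel Re_scale)
    then show ?thesis using H by (simp add: 1 side_region_def)
  next
    case 2
    have "Re w < 1" using w by (simp add: 2 side_exterior_def inv_letter_def)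
    moreover have "(cmod (w - 1))\<^sup>2 + 1 * Re ((w - 1) * cnj (of_real (1 + k\<^sup>2) - w)) = k\<^sup>2 * (Re w - 1)"
      unfolding sq by (simp add: power2_eq_square algebra_simps)
    ultimately have "(cmod (w - 1))\<^sup>2 + 1 * Re ((w - 1) * cnj (of_real (1 + k\<^sup>2) - w)) < 0"
      using k_pos by (simp only: mult_less_0_iff) simp
    from div_neg[OF this] have "(cmod (letter_map l w))\<^sup>2 + Re (letter_map l w) < 0"
      using pos unfolding 2 letter_map_apply[OF pos] by simp
    then show ?thesis using H by (simp add: 2 side_region_def)
  next
    case 3
    have "(cmod w)\<^sup>2 - Re w > 0" using w by (simp add: 3 side_exterior_def inv_letter_def)
    then have "Re (w * cnj (1 - w)) < 0" using sq[of w] by (simp add: algebra_simps)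
    then have "Re (w / (1 - w)) < 0" using nz[of "1 - w"] pos unfolding Re_divide'
      by (simp add: divide_neg_pos)
    then have "k\<^sup>2 * Re (w / (1 - w)) < 0" using k_pos by (simp add: mult_pos_neg)
    then have "Re (letter_map l w) < - 1" unfolding 3 letter_map_apply[OF pos]
      by (simp only: plus_complex.sel uminus_complex.sel one_complex.sel Re_scale)
    then show ?thesis using H by (simp add: 3 side_region_def)
  next
    case 4
    have "- Re w < 1" using w by (simp add: 4 side_exterior_def inv_letter_def)
    moreover have "(cmod (w + 1))\<^sup>2 + - 1 * Re ((w + 1) * cnj (of_real (1 + k\<^sup>2) + w)) = k\<^sup>2 * (- Re w - 1)"
      unfolding sq by (simp add: power2_eq_square algebra_simps)
    ultimately have "(cmod (w + 1))\<^sup>2 + - 1 * Re ((w + 1) * cnj (of_real (1 + k\<^sup>2) + w)) < 0"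
      using k_pos by (simp only: mult_less_0_iff) simp
    from div_neg[OF this] have "(cmod (letter_map l w))\<^sup>2 - Re (letter_map l w) < 0"
      using pos unfolding 4 letter_map_apply[OF pos] by simp
    then show ?thesis using H by (simp add: 4 side_region_def)
  qed
qed

text \<open>Letters act from the right. By reducedness the region reached by the tail does not
  belong to the inverse of the next letter, so it lies in the exterior on which that letter can
  play.\<close>

lemma word_map_ping_pong:
  assumes "reduced_word w" "w \<noteq> []" "\<And>l. z \<in> side_exterior l"
  shows "word_map w z \<in> side_region (hd w)"
  using assms(1,2)
proof (induction w)
  case (Cons l w)
  have pos: "Im z > 0" using assms(3)[of "(True, True)"] by (simp add: side_exterior_def)
  have "word_map w z \<in> side_exterior (inv_letter l)"
  proof (cases "w = []")
    case True
    then show ?thesis using assms(3) pos word_map_Nil_apply by simp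
  next
    case False
    then show ?thesis
      using Cons side_region_subset_exterior[of "hd w" "inv_letter l"] by (auto simp: reduced_word_Cons)
  qed
  then show ?case using letter_map_ping_pong word_map_Cons_apply[OF pos] by simp
qed simp

text \<open>The value 13/12 makes the Euclidean distance \<open>d\<close> to \<open>2 * \<i>\<close>
  satisfy \<open>3 * d\<^sup>2 < Im w \<le> 2 + d\<close>, which forces \<open>d < 1\<close>. Then
  \<bar>Re w\<bar> < 1 < Im w, and such points avoid all four half planes.\<close>

lemma near_base_point_exterior:
  assumes "w \<in> hyp_plane" "hyp_dist (2 * \<i>) w < arcosh (13 / 12)"
  shows "w \<in> side_exterior l"
proof -
  define d where "d = cmod (2 * \<i> - w)"
  have w: "Im w > 0" using assms by simp
  have "cosh (hyp_dist (2 * \<i>) w) < cosh (arcosh (13 / 12))"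
    using assms(2) hyp_dist_nonneg[of "2 * \<i>" w] w
      cosh_real_nonneg_less_iff[of "hyp_dist (2 * \<i>) w" "arcosh (13 / 12)"]
    by (simp del: cosh_arcosh_real)
  then have "1 + d\<^sup>2 / (2 * 2 * Im w) < 13 / 12"
    using w by (simp add: cosh_hyp_dist d_def)
  then have "3 * d\<^sup>2 < Im w" using w by (simp add: field_simps)
  also have "\<dots> \<le> 2 + d" using abs_Im_le_cmod[of "2 * \<i> - w"] by (simp add: d_def)
  finally have d: "3 * d\<^sup>2 < 2 + d" .
  have "d < 1"
  proof (rule ccontr)
    assume "\<not> d < 1"
    then have "d \<le> d * d" using mult_right_mono[of 1 d d] by simp
    then have "3 * d < 2 + d" using d unfolding power2_eq_square by linarith
    then show False using \<open>\<not> d < 1\<close> by simp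
  qed
  then have "\<bar>Re w\<bar> < 1" "\<bar>2 - Im w\<bar> < 1"
    using abs_Re_le_cmod[of "2 * \<i> - w"] abs_Im_le_cmod[of "2 * \<i> - w"] by (simp_all add: d_def)
  then have re: "\<bar>Re w\<bar> < 1" and im: "Im w > 1" by auto
  have "1 * 1 < Im w * Im w" using im by (intro mult_strict_mono) auto
  moreover have "0 \<le> Re w * Re w" by simp
  ultimately have "1 < Re w * Re w + Im w * Im w" by linarith
  then have "(cmod w)\<^sup>2 > 1"
    by (simp add: cmod_power2 power2_eq_square[of "Re w"] power2_eq_square[of "Im w"])
  then show ?thesis using re w by (auto simp: side_exterior_def Let_def)
qed

end

section \<open>Discreteness and freeness of the explicit representation\<close>

locale fricke_representation = free_group_two_generators P a b + fricke_group k
  for P (structure) and a b k +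
  fixes \<rho>
  assumes hom: "\<rho> \<in> hom P (BijGroup hyp_plane)"
    and word: "\<rho> (word_value P a b w) = word_map w"
begin

lemma rho_PSL2R: "\<gamma> \<in> carrier P \<Longrightarrow> \<rho> \<gamma> \<in> PSL2R"
  by (metis carrier_reduced_wordE word word_map_PSL2R)

lemma rho_isometry: "\<gamma> \<in> carrier P \<Longrightarrow> hyp_isometry (\<rho> \<gamma>)"
  by (rule hyp_isometry_PSL2R[OF rho_PSL2R])

lemma rho_closed: "\<gamma> \<in> carrier P \<Longrightarrow> Im z > 0 \<Longrightarrow> Im (\<rho> \<gamma> z) > 0"
  by (rule hyp_isometry_closed[OF rho_isometry])

lemma rho_Bij: "\<gamma> \<in> carrier P \<Longrightarrow> \<rho> \<gamma> \<in> Bij hyp_plane"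
  using hom_in_carrier[OF hom] by (simp only: carrier_BijGroup)

lemma rho_mult_apply:
  assumes "\<gamma> \<in> carrier P" "\<delta> \<in> carrier P" "Im z > 0"
  shows "\<rho> (\<gamma> \<otimes> \<delta>) z = \<rho> \<gamma> (\<rho> \<delta> z)"
  using assms hom_mult[OF hom] by (simp add: mult_BijGroup_apply rho_Bij)

lemma rho_one_apply: "Im z > 0 \<Longrightarrow> \<rho> \<one> z = z"
  using hom_one[OF hom is_group group_BijGroup] by (simp add: one_BijGroup)

lemma rho_letter: "\<rho> (letter P a b l) = letter_map l"
  using word[of "[l]"] letter_closed[of l] generated.letter_closed[of l]
  by (simp only: word_value_Cons word_value_Nil r_one generated.r_one)

text \<open>Ping-pong sends the base point into a side region, whereas all points near the base
  point lie in every exterior.\<close>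

lemma base_point_moved:
  assumes "\<gamma> \<in> carrier P" "\<gamma> \<noteq> \<one>"
  shows "hyp_dist (2 * \<i>) (\<rho> \<gamma> (2 * \<i>)) \<ge> arcosh (13 / 12)"
proof (rule ccontr)
  assume "\<not> ?thesis"
  then have near: "\<rho> \<gamma> (2 * \<i>) \<in> side_exterior l" for l
    using rho_closed[OF assms(1), of "2 * \<i>"] by (intro near_base_point_exterior) auto
  have base: "2 * \<i> \<in> side_exterior l" for l
    by (rule near_base_point_exterior) (simp_all add: hyp_dist_def)
  obtain w where w: "reduced_word w" "\<gamma> = word_value P a b w"
    by (rule carrier_reduced_wordE[OF assms(1)])
  then have "w \<noteq> []" using assms(2) by auto
  from word_map_ping_pong[OF w(1) this base] near[of "hd w"] show False
    using side_region_disjoint[of "hd w"] w(2) word by auto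
qed

lemma orbit_separated:
  assumes "\<gamma> \<in> carrier P" "\<delta> \<in> carrier P" "\<gamma> \<noteq> \<delta>"
  shows "hyp_dist (\<rho> \<gamma> (2 * \<i>)) (\<rho> \<delta> (2 * \<i>)) \<ge> arcosh (13 / 12)"
proof -
  let ?\<eta> = "inv \<gamma> \<otimes> \<delta>"
  have \<eta>: "?\<eta> \<in> carrier P" using assms by simp
  have \<delta>: "\<delta> = \<gamma> \<otimes> ?\<eta>" using assms by (simp add: m_assoc[symmetric])
  then have "?\<eta> \<noteq> \<one>" using assms by auto
  have "hyp_dist (\<rho> \<gamma> (2 * \<i>)) (\<rho> \<gamma> (\<rho> ?\<eta> (2 * \<i>))) = hyp_dist (2 * \<i>) (\<rho> ?\<eta> (2 * \<i>))"
    using rho_isometry[OF assms(1)] rho_closed[OF \<eta>, of "2 * \<i>"] by (simp add: hyp_isometry_def)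
  also have "\<rho> \<gamma> (\<rho> ?\<eta> (2 * \<i>)) = \<rho> \<delta> (2 * \<i>)"
    using rho_mult_apply[OF assms(1) \<eta>, of "2 * \<i>"] \<delta> by simp
  finally show ?thesis using base_point_moved[OF \<eta> \<open>?\<eta> \<noteq> \<one>\<close>] by simp
qed

lemma properly_discontinuous:
  assumes "compact K" "K \<subseteq> hyp_plane"
  shows "finite {\<gamma> \<in> carrier P. \<rho> \<gamma> ` K \<inter> K \<noteq> {}}"
  by (rule properly_discontinuous_of_separated_orbit[of "2 * \<i>" "arcosh (13 / 12)"])
    (use rho_isometry orbit_separated assms in auto)

text \<open>All powers of \<open>\<gamma>\<close> fix \<open>z\<close>, and proper discontinuity for
  the compact set \<open>{z}\<close> leaves only finitely many of them.\<close>

lemma free_action: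
  assumes \<gamma>: "\<gamma> \<in> carrier P" and z: "z \<in> hyp_plane" "\<rho> \<gamma> z = z"
  shows "\<gamma> = \<one>"
proof (rule finite_powers_imp_one[OF \<gamma>])
  have "\<rho> (\<gamma> [^] n) z = z" for n :: nat
  proof (induction n)
    case (Suc n)
    then show ?case using \<gamma> z rho_mult_apply[of "\<gamma> [^] n" \<gamma> z] by simp
  qed (use z rho_one_apply in simp)
  then have "range (\<lambda>n::nat. \<gamma> [^] n) \<subseteq> {\<gamma> \<in> carrier P. \<rho> \<gamma> ` {z} \<inter> {z} \<noteq> {}}"
    using \<gamma> by auto
  moreover have "finite {\<gamma> \<in> carrier P. \<rho> \<gamma> ` {z} \<inter> {z} \<noteq> {}}"
    using z by (intro properly_discontinuous) auto
  ultimately show "finite (range (\<lambda>n::nat. \<gamma> [^] n))" by (rule finite_subset)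
qed

lemma rho_generators:
  "\<rho> a = letter_map (True, True)" "\<rho> (inv a) = letter_map (True, False)"
  "\<rho> b = letter_map (False, True)" "\<rho> (inv b) = letter_map (False, False)"
  using rho_letter[of "(True, True)"] rho_letter[of "(True, False)"]
    rho_letter[of "(False, True)"] rho_letter[of "(False, False)"]
  by (simp_all add: letter_def)

lemmas rho_mult = hom_mult_real_moebius[OF hom]

lemma rho_ab: "\<rho> (a \<otimes> b) = real_moebius (k\<^sup>2 + 2) (- 1) 1 0"
proof -
  have "(1 + k\<^sup>2) / k * ((1 + k\<^sup>2) / k) + 1 / k * (- (1 / k)) = k\<^sup>2 + 2"
    "(1 + k\<^sup>2) / k * (- (1 / k)) + 1 / k * (1 / k) = - 1"
    "1 / k * ((1 + k\<^sup>2) / k) + 1 / k * (- (1 / k)) = 1"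
    "1 / k * (- (1 / k)) + 1 / k * (1 / k) = 0"
    using k_pos by (simp_all add: field_simps power2_eq_square)
  with rho_mult[OF a_closed b_closed rho_generators(1,3)[unfolded letter_map_moebius] det_A det_B]
  show ?thesis by (simp only:)
qed

lemma rho_a_inv_b_inv: "\<rho> (inv a \<otimes> inv b) = real_moebius 0 (- 1) 1 (k\<^sup>2 + 2)"
proof -
  have "1 / k * (1 / k) + - (1 / k) * (1 / k) = 0"
    "1 / k * (1 / k) + - (1 / k) * ((1 + k\<^sup>2) / k) = - 1"
    "- (1 / k) * (1 / k) + (1 + k\<^sup>2) / k * (1 / k) = 1"
    "- (1 / k) * (1 / k) + (1 + k\<^sup>2) / k * ((1 + k\<^sup>2) / k) = k\<^sup>2 + 2"
    using k_pos by (simp_all add: field_simps power2_eq_square)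
  with rho_mult[OF inv_closed[OF a_closed] inv_closed[OF b_closed]
      rho_generators(2,4)[unfolded letter_map_moebius] det_A_inv det_B_inv]
  show ?thesis by (simp only:)
qed

section \<open>The cusp and a strip of finite area meeting every orbit\<close>

lemma commutator_closed: "commutator_of P a b \<in> carrier P"
  using a_closed b_closed by (simp add: commutator_of_def)

lemma rho_commutator: "\<rho> (commutator_of P a b) = real_moebius (- 1) (- (2 * (k\<^sup>2 + 2))) 0 (- 1)"
proof -
  have "commutator_of P a b = a \<otimes> b \<otimes> (inv a \<otimes> inv b)"
    using a_closed b_closed by (simp add: commutator_of_def m_assoc)
  then show ?thesis
    using rho_mult[OF _ _ rho_ab rho_a_inv_b_inv] a_closed b_closed by simp
qed

lemma rho_commutator_apply:
  assumes "Im z > 0"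
  shows "\<rho> (commutator_of P a b) z = z + of_real (2 * (k\<^sup>2 + 2))"
    "\<rho> (inv (commutator_of P a b)) z = z - of_real (2 * (k\<^sup>2 + 2))"
proof -
  have *: "\<rho> (commutator_of P a b) w = w + of_real (2 * (k\<^sup>2 + 2))" if "Im w > 0" for w
    using that unfolding rho_commutator by (simp add: real_moebius_apply)
  then show "\<rho> (commutator_of P a b) z = z + of_real (2 * (k\<^sup>2 + 2))" using assms .
  have "Im (\<rho> (inv (commutator_of P a b)) z) > 0"
    using rho_closed commutator_closed assms by simp
  from *[OF this] show "\<rho> (inv (commutator_of P a b)) z = z - of_real (2 * (k\<^sup>2 + 2))"
    using rho_mult_apply[of "commutator_of P a b" "inv (commutator_of P a b)" z]
      commutator_closed assms rho_one_apply by (simp add: algebra_simps)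
qed

lemma parabolic_commutator: "parabolic (\<rho> (commutator_of P a b))"
  unfolding parabolic_def
proof (intro conjI exI)
  show "\<rho> (commutator_of P a b) = real_moebius (- 1) (- (2 * (k\<^sup>2 + 2))) 0 (- 1)"
    by (rule rho_commutator)
  show "\<rho> (commutator_of P a b) \<noteq> (\<lambda>z\<in>hyp_plane. z)"
  proof
    assume "\<rho> (commutator_of P a b) = (\<lambda>z\<in>hyp_plane. z)"
    then have "\<i> + of_real (2 * (k\<^sup>2 + 2)) = \<i>"
      using rho_commutator_apply(1)[of \<i>] by simp
    then have "k\<^sup>2 + 2 = 0" by (simp add: complex_eq_iff)
    then show False using zero_le_power2[of k] by linarith
  qed
qed simp_all

text \<open>The commutator translates by \<open>2 * (k\<^sup>2 + 2)\<close>, the width of the strip.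
  Each translation lowers the odd multiple of the half width by two, so \<open>n\<close> bounds the
  number of translations.\<close>

lemma translate_to_strip:
  assumes "\<bar>Re z\<bar> \<le> real (2 * n + 1) * (k\<^sup>2 + 2)" "Im z > 0"
  shows "\<exists>\<gamma>\<in>carrier P. \<bar>Re (\<rho> \<gamma> z)\<bar> \<le> k\<^sup>2 + 2 \<and> Im (\<rho> \<gamma> z) = Im z"
  using assms
proof (induction n arbitrary: z)
  case 0
  then show ?case by (intro bexI[of _ \<one>]) (simp_all add: rho_one_apply)
next
  case (Suc n)
  let ?c = "commutator_of P a b" and ?m = "k\<^sup>2 + 2"
  have m: "?m > 0" using zero_le_power2[of k] by linarith
  have step: ?case if \<delta>: "\<delta> \<in> carrier P" "Im (\<rho> \<delta> z) = Im z"
    and re: "\<bar>Re (\<rho> \<delta> z)\<bar> \<le> real (2 * n + 1) * ?m" for \<delta>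
  proof -
    obtain \<gamma> where \<gamma>: "\<gamma> \<in> carrier P" "\<bar>Re (\<rho> \<gamma> (\<rho> \<delta> z))\<bar> \<le> ?m" "Im (\<rho> \<gamma> (\<rho> \<delta> z)) = Im (\<rho> \<delta> z)"
      using Suc.IH[OF re] \<delta> Suc.prems(2) by auto
    then show ?thesis
      using \<delta> Suc.prems(2) by (intro bexI[of _ "\<gamma> \<otimes> \<delta>"]) (simp_all add: rho_mult_apply)
  qed
  have M: "real (2 * Suc n + 1) * ?m = real (2 * n + 1) * ?m + 2 * ?m" "?m \<le> real (2 * n + 1) * ?m"
    using m by (simp_all add: algebra_simps)
  consider "\<bar>Re z\<bar> \<le> ?m" | "Re z > ?m" | "Re z < - ?m" by linarith
  then show ?case
  proof cases
    case 1
    then show ?thesis using Suc.prems(2) by (intro bexI[of _ \<one>]) (simp_all add: rho_one_apply)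
  next
    case 2
    show ?thesis
      by (rule step[of "inv ?c"]) (use 2 M Suc.prems commutator_closed in \<open>simp_all add: rho_commutator_apply\<close>)
  next
    case 3
    show ?thesis
      by (rule step[of ?c]) (use 3 M Suc.prems commutator_closed in \<open>simp_all add: rho_commutator_apply\<close>)
  qed
qed

lemma orbit_meets_strip:
  assumes "Im z > 0"
  shows "\<exists>\<gamma>\<in>carrier P. \<bar>Re (\<rho> \<gamma> z)\<bar> \<le> k\<^sup>2 + 2 \<and> Im (\<rho> \<gamma> z) = Im z"
proof -
  obtain j :: nat where "\<bar>Re z\<bar> \<le> real j" using real_arch_simple by blast
  also have "real j \<le> real (2 * j + 1) * 1" by simp
  also have "\<dots> \<le> real (2 * j + 1) * (k\<^sup>2 + 2)"
    using zero_le_power2[of k] by (intro mult_left_mono) (linarith, simp)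
  finally show ?thesis using assms by (rule translate_to_strip)
qed

text \<open>The isometric circles of the four letters have radius \<open>k\<close> and centres \<open>\<plusminus> 1\<close>, \<open>\<plusminus> (1 + k\<^sup>2)\<close>. They
  cover the interval \<open>[-(k\<^sup>2 + 2), k\<^sup>2 + 2]\<close>, so every point of the strip close to the real
  axis can be raised.\<close>

definition overlap :: real where
  "overlap = max 1 (k\<^sup>2 / 2)"

text \<open>The number is the largest distance from a point of the interval to the nearest centre: 1
  between -1 and 1 and at the two ends, \<open>k\<^sup>2 / 2\<close> between \<plusminus> 1 and
  \<plusminus> (1 + k^2). Being below the radius \<open>k\<close>, it leaves room for a uniform gain
  in height.\<close>

lemma overlap: "1 \<le> overlap" "k\<^sup>2 / 2 \<le> overlap" "overlap < k"
proof -
  have "k * k < k * 2" using k_gt k_lt by (intro mult_strict_left_mono) auto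
  then show "1 \<le> overlap" "k\<^sup>2 / 2 \<le> overlap" "overlap < k"
    using k_gt by (auto simp: overlap_def power2_eq_square)
qed

text \<open>The midpoint between \<open>overlap\<^sup>2 / k\<^sup>2\<close> and 1. The next constant
  is chosen so that a point of at most that height, at horizontal distance at most
  \<open>overlap\<close> from a centre, has squared distance at most
  \<open>raise_ratio * k\<^sup>2\<close> from it.\<close>

definition raise_ratio :: real where
  "raise_ratio = (overlap\<^sup>2 + k\<^sup>2) / (2 * k\<^sup>2)"

definition raise_bound :: real where
  "raise_bound = sqrt ((k\<^sup>2 - overlap\<^sup>2) / 2)"

lemma raise: "0 < raise_ratio" "raise_ratio < 1" "raise_bound > 0"
  "overlap\<^sup>2 + raise_bound\<^sup>2 = raise_ratio * k\<^sup>2"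
proof -
  have sq: "overlap\<^sup>2 < k\<^sup>2" using overlap by (intro power_strict_mono) auto
  have k2: "k\<^sup>2 > 0" using k_pos by simp
  show "0 < raise_ratio"
    unfolding raise_ratio_def using k2 by (intro divide_pos_pos add_nonneg_pos) auto
  show "raise_ratio < 1"
    unfolding raise_ratio_def using sq k2 by (subst pos_divide_less_eq) auto
  show "raise_bound > 0" using sq by (simp add: raise_bound_def)
  have "raise_bound\<^sup>2 = (k\<^sup>2 - overlap\<^sup>2) / 2" using sq by (simp add: raise_bound_def)
  then show "overlap\<^sup>2 + raise_bound\<^sup>2 = raise_ratio * k\<^sup>2"
  proof -
    have "raise_ratio * k\<^sup>2 = (overlap\<^sup>2 + k\<^sup>2) / 2" using k2 by (simp add: raise_ratio_def)
    then show ?thesis using \<open>raise_bound\<^sup>2 = (k\<^sup>2 - overlap\<^sup>2) / 2\<close> by simp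
  qed
qed

lemma raise_low_point:
  assumes re: "\<bar>Re z\<bar> \<le> k\<^sup>2 + 2" and im: "0 < Im z" "Im z \<le> raise_bound"
  shows "\<exists>\<gamma>\<in>carrier P. Im (\<rho> \<gamma> z) \<ge> Im z / raise_ratio"
proof -
  have raised: "Im (real_moebius p q (c / k) (d / k) z) \<ge> Im z / raise_ratio"
    if det: "p * (d / k) - q * (c / k) = 1" and near: "(c * Re z + d)\<^sup>2 \<le> overlap\<^sup>2" and c: "c\<^sup>2 = 1" for p q c d
  proof -
    let ?D = "cmod (of_real (c / k) * z + of_real (d / k))"
    have "?D > 0" using moebius_denominator_nonzero[OF det im(1)] by simp
    then have D: "0 < ?D\<^sup>2" by simp
    have "?D\<^sup>2 * k\<^sup>2 = (c * Re z + d)\<^sup>2 + c\<^sup>2 * (Im z)\<^sup>2"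
      using k_pos by (simp add: cmod_power2 power_mult_distrib power_divide add_divide_distrib[symmetric] distrib_right)
        (simp add: add_divide_distrib)
    also have "\<dots> \<le> overlap\<^sup>2 + raise_bound\<^sup>2"
      using near im c by (intro add_mono) (auto intro: power_mono)
    also have "\<dots> = raise_ratio * k\<^sup>2" by (rule raise)
    finally have "?D\<^sup>2 \<le> raise_ratio" using k_pos by simp
    then show ?thesis
      using D im(1) raise(1) unfolding Im_real_moebius[OF det im(1)] by (intro divide_left_mono) auto
  qed
  have close: "(c * Re z + d)\<^sup>2 \<le> overlap\<^sup>2" if "\<bar>c * Re z + d\<bar> \<le> overlap" for c d
    using that overlap(1) by (intro abs_le_square_iff[THEN iffD1]) auto
  \<comment> \<open>The four cases are the centres -1, 1, 1 + k^2 and -(1 + k^2), in this order;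
    \<open>c\<close> is 1 or -1, so the expressions are distances to the centre.\<close>
  consider "\<bar>1 * Re z + 1\<bar> \<le> overlap" | "\<bar>- 1 * Re z + 1\<bar> \<le> overlap"
    | "\<bar>- 1 * Re z + (1 + k\<^sup>2)\<bar> \<le> overlap" | "\<bar>1 * Re z + (1 + k\<^sup>2)\<bar> \<le> overlap"
    using re overlap(1,2) by (simp add: abs_le_iff field_simps) linarith
  then show ?thesis
  proof cases
    case 1
    from raised[OF det_A close[OF this]] show ?thesis
      using a_closed by (intro bexI[of _ a]) (simp_all add: rho_generators letter_map_moebius)
  next
    case 2
    from raised[OF _ close[OF this], of "(1 + k\<^sup>2) / k" "- (1 / k)"] show ?thesis
      using b_closed det_B by (intro bexI[of _ b]) (simp_all add: rho_generators letter_map_moebius)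
  next
    case 3
    from raised[OF _ close[OF this], of "1 / k" "- (1 / k)"] show ?thesis
      using a_closed det_A_inv by (intro bexI[of _ "inv a"]) (simp_all add: rho_generators letter_map_moebius)
  next
    case 4
    from raised[OF det_B_inv close[OF this]] show ?thesis
      using b_closed by (intro bexI[of _ "inv b"]) (simp_all add: rho_generators letter_map_moebius)
  qed
qed

definition cusp_strip :: "complex set" where
  "cusp_strip = {z. \<bar>Re z\<bar> \<le> k\<^sup>2 + 2 \<and> raise_bound \<le> Im z}"

text \<open>\<open>n\<close> bounds the number of raises still required. Each one divides the height
  by at least \<open>raise_ratio\<close>, and moving the point back into the strip beforehand
  preserves its height.\<close>

lemma orbit_meets_cusp_strip_power:
  assumes "Im z > 0" "Im z / raise_ratio ^ n \<ge> raise_bound"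
  shows "\<exists>\<gamma>\<in>carrier P. \<rho> \<gamma> z \<in> cusp_strip"
  using assms
proof (induction n arbitrary: z)
  case (0 z)
  obtain \<gamma> where "\<gamma> \<in> carrier P" "\<bar>Re (\<rho> \<gamma> z)\<bar> \<le> k\<^sup>2 + 2" "Im (\<rho> \<gamma> z) = Im z"
    using orbit_meets_strip[OF 0(1)] by blast
  then show ?case using 0(2) by (auto simp: cusp_strip_def)
next
  case (Suc n z)
  obtain \<gamma> where \<gamma>: "\<gamma> \<in> carrier P" "\<bar>Re (\<rho> \<gamma> z)\<bar> \<le> k\<^sup>2 + 2" "Im (\<rho> \<gamma> z) = Im z"
    using orbit_meets_strip[OF Suc.prems(1)] by blast
  show ?case
  proof (cases "Im z \<ge> raise_bound")
    case True
    then show ?thesis using \<gamma> by (auto simp: cusp_strip_def)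
  next
    case False
    then obtain \<delta> where \<delta>: "\<delta> \<in> carrier P" "Im (\<rho> \<delta> (\<rho> \<gamma> z)) \<ge> Im z / raise_ratio"
      using raise_low_point[OF \<gamma>(2)] \<gamma>(3) Suc.prems(1) by auto
    let ?w = "\<rho> \<delta> (\<rho> \<gamma> z)"
    have pos: "Im ?w > 0" using rho_closed \<gamma>(1) \<delta>(1) Suc.prems(1) by simp
    have "raise_bound \<le> Im z / raise_ratio / raise_ratio ^ n" using Suc.prems(2) by simp
    also have "\<dots> \<le> Im ?w / raise_ratio ^ n"
      using \<delta>(2) raise(1) by (intro divide_right_mono) auto
    finally obtain \<eta> where "\<eta> \<in> carrier P" "\<rho> \<eta> ?w \<in> cusp_strip"
      using Suc.IH[OF pos] by blast
    then show ?thesis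
      using \<gamma>(1) \<delta>(1) Suc.prems(1) rho_closed
      by (intro bexI[of _ "\<eta> \<otimes> (\<delta> \<otimes> \<gamma>)"]) (simp_all add: rho_mult_apply)
  qed
qed

lemma orbit_meets_cusp_strip:
  assumes "Im z > 0"
  shows "\<exists>\<gamma>\<in>carrier P. \<rho> \<gamma> z \<in> cusp_strip"
proof -
  have "1 < 1 / raise_ratio" using raise by simp
  then obtain n where "raise_bound / Im z < (1 / raise_ratio) ^ n"
    using real_arch_pow by blast
  then have "raise_bound \<le> Im z / raise_ratio ^ n"
    using assms by (simp add: pos_divide_less_eq power_one_over mult.commute)
  then show ?thesis by (rule orbit_meets_cusp_strip_power[OF assms])
qed

lemma cusp_strip_covers: "hyp_plane \<subseteq> (\<Union>\<gamma>\<in>carrier P. \<rho> \<gamma> ` cusp_strip)"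
proof
  fix z assume "z \<in> hyp_plane"
  then have z: "Im z > 0" by simp
  obtain \<gamma> where \<gamma>: "\<gamma> \<in> carrier P" "\<rho> \<gamma> z \<in> cusp_strip"
    using orbit_meets_cusp_strip[OF z] by blast
  have "\<rho> (inv \<gamma>) (\<rho> \<gamma> z) = z"
    using rho_mult_apply[of "inv \<gamma>" \<gamma> z] \<gamma>(1) z rho_one_apply by simp
  then have "z \<in> \<rho> (inv \<gamma>) ` cusp_strip" using \<gamma>(2) by (metis imageI)
  then show "z \<in> (\<Union>\<gamma>\<in>carrier P. \<rho> \<gamma> ` cusp_strip)" using \<gamma>(1) by blast
qed

lemma hyperbolic_holonomy_rho: "hyperbolic_holonomy P (commutator_of P a b) \<rho>"
  unfolding hyperbolic_holonomy_def
proof (intro conjI ballI allI impI)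
  show "\<rho> \<in> hom P (BijGroup hyp_plane)" by (rule hom)
  show "\<rho> ` carrier P \<subseteq> PSL2R" using rho_PSL2R by blast
  show "parabolic (\<rho> (commutator_of P a b))" by (rule parabolic_commutator)
  show "finite {\<gamma> \<in> carrier P. \<rho> \<gamma> ` K \<inter> K \<noteq> {}}" if "compact K \<and> K \<subseteq> hyp_plane" for K
    using that by (intro properly_discontinuous) auto
  show "\<gamma> = \<one>" if "\<gamma> \<in> carrier P" "z \<in> hyp_plane" "\<rho> \<gamma> z = z" for \<gamma> z
    by (rule free_action[OF that])
  show "\<exists>D\<in>sets borel. D \<subseteq> hyp_plane \<and> hyp_plane \<subseteq> (\<Union>\<gamma>\<in>carrier P. \<rho> \<gamma> ` D) \<and> hyp_area D < \<infinity>"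
  proof (intro bexI conjI)
    have "closed cusp_strip"
      unfolding cusp_strip_def
      by (intro closed_Collect_conj closed_Collect_le continuous_intros)
    then show "cusp_strip \<in> sets borel" by (rule borel_closed)
    show "cusp_strip \<subseteq> hyp_plane" using raise(3) by (auto simp: cusp_strip_def)
    show "hyp_plane \<subseteq> (\<Union>\<gamma>\<in>carrier P. \<rho> \<gamma> ` cusp_strip)" by (rule cusp_strip_covers)
    show "hyp_area cusp_strip < \<infinity>"
      unfolding cusp_strip_def using raise(3) by (intro hyp_area_cusp_strip) auto
  qed
qed

lemma solution_of_quintic:
  assumes quintic: "k ^ 5 - k ^ 4 + 3 * k ^ 3 - 2 * k\<^sup>2 + 2 * k - 4 = 0"
  shows "\<exists>g. g \<in> teichmueller_space P (commutator_of P a b) \<and> Tr g a = Tr g b \<and>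
    Tr g (a [^] (2::nat)) = Tr g (a [^] (2::nat) \<otimes> b)"
proof -
  define g where "g = same_metric P (commutator_of P a b) `` {\<rho>}"
  have g: "g \<in> teichmueller_space P (commutator_of P a b)"
    unfolding g_def teichmueller_space_def using hyperbolic_holonomy_rho by (intro quotientI) simp
  have \<rho>: "\<rho> \<in> g"
    unfolding g_def by (rule equiv_class_self[OF equiv_same_metric]) (simp add: hyperbolic_holonomy_rho)
  define x where "x = (k\<^sup>2 + 2) / k"
  have "(k - 1)\<^sup>2 + 1 > 0" by (simp add: add_nonneg_pos)
  then have "2 * k < k\<^sup>2 + 2" by (simp add: power2_eq_square algebra_simps)
  then have x: "x > 2" using k_pos by (simp add: x_def pos_less_divide_eq)
  have trace: "(1 + k\<^sup>2) / k + 1 / k = x" by (simp add: x_def add_divide_distrib[symmetric])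
  note A = rho_generators(1)[unfolded letter_map_moebius] and B = rho_generators(3)[unfolded letter_map_moebius]
  have "Tr g a = x"
    using Tr_eq_abs_trace[OF g \<rho> a_closed A det_A] x unfolding trace by simp
  moreover have "Tr g b = x"
    using Tr_eq_abs_trace[OF g \<rho> b_closed B det_B] x unfolding trace by simp
  moreover have "Tr g (a [^] (2::nat)) = x\<^sup>2 - 2"
  proof -
    have tr: "(1 + k\<^sup>2) / k * ((1 + k\<^sup>2) / k) + 1 / k * (1 / k) + (1 / k * (1 / k) + 1 / k * (1 / k)) = x\<^sup>2 - 2"
      using k_pos by (simp add: x_def field_simps power2_eq_square)
    have "2 * 2 < x * x" using x by (intro mult_strict_mono) auto
    then have "x\<^sup>2 - 2 > 2" by (simp add: power2_eq_square)
    moreover have "a [^] (2::nat) = a \<otimes> a" using a_closed by (simp add: numeral_2_eq_2)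
    ultimately show ?thesis
      using Tr_eq_abs_trace[OF g \<rho> m_closed[OF a_closed a_closed] rho_mult[OF a_closed a_closed A A det_A det_A]
          det_mult[OF det_A det_A]] unfolding tr by simp
  qed
  moreover have "Tr g (a [^] (2::nat) \<otimes> b) = (1 + k\<^sup>2) * x"
  proof -
    have tr: "(1 + k\<^sup>2) / k * (k\<^sup>2 + 2) + 1 / k * 1 + (1 / k * - 1 + 1 / k * 0) = (1 + k\<^sup>2) * x"
      by (simp add: x_def)
    have "1 * x \<le> (1 + k\<^sup>2) * x" using x by (intro mult_right_mono) auto
    then have "(1 + k\<^sup>2) * x > 2" using x by linarith
    \<comment> \<open>This bracketing allows the matrix already found for the product of the
      generators to be used again.\<close>
    moreover have "a [^] (2::nat) \<otimes> b = a \<otimes> (a \<otimes> b)"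
      using a_closed b_closed by (simp add: numeral_2_eq_2 m_assoc)
    moreover have det: "(k\<^sup>2 + 2) * 0 - - 1 * 1 = (1::real)" by simp
    ultimately show ?thesis
      using Tr_eq_abs_trace[OF g \<rho> m_closed[OF a_closed m_closed[OF a_closed b_closed]]
          rho_mult[OF a_closed m_closed[OF a_closed b_closed] A rho_ab det_A det] det_mult[OF det_A det]]
      unfolding tr by simp
  qed
  moreover have "x\<^sup>2 - 2 = (1 + k\<^sup>2) * x"
  proof -
    have xk: "x * k = k\<^sup>2 + 2" using k_pos by (simp add: x_def)
    \<comment> \<open>Multiplication by \<open>k\<^sup>2\<close> clears the denominators of
      \<open>x\<close> and yields the negative of the quintic.\<close>
    have "(x\<^sup>2 - 2 - (1 + k\<^sup>2) * x) * k\<^sup>2 = (x * k)\<^sup>2 - 2 * k\<^sup>2 - (1 + k\<^sup>2) * k * (x * k)"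
      by (simp add: power2_eq_square algebra_simps)
    also have "\<dots> = - (k ^ 5 - k ^ 4 + 3 * k ^ 3 - 2 * k\<^sup>2 + 2 * k - 4)"
      unfolding xk by (simp add: eval_nat_numeral algebra_simps)
    finally have "(x\<^sup>2 - 2 - (1 + k\<^sup>2) * x) * k\<^sup>2 = 0" using quintic by simp
    then show ?thesis using k_pos by simp
  qed
  ultimately show ?thesis using g by auto
qed

end

section \<open>Existence of the solution and conclusion\<close>

context free_group_two_generators
begin

lemma solution_exists:
  "\<exists>g. g \<in> teichmueller_space P (commutator_of P a b) \<and> Tr g a = Tr g b \<and>
    Tr g (a [^] (2::nat)) = Tr g (a [^] (2::nat) \<otimes> b)"
proof -
  let ?f = "\<lambda>k::real. k ^ 5 - k ^ 4 + 3 * k ^ 3 - 2 * k\<^sup>2 + 2 * k - 4"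
  have "continuous_on {1..2} ?f" by (intro continuous_intros)
  \<comment> \<open>The polynomial has the values -1 at 1 and 32 at 2, so the root also differs from
    both endpoints.\<close>
  then obtain k where k: "1 \<le> k" "k \<le> 2" "?f k = 0"
    using IVT'[of ?f 1 0 2] by auto
  moreover have "k \<noteq> 1" "k \<noteq> 2" using k(3) by auto
  ultimately interpret fricke_group k by unfold_locales auto
  obtain \<rho> where "\<rho> \<in> hom P (BijGroup hyp_plane)" "\<And>w. \<rho> (word_value P a b w) = word_map w"
    using hom_extension[OF generated.group_two_elements_axioms] by blast
  then interpret fricke_representation P a b k \<rho> by unfold_locales
  show ?thesis by (rule solution_of_quintic[OF k(3)])
qed

end

theorem lemma3p1:
  fixes P :: "('p, 'm) monoid_scheme" and a b :: 'p
  assumes "free_generators P a b"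
  shows "\<exists>!g. g \<in> teichmueller_space P (commutator_of P a b) \<and>
           Tr g a = Tr g b \<and>
           Tr g (a [^]\<^bsub>P\<^esub> (2::nat)) = Tr g (a [^]\<^bsub>P\<^esub> (2::nat) \<otimes>\<^bsub>P\<^esub> b)"
proof -
  interpret free_group_two_generators P a b by (rule free_generators_locale[OF assms])
  show ?thesis
    using solution_exists solution_unique by (rule ex_ex1I) auto
qed

end
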